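(* Under the standing assumptions (1)-(4) in the context, for the closed-loop system (S) described in the context: (a) there exists a unique equilibrium state $z^*=(\varphi^*,\omega_M^*,\eta^*,\lambda^* )\in\Psi$, where $\Psi=\Phi\times\mathbb R^{n_M}\times\mathbb R\times\mathbb R$; (b) there exists a domain $\Psi^d\subset\Psi$ (a neighbourhood of $z^*$ in $\Psi$) such that for any initial state $z^0\in\Psi^d$ that satisfies the algebraic equations (S4) and (S6), the state trajectory of (S) starting at $z^0$ converges to the unique equilibrium state $z^*\in\Psi$.
   Context: Power system. $G=(\mathcal V,\mathcal E)$ is a finite connected undirected graph with $n$ nodes; $\mathcal V=\mathcal V_M\cup\mathcal V_F\cup\mathcal V_P$ is a disjoint union with $n_M,n_F,n_P$ elements respectively (synchronous machines, frequency dependent devices, passive loads), and node $1\in\mathcal V_M$. $B_{ij}=B_{ji}>0$ if $(i,j)\in\mathcal E$ and $B_{ij}=0$ otherwise. $M_i>0$ ($i\in\mathcal V_M$), $D_i>0$ ($i\in\mathcal V_M\cup\mathcal V_F$), $P_i\in\mathbb R$ ($i\in\mathcal V$), and $k\in(0,\infty)$ are constants. $\mathcal V_K\subseteq\mathcal V_M\cup\mathcal V_F$ is nonempty, with cost functions $J_i$, $i\in\mathcal V_K$. Convention: $(J_i')^{-1}(\lambda)$ is read as $0$ for $i\notin\mathcal V_K$. The closed-loop system in phase angles $\theta_i$, with $\theta_{ij}=\theta_i-\theta_j$, is $$\dot\theta_i=\omega_i,\ i\in\mathcal V_M\cup\mathcal V_F;\quad M_i\dot\omega_i=P_i-D_i\omega_i-\sum_{j\in\mathcal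 V}B_{ij}\sin\theta_{ij}+(J_i')^{-1}(\lambda),\ i\in\mathcal V_M;$$ $$0=P_i-D_i\omega_i-\sum_{j\in\mathcal V}B_{ij}\sin\theta_{ij}+(J_i')^{-1}(\lambda),\ i\in\mathcal V_F;\quad 0=P_i-\sum_{j\in\mathcal V}B_{ij}\sin\theta_{ij},\ i\in\mathcal V_P;$$ $$\dot\eta=\sum_{i\in\mathcal V_M\cup\mathcal V_F}D_i\omega_i;\quad 0=\sum_{i\in\mathcal V_K}(J_i')^{-1}(\lambda)+k\Big(\sum_{i\in\mathcal V_M}M_i\omega_i+\eta\Big).$$ With $\varphi_i=\theta_i-\theta_1$ (so $\varphi_1\equiv0$) and $\varphi_{ij}=\varphi_i-\varphi_j$, this becomes system (S): (S1) $\dot\varphi_i=\omega_i-\omega_1$, $i\in\mathcal V_M\cup\mathcal V_F$; (S2) $M_i\dot\omega_i=P_i-D_i\omega_i-\sum_{j\in\mathcal V}B_{ij}\sin\varphi_{ij}+(J_i')^{-1}(\lambda)$, $i\in\mathcal V_M$; (S3) $D_i\dot\varphi_i=P_i-D_i\omega_1-\sum_{j\in\mathcal V}B_{ij}\sin\varphi_{ij}+(J_i')^{-1}(\lambda)$, $i\in\mathcal V_F$; (S4) $0=P_i-\sum_{j\in\mathcal V}B_{ij}\sin\varphi_{ij}$, $i\in\mathcal V_P$; (S5) $\dot\eta=\sum_{i\in\mathcal V_M\cup\mathcal V_F}D_i\omega_i$; (S6) $0=\sum_{i\in\mathcal V_K}(J_i')^{-1}(\lambda)+k\big(\sum_{i\in\mathcal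 V_M}M_i\omega_i+\eta\big)$. Here for $i\in\mathcal V_F$ the term $D_i\omega_i$ in (S5) is replaced by $P_i-\sum_{j\in\mathcal V}B_{ij}\sin\varphi_{ij}+(J_i')^{-1}(\lambda)$, so (S) is a differential algebraic system with state variables $(\varphi_i)_{i\in\mathcal V_M\setminus\{1\}},(\varphi_i)_{i\in\mathcal V_F},\omega_M=(\omega_i)_{i\in\mathcal V_M},\eta$ and algebraic variables $(\varphi_i)_{i\in\mathcal V_P},\lambda$. An equilibrium state is a point at which all algebraic equations hold and all time derivatives vanish. The full state is $z=(\varphi,\omega_M,\eta,\lambda)$, and $$\Phi=\{\varphi\in\mathbb R^n:\ |\varphi_i-\varphi_j|<\tfrac{\pi}{2}\ \ \forall (i,j)\in\mathcal E,\ \varphi_1=0\}.$$ Standing assumptions. (1) The $P_i$ are constant in time, and there exist $u_i\in[\underline u_i,\overline u_i]$, $i\in\mathcal V_K$ (given bounds), with $\sum_{i\in\mathcal V}P_i+\sum_{i\in\mathcal V_K}u_i=0$; the bounds are regarded as incorporated in the cost functions. (2) $J_i:\mathbb R\to\mathbb R$, $i\in\mathcal V_K$, are twice continuously differentiable with $J_i''>0$ everywhere, and $(J_i')^{-1}$ is taken to be defined on $\mathbb R$. (3) All frequency deviations $\omega_i$, $i\in\mathcal V_M\cup\mathcal V_F$, are available to the controller and control inputs are applied without delay (as modelled by the closed-loop equations). (4) The closed-loop system in $\theta$ has a synchronous state $(\theta^*,\omega^*,\eta^*,\lambda^* )\in\mathbb R^n\times\mathbb R^n\times\mathbb R\times\mathbb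 R$, i.e. a solution with constant $\eta^*,\lambda^*$, with $\omega_i^*=\omega_{syn}$ and $\dot\theta_i^*=\omega_{syn}$ for a constant $\omega_{syn}$ and all $i$, and with $\theta^*(t)\in\Theta=\{\theta\in\mathbb R^n:\ |\theta_i-\theta_j|<\tfrac{\pi}{2}\ \forall(i,j)\in\mathcal E\}$. *)

theory Defs
  imports "HOL-Analysis.Analysis"
begin

text \<open>
  The nodes of the network are the elements of a finite type \<open>'n\<close>, so vectors in
  $\mathbb{R}^n$ have type \<open>real ^ 'n\<close>.  The classes of nodes are sets, because the
  frequency dependent devices and the passive loads may be absent.  The field \<open>ref\<close>
  is node 1.
\<close>

record 'n power_system =
  ref :: 'n
  machines :: "'n set"
  freq_devices :: "'n set"
  loads :: "'n set"
  controlled :: "'n set"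
  edges :: "('n \<times> 'n) set"
  coupling :: "'n \<Rightarrow> 'n \<Rightarrow> real"      (* B *)
  inertia :: "'n \<Rightarrow> real"             (* M *)
  damping :: "'n \<Rightarrow> real"             (* D *)
  injection :: "'n \<Rightarrow> real"           (* P *)
  gain :: real                      (* k *)
  cost :: "'n \<Rightarrow> real \<Rightarrow> real"          (* J *)
  u_min :: "'n \<Rightarrow> real"
  u_max :: "'n \<Rightarrow> real"

definition well_formed :: "'n::finite power_system \<Rightarrow> bool" where
  "well_formed S \<longleftrightarrow>
     machines S \<union> freq_devices S \<union> loads S = UNIV \<and>
     machines S \<inter> freq_devices S = {} \<and>
     machines S \<inter> loads S = {} \<and>
     freq_devices S \<inter> loads S = {} \<and>
     ref S \<in> machines S \<and>
     sym (edges S) \<and>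
     (\<forall>i j. (i, j) \<in> (edges S)\<^sup>*) \<and>
     (\<forall>i j. coupling S i j = coupling S j i) \<and>
     (\<forall>i j. if (i, j) \<in> edges S then coupling S i j > 0 else coupling S i j = 0) \<and>
     (\<forall>i\<in>machines S. inertia S i > 0) \<and>
     (\<forall>i\<in>machines S \<union> freq_devices S. damping S i > 0) \<and>
     gain S > 0 \<and>
     controlled S \<subseteq> machines S \<union> freq_devices S \<and>
     controlled S \<noteq> {}"

definition balance_feasible :: "'n::finite power_system \<Rightarrow> bool" where
  "balance_feasible S \<longleftrightarrow>
     (\<exists>u. (\<forall>i\<in>controlled S. u_min S i \<le> u i \<and> u i \<le> u_max S i) \<and>
          (\<Sum>i\<in>UNIV. injection S i) + (\<Sum>i\<in>controlled S. u i) = 0)"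

text \<open>
  Surjectivity of $J_i'$ expresses that $(J_i')^{-1}$ is defined on all of $\mathbb{R}$;
  injectivity follows from $J_i'' > 0$.
\<close>

definition admissible_costs :: "'n::finite power_system \<Rightarrow> bool" where
  "admissible_costs S \<longleftrightarrow>
     (\<forall>i\<in>controlled S.
        (\<forall>x. cost S i field_differentiable at x) \<and>
        (\<forall>x. deriv (cost S i) field_differentiable at x) \<and>
        continuous_on UNIV (deriv (deriv (cost S i))) \<and>
        (\<forall>x. deriv (deriv (cost S i)) x > 0) \<and>
        surj (deriv (cost S i)))"

definition control :: "'n::finite power_system \<Rightarrow> 'n \<Rightarrow> real \<Rightarrow> real" where
  "control S i l = (if i \<in> controlled S then inv (deriv (cost S i)) l else 0)"

definition flow :: "'n::finite power_system \<Rightarrow> real ^ 'n \<Rightarrow> 'n \<Rightarrow> real" where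
  "flow S x i = (\<Sum>j\<in>UNIV. coupling S i j * sin (x $ i - x $ j))"

definition Theta :: "'n::finite power_system \<Rightarrow> (real ^ 'n) set" where
  "Theta S = {x. \<forall>i j. (i, j) \<in> edges S \<longrightarrow> \<bar>x $ i - x $ j\<bar> < pi / 2}"

definition Phi :: "'n::finite power_system \<Rightarrow> (real ^ 'n) set" where
  "Phi S = {x \<in> Theta S. x $ ref S = 0}"


subsection \<open>The closed-loop system in the phase angles, on the time axis \<open>t \<ge> 0\<close>\<close>

text \<open>
  The component of \<open>w\<close> at a passive load does not occur in the equations.
\<close>

definition angle_solution ::
    "'n::finite power_system \<Rightarrow> (real \<Rightarrow> real ^ 'n) \<Rightarrow> (real \<Rightarrow> real ^ 'n) \<Rightarrow>
       (real \<Rightarrow> real) \<Rightarrow> (real \<Rightarrow> real) \<Rightarrow> bool" where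
  "angle_solution S \<theta> w \<eta> l \<longleftrightarrow>
     continuous_on {0..} \<theta> \<and> continuous_on {0..} l \<and>
     (\<forall>t\<ge>0.
       (\<forall>i\<in>machines S \<union> freq_devices S.
          ((\<lambda>s. \<theta> s $ i) has_real_derivative w t $ i) (at t within {0..})) \<and>
       (\<forall>i\<in>machines S.
          ((\<lambda>s. w s $ i) has_real_derivative
             (injection S i - damping S i * w t $ i - flow S (\<theta> t) i + control S i (l t))
               / inertia S i) (at t within {0..})) \<and>
       (\<forall>i\<in>freq_devices S.
          0 = injection S i - damping S i * w t $ i - flow S (\<theta> t) i + control S i (l t)) \<and>
       (\<forall>i\<in>loads S. 0 = injection S i - flow S (\<theta> t) i) \<and>
       (\<eta> has_real_derivative (\<Sum>i\<in>machines S \<union> freq_devices S. damping S i * w t $ i))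
         (at t within {0..}) \<and>
       0 = (\<Sum>i\<in>controlled S. control S i (l t))
           + gain S * ((\<Sum>i\<in>machines S. inertia S i * w t $ i) + \<eta> t))"

definition has_synchronous_state :: "'n::finite power_system \<Rightarrow> bool" where
  "has_synchronous_state S \<longleftrightarrow>
     (\<exists>\<theta> w \<eta> l w_syn.
        angle_solution S \<theta> w (\<lambda>t. \<eta>) (\<lambda>t. l) \<and>
        (\<forall>t\<ge>0. \<theta> t \<in> Theta S \<and>
          (\<forall>i. w t $ i = w_syn \<and>
               ((\<lambda>s. \<theta> s $ i) has_real_derivative w_syn) (at t within {0..}))))"


subsection \<open>The differential algebraic system in the angle differences\<close>

text \<open>
  A state is $(\varphi, \omega_M, \eta, \lambda)$.  The vector $\omega_M$, indexed by the
  machines only, is represented by its extension by zero to all nodes; likewise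
  $\varphi_1 = 0$ is imposed as a constraint.
\<close>

type_synonym 'n state = "(real ^ 'n) \<times> (real ^ 'n) \<times> real \<times> real"

definition state_space :: "'n::finite power_system \<Rightarrow> 'n state set" where
  "state_space S = {(x, w, \<eta>, l). x $ ref S = 0 \<and> (\<forall>i. i \<notin> machines S \<longrightarrow> w $ i = 0)}"

definition Psi :: "'n::finite power_system \<Rightarrow> 'n state set" where
  "Psi S = {(x, w, \<eta>, l). x \<in> Phi S \<and> (\<forall>i. i \<notin> machines S \<longrightarrow> w $ i = 0)}"

text \<open>
  For a frequency dependent device $i$, the equation
  $\dot\varphi_i = \omega_i - \omega_1$ merely defines the eliminated frequency
  $\omega_i$, so \<open>\<phi>_rate\<close> is given by the differential equation in which $\omega_i$ has
  been eliminated.  In \<open>\<eta>_rate\<close> the term $D_i \omega_i$ is replaced accordingly.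
\<close>

fun \<phi>_rate :: "'n::finite power_system \<Rightarrow> 'n \<Rightarrow> 'n state \<Rightarrow> real" where
  "\<phi>_rate S i (x, w, \<eta>, l) =
     (if i \<in> machines S then w $ i - w $ ref S
      else (injection S i - damping S i * w $ ref S - flow S x i + control S i l)
             / damping S i)"

fun \<omega>_rate :: "'n::finite power_system \<Rightarrow> 'n \<Rightarrow> 'n state \<Rightarrow> real" where
  "\<omega>_rate S i (x, w, \<eta>, l) =
     (injection S i - damping S i * w $ i - flow S x i + control S i l) / inertia S i"

fun \<eta>_rate :: "'n::finite power_system \<Rightarrow> 'n state \<Rightarrow> real" where
  "\<eta>_rate S (x, w, \<eta>, l) =
     (\<Sum>i\<in>machines S. damping S i * w $ i)
     + (\<Sum>i\<in>freq_devices S. injection S i - flow S x i + control S i l)"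

fun algebraic_eqs :: "'n::finite power_system \<Rightarrow> 'n state \<Rightarrow> bool" where
  "algebraic_eqs S (x, w, \<eta>, l) \<longleftrightarrow>
     (\<forall>i\<in>loads S. 0 = injection S i - flow S x i) \<and>
     0 = (\<Sum>i\<in>controlled S. control S i l)
         + gain S * ((\<Sum>i\<in>machines S. inertia S i * w $ i) + \<eta>)"

definition equilibrium :: "'n::finite power_system \<Rightarrow> 'n state \<Rightarrow> bool" where
  "equilibrium S z \<longleftrightarrow>
     z \<in> state_space S \<and>
     algebraic_eqs S z \<and>
     (\<forall>i\<in>machines S \<union> freq_devices S. \<phi>_rate S i z = 0) \<and>
     (\<forall>i\<in>machines S. \<omega>_rate S i z = 0) \<and>
     \<eta>_rate S z = 0"

text \<open>
  A solution on a time interval \<open>I\<close>: the state variables are differentiable (one-sidedly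
  at an end point) and the algebraic variables are continuous.  Without continuity of the
  load angles a solution could jump between different roots of the load equations.
\<close>

definition solution_on :: "'n::finite power_system \<Rightarrow> real set \<Rightarrow> (real \<Rightarrow> 'n state) \<Rightarrow> bool" where
  "solution_on S I z \<longleftrightarrow>
     (\<exists>x w \<eta> l. z = (\<lambda>t. (x t, w t, \<eta> t, l t)) \<and>
        (\<forall>i\<in>loads S. continuous_on I (\<lambda>t. x t $ i)) \<and>
        continuous_on I l \<and>
        (\<forall>t\<in>I.
           z t \<in> state_space S \<and>
           algebraic_eqs S (z t) \<and>
           (\<forall>i\<in>machines S \<union> freq_devices S.
              ((\<lambda>s. x s $ i) has_real_derivative \<phi>_rate S i (z t)) (at t within I)) \<and>
           (\<forall>i\<in>machines S.
              ((\<lambda>s. w s $ i) has_real_derivative \<omega>_rate S i (z t)) (at t within I)) \<and>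
           (\<eta> has_real_derivative \<eta>_rate S (z t)) (at t within I)))"

text \<open>
  \<open>z\<close> is the state trajectory starting at \<open>z0\<close>: it exists for all \<open>t \<ge> 0\<close>, and every
  solution starting at \<open>z0\<close>, even if it is only defined on a bounded interval, agrees
  with it.
\<close>

definition is_trajectory_from ::
    "'n::finite power_system \<Rightarrow> 'n state \<Rightarrow> (real \<Rightarrow> 'n state) \<Rightarrow> bool" where
  "is_trajectory_from S z0 z \<longleftrightarrow>
     solution_on S {0..} z \<and> z 0 = z0 \<and>
     (\<forall>T>0. \<forall>y. solution_on S {0..<T} y \<and> y 0 = z0 \<longrightarrow> (\<forall>t\<in>{0..<T}. y t = z t))"

end

theory Submission
  imports Defs
begin

text \<open>
  The flows cancel when the equations of all nodes and that of \<open>\<eta>\<close> are added, so the quantity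
  \<open>p = \<Sum>M\<^sub>i \<omega>\<^sub>i + \<eta>\<close> satisfies a scalar linear equation \<open>p' = - k p + const\<close> of its own.  By the
  second algebraic equation the total control is \<open>- k p\<close>.  The price is therefore an explicit
  function of time that converges to its equilibrium value, and since all controllers respond
  monotonically to it, no single control deviates by more than the total does, that is, by more than
  a multiple of \<open>exp (- k t)\<close> (\<open>control_diff_le_total_control_diff\<close>).  What remains are the swing
  equations with an exponentially convergent forcing.

  These are made global by continuing the sine linearly outside an interval \<open>[- r, r]\<close> with
  \<open>r < \<pi> / 2\<close> (\<open>extended_sin\<close>).  On a connected graph the resulting flow is Lipschitz and strongly
  monotone on grounded angle vectors.  Hence the load equations have exactly one solution, which
  depends in a Lipschitz way on the other angles (\<open>load_solution_exists_unique\<close>,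
  \<open>load_flow_lipschitz\<close>), and the differential algebraic system becomes a globally Lipschitz
  differential equation; \<open>lipschitz_ode_exists\<close> and \<open>lipschitz_ode_unique\<close> apply to it.

  The energy (kinetic plus potential) decreases along solutions up to the forcing, but it
  dissipates only the machine frequencies and the power mismatch at the devices.  Adding a small
  multiple of the cross term \<open>\<Sum>M\<^sub>i \<omega>\<^sub>i (\<phi>\<^sub>i - \<phi>\<^sub>i\<^sup>*)\<close> gives a strict Lyapunov function
  (\<open>strict_lyapunov\<close>) and so exponential decay of all errors (\<open>error_exponential_decay\<close>).  For
  initial states close to the equilibrium this bound keeps the angle differences in the interval
  where the sine was not changed, so the solution found solves the original system.  Any other
  solution from the same state would first have to leave that interval, but up to the first exit
  time the two agree (\<open>trajectory_unique\<close>).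

  At an equilibrium all frequencies coincide, and a vanishing rate of \<open>\<eta>\<close> makes them zero.  The sum
  of the power balances then fixes the price, and strong monotonicity fixes the angles
  (\<open>equilibrium_unique\<close>).  In the synchronous state \<open>\<eta>\<close> is constant, which again makes the
  frequency zero, and a shift of its angles gives the equilibrium (\<open>synchronous_state_balance\<close>).
\<close>

section \<open>Globally Lipschitz differential equations\<close>

text \<open>
  The function \<open>exp (- c t) q t\<close> is nonincreasing.
\<close>

lemma exponential_bound_from_differential_inequality:
  fixes q q' :: "real \<Rightarrow> real"
  assumes "0 \<le> T"
    and deriv: "\<And>t. t \<in> {0..T} \<Longrightarrow> (q has_real_derivative q' t) (at t within {0..T})"
    and le: "\<And>t. t \<in> {0..T} \<Longrightarrow> q' t \<le> c * q t"
  shows "q T \<le> exp (c * T) * q 0"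
proof -
  let ?h = "\<lambda>t. exp (- c * t) * q t"
  let ?h' = "\<lambda>t. exp (- c * t) * (q' t - c * q t)"
  have "\<exists>t\<in>{0..T}. ?h T - ?h 0 = (\<lambda>x. ?h' t * x) (T - 0)"
  proof (rule mvt_very_simple[OF \<open>0 \<le> T\<close>])
    fix t assume "0 \<le> t" "t \<le> T"
    then have "(?h has_real_derivative ?h' t) (at t within {0..T})"
      by (auto intro!: derivative_eq_intros deriv simp: algebra_simps)
    then show "(?h has_derivative (\<lambda>x. ?h' t * x)) (at t within {0..T})"
      by (simp add: has_field_derivative_def)
  qed
  then obtain t where t: "t \<in> {0..T}" and eq: "?h T - ?h 0 = ?h' t * T"
    by auto
  have "?h' t \<le> 0"
    using le[OF t] by (simp add: mult_nonneg_nonpos)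
  then have "?h T \<le> q 0"
    using eq mult_nonpos_nonneg[of "?h' t" T] \<open>0 \<le> T\<close> by simp
  then have "exp (c * T) * ?h T \<le> exp (c * T) * q 0"
    by (intro mult_left_mono) auto
  moreover have "exp (c * T) * ?h T = q T"
    by (simp add: exp_minus)
  ultimately show ?thesis by (simp only:)
qed

text \<open>
  The squared distance of two solutions grows at most at the rate \<open>2 L\<close>.
\<close>

lemma lipschitz_ode_unique:
  fixes x y b :: "real \<Rightarrow> 'a::euclidean_space"
  assumes "0 \<le> T" and lip: "L-lipschitz_on UNIV F"
    and x: "\<And>t. t \<in> {0..T} \<Longrightarrow> (x has_vector_derivative F (x t) + b t) (at t within {0..T})"
    and y: "\<And>t. t \<in> {0..T} \<Longrightarrow> (y has_vector_derivative F (y t) + b t) (at t within {0..T})"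
    and "x 0 = y 0"
  shows "x T = y T"
proof -
  let ?q = "\<lambda>t. (x t - y t) \<bullet> (x t - y t)"
  have "?q T \<le> exp (2 * L * T) * ?q 0"
  proof (rule exponential_bound_from_differential_inequality[OF \<open>0 \<le> T\<close>])
    fix t assume t: "t \<in> {0..T}"
    have D: "((\<lambda>s. x s - y s) has_derivative (\<lambda>h. h *\<^sub>R (F (x t) - F (y t)))) (at t within {0..T})"
      using has_vector_derivative_diff[OF x[OF t] y[OF t]] by (simp add: has_vector_derivative_def)
    show "(?q has_real_derivative 2 * ((x t - y t) \<bullet> (F (x t) - F (y t)))) (at t within {0..T})"
      unfolding has_field_derivative_def
      by (rule has_derivative_eq_rhs[OF has_derivative_inner[OF D D]])
        (auto simp: algebra_simps inner_commute)
    have "(x t - y t) \<bullet> (F (x t) - F (y t)) \<le> norm (x t - y t) * norm (F (x t) - F (y t))"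
      by (rule norm_cauchy_schwarz)
    also have "\<dots> \<le> norm (x t - y t) * (L * norm (x t - y t))"
      using lipschitz_on_normD[OF lip, of "x t" "y t"] by (intro mult_left_mono) auto
    also have "\<dots> = L * ?q t"
      by (simp add: dot_square_norm power2_eq_square)
    finally show "2 * ((x t - y t) \<bullet> (F (x t) - F (y t))) \<le> 2 * L * ?q t" by simp
  qed
  then have "?q T \<le> 0" using \<open>x 0 = y 0\<close> by simp
  then show ?thesis by (metis inner_ge_zero inner_eq_zero_iff order_antisym right_minus_eq)
qed

text \<open>
  The weight \<open>exp (- (L + 1) t)\<close> turns the Picard operator into a contraction on the whole half
  line at once.
\<close>

theorem lipschitz_ode_exists:
  fixes b :: "real \<Rightarrow> 'a::euclidean_space"
  assumes lip: "L-lipschitz_on UNIV F"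
    and b: "continuous_on {0..} b" and bd: "bounded (b ` {0..})"
  shows "\<exists>x. x 0 = x0 \<and>
    (\<forall>t\<ge>0. (x has_vector_derivative F (x t) + b t) (at t within {0..}))"
proof -
  define K where "K = L + 1"
  have L: "0 \<le> L" using lip by (rule lipschitz_on_nonneg)
  have K: "1 \<le> K" "0 < K" "L < K" using L by (auto simp: K_def)
  have contF: "continuous_on UNIV F" using lip by (rule lipschitz_on_continuous_on)
  obtain C where C: "\<And>s. 0 \<le> s \<Longrightarrow> norm (b s) \<le> C"
    using bd by (auto simp: bounded_iff)
  have C0: "0 \<le> C" using C[of 0] norm_ge_zero[of "b 0"] by linarith
  define h where "h u s = F (exp (K * s) *\<^sub>R apply_bcontfun u s) + b s" for u :: "real \<Rightarrow>\<^sub>C 'a" and s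
  have conth: "continuous_on {0..t} (h u)" for t u
    unfolding h_def using b
    by (intro continuous_intros continuous_on_compose2[OF contF])
       (auto intro: continuous_on_subset)
  have inth: "h u integrable_on {0..t}" for u t
    by (rule integrable_continuous_real[OF conth])
  have intexp: "((\<lambda>s. c * exp (K * s)) has_integral c / K * (exp (K * t) - 1)) {0..t}"
    if "0 \<le> t" for c t
  proof -
    have "((\<lambda>s. c * exp (K * s)) has_integral c / K * exp (K * t) - c / K * exp (K * 0)) {0..t}"
      using that K by (intro fundamental_theorem_of_calculus)
        (auto intro!: derivative_eq_intros
          simp: has_real_derivative_iff_has_vector_derivative[symmetric])
    then show ?thesis by (simp add: algebra_simps)
  qed
  define I where "I u t = integral {0..t} (h u)" for u t
  have dI: "(I u has_vector_derivative h u t) (at t within {0..})" if "0 \<le> t" for u t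
  proof -
    have "(I u has_vector_derivative h u t) (at t within {0..t+1})"
      unfolding I_def using that by (intro integral_has_vector_derivative conth) auto
    moreover have "at t within {0..t+1} = at t within {0..}"
      using that by (intro at_within_nhd[of _ "{..<t+1}"]) auto
    ultimately show ?thesis by simp
  qed
  have contI: "continuous_on {0..} (I u)" for u
    using dI by (meson atLeast_iff continuous_on_eq_continuous_within has_vector_derivative_continuous)
  define T where "T u t = exp (- K * max 0 t) *\<^sub>R (x0 + I u (max 0 t))" for u t
  have "T u \<in> bcontfun" for u
  proof (rule bcontfun_normI)
    show "continuous_on UNIV (T u)"
      unfolding T_def
      by (intro continuous_intros continuous_on_compose2[OF contI]) auto
    fix t :: real
    define s where "s = max 0 t"
    have s: "0 \<le> s" by (simp add: s_def)
    let ?B = "norm (F 0) + L * norm u + C"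
    have "norm (I u s) \<le> integral {0..s} (\<lambda>s. ?B * exp (K * s))"
      unfolding I_def
    proof (rule integral_norm_bound_integral[OF inth])
      show "(\<lambda>s. ?B * exp (K * s)) integrable_on {0..s}"
        using intexp[OF s] by (auto simp: has_integral_integrable)
      fix r assume "r \<in> {0..s}"
      then have r: "0 \<le> r" by simp
      have e: "1 \<le> exp (K * r)" using r K by simp
      have "norm (h u r) \<le> norm (F (exp (K * r) *\<^sub>R apply_bcontfun u r) - F 0) + norm (F 0) + norm (b r)"
        unfolding h_def by norm
      also have "\<dots> \<le> L * (exp (K * r) * norm u) + norm (F 0) * exp (K * r) + C * exp (K * r)"
      proof (intro add_mono)
        show "norm (F (exp (K * r) *\<^sub>R apply_bcontfun u r) - F 0) \<le> L * (exp (K * r) * norm u)"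
        proof (rule order_trans)
          show "norm (F (exp (K * r) *\<^sub>R apply_bcontfun u r) - F 0)
            \<le> L * norm (exp (K * r) *\<^sub>R apply_bcontfun u r - 0)"
            by (rule lipschitz_on_normD[OF lip]) auto
          show "L * norm (exp (K * r) *\<^sub>R apply_bcontfun u r - 0) \<le> L * (exp (K * r) * norm u)"
            using L norm_bounded[of u r] by (intro mult_left_mono) auto
        qed
        show "norm (F 0) \<le> norm (F 0) * exp (K * r)"
          using e by (simp add: mult_le_cancel_left1)
        show "norm (b r) \<le> C * exp (K * r)"
          using C[OF r] C0 e mult_left_mono[OF e C0] by linarith
      qed
      finally show "norm (h u r) \<le> ?B * exp (K * r)" by (simp add: algebra_simps)
    qed
    also have "\<dots> = ?B / K * (exp (K * s) - 1)"
      using intexp[OF s] by (rule integral_unique)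
    also have "\<dots> \<le> ?B * exp (K * s)"
    proof -
      have "?B / K \<le> ?B / 1" using K L C0 by (intro divide_left_mono) auto
      then show ?thesis using L C0 K s by (intro mult_mono) auto
    qed
    finally have I: "norm (I u s) \<le> ?B * exp (K * s)" .
    have "norm (T u t) \<le> exp (- K * s) * (norm x0 + norm (I u s))"
      unfolding T_def s_def[symmetric] by (auto intro!: mult_left_mono norm_triangle_ineq)
    also have "\<dots> \<le> exp (- K * s) * (norm x0 * exp (K * s) + ?B * exp (K * s))"
      using I s K by (intro mult_left_mono add_mono) (auto simp: mult_le_cancel_left1)
    also have "\<dots> = norm x0 + ?B"
      by (simp add: algebra_simps exp_minus)
    finally show "norm (T u t) \<le> norm x0 + ?B" .
  qed
  then have T: "apply_bcontfun (Bcontfun (T u)) = T u" for u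
    by (simp add: Bcontfun_inverse)
  have contr: "dist (Bcontfun (T u)) (Bcontfun (T v)) \<le> L / K * dist u v" for u v
  proof (rule dist_bound, unfold T)
    fix t :: real
    define s where "s = max 0 t"
    have s: "0 \<le> s" by (simp add: s_def)
    have "norm (I u s - I v s) = norm (integral {0..s} (\<lambda>r. h u r - h v r))"
      unfolding I_def by (simp add: integral_diff inth)
    also have "\<dots> \<le> integral {0..s} (\<lambda>r. L * dist u v * exp (K * r))"
    proof (rule integral_norm_bound_integral)
      show "(\<lambda>r. L * dist u v * exp (K * r)) integrable_on {0..s}"
        using intexp[OF s] by (auto simp: has_integral_integrable)
      show "(\<lambda>r. h u r - h v r) integrable_on {0..s}"
        by (intro integrable_diff inth)
      fix r
      have "norm (h u r - h v r) \<le> L * norm (exp (K * r) *\<^sub>R (apply_bcontfun u r - apply_bcontfun v r))"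
        unfolding h_def
        using lipschitz_on_normD[OF lip, of "exp (K * r) *\<^sub>R apply_bcontfun u r" "exp (K * r) *\<^sub>R apply_bcontfun v r"]
        by (simp add: scaleR_diff_right)
      also have "\<dots> \<le> L * (exp (K * r) * dist u v)"
        using L dist_bounded[of u r v] by (intro mult_left_mono) (auto simp: dist_norm)
      finally show "norm (h u r - h v r) \<le> L * dist u v * exp (K * r)" by (simp add: algebra_simps)
    qed
    also have "\<dots> = L * dist u v / K * (exp (K * s) - 1)"
      using intexp[OF s] by (rule integral_unique)
    also have "\<dots> \<le> L * dist u v / K * exp (K * s)"
      using L K by (intro mult_left_mono) auto
    finally have I: "norm (I u s - I v s) \<le> L / K * dist u v * exp (K * s)" by simp
    have "dist (T u t) (T v t) = exp (- K * s) * norm (I u s - I v s)"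
      unfolding T_def s_def[symmetric] dist_norm scaleR_diff_right[symmetric] by simp
    also have "\<dots> \<le> exp (- K * s) * (L / K * dist u v * exp (K * s))"
      using I by (intro mult_left_mono) auto
    also have "\<dots> = L / K * dist u v" by (simp add: exp_minus)
    finally show "dist (T u t) (T v t) \<le> L / K * dist u v" .
  qed
  have "\<exists>!u. Bcontfun (T u) = u"
    using contr K L by (intro banach_fix_type[of "L / K"]) auto
  then obtain u where "Bcontfun (T u) = u" by blast
  then have u: "apply_bcontfun u = T u" using T[of u] by simp
  define x where "x t = x0 + I u t" for t
  have ux: "exp (K * t) *\<^sub>R apply_bcontfun u t = x t" if "0 \<le> t" for t
    using that unfolding u T_def x_def by (simp add: exp_minus max_def)
  have "(x has_vector_derivative F (x t) + b t) (at t within {0..})" if "0 \<le> t" for t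
    using dI[OF that, of u] ux[OF that] unfolding x_def h_def
    by (auto intro!: derivative_eq_intros)
  moreover have "x 0 = x0" by (simp add: x_def I_def)
  ultimately show ?thesis by blast
qed

section \<open>Networks with strongly monotone couplings\<close>

text \<open>
  Outside \<open>[- r, r]\<close> the sine is continued along its tangents at \<open>- r\<close> and \<open>r\<close>, so that all slopes lie
  between \<open>cos r\<close> and \<open>1\<close>.
\<close>

definition extended_sin :: "real \<Rightarrow> real \<Rightarrow> real" where
  "extended_sin r y = sin (max (- r) (min r y)) + cos r * (y - max (- r) (min r y))"

lemma extended_sin_eq: "\<bar>y\<bar> \<le> r \<Longrightarrow> extended_sin r y = sin y"
  by (auto simp: extended_sin_def max_def min_def)

lemma extended_sin_minus: "0 \<le> r \<Longrightarrow> extended_sin r (- y) = - extended_sin r y"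
proof -
  assume "0 \<le> r"
  then have "max (- r) (min r (- y)) = - max (- r) (min r y)"
    by (simp add: max_def min_def)
  then show ?thesis by (simp add: extended_sin_def algebra_simps)
qed

lemma extended_sin_slope:
  assumes r: "0 \<le> r" "r < pi / 2" and "z \<le> y"
  shows "cos r * (y - z) \<le> extended_sin r y - extended_sin r z" (is ?lower)
    and "extended_sin r y - extended_sin r z \<le> 1 * (y - z)" (is ?upper)
proof -
  define c where "c = (\<lambda>y. max (- r) (min r y))"
  have c: "- r \<le> c z" "c z \<le> c y" "c y \<le> r" and c': "z - c z \<le> y - c y"
    using r \<open>z \<le> y\<close> by (auto simp: c_def max_def min_def)
  obtain v where v: "v \<in> {c z..c y}" and eq: "sin (c y) - sin (c z) = cos v * (c y - c z)"
    using mvt_very_simple[of "c z" "c y" sin "\<lambda>x h. cos x * h", OF c(2)]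
      has_field_derivative_at_within[OF DERIV_sin, unfolded has_field_derivative_def] by blast
  have "cos r \<le> cos v"
  proof -
    have "cos r \<le> cos \<bar>v\<bar>" using v c r by (intro cos_monotone_0_pi_le) auto
    then show ?thesis by simp
  qed
  then have lower: "cos r * (c y - c z) \<le> sin (c y) - sin (c z)"
    and upper: "sin (c y) - sin (c z) \<le> c y - c z"
    using c(2) eq by (auto simp: mult_right_mono mult_left_le_one_le[of "c y - c z" "cos v"]
        intro: mult_right_mono[of "cos v" 1 "c y - c z", simplified])
  have ext: "extended_sin r y = sin (c y) + cos r * (y - c y)" for y
    by (simp add: extended_sin_def c_def)
  show ?lower
    using lower unfolding ext by (simp add: algebra_simps)
  have "cos r * ((y - c y) - (z - c z)) \<le> 1 * ((y - c y) - (z - c z))"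
    using c' by (intro mult_right_mono) auto
  then show ?upper
    using upper unfolding ext by (simp add: algebra_simps)
qed

locale monotone_network =
  fixes B :: "'n::finite \<Rightarrow> 'n \<Rightarrow> real" and s :: "real \<Rightarrow> real" and m L :: real
  assumes B_sym: "B i j = B j i"
    and B_nonneg: "0 \<le> B i j"
    and connected: "(i, j) \<in> {(i, j). 0 < B i j}\<^sup>*"
    and s_odd: "s (- y) = - s y"
    and m_pos: "0 < m"
    and slope_lower: "z \<le> y \<Longrightarrow> m * (y - z) \<le> s y - s z"
    and slope_upper: "z \<le> y \<Longrightarrow> s y - s z \<le> L * (y - z)"
begin

definition net_flow :: "real ^ 'n \<Rightarrow> 'n \<Rightarrow> real" where
  "net_flow x i = (\<Sum>j\<in>UNIV. B i j * s (x $ i - x $ j))"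

definition dirichlet :: "real ^ 'n \<Rightarrow> real" where
  "dirichlet h = (\<Sum>i\<in>UNIV. \<Sum>j\<in>UNIV. B i j * (h $ i - h $ j)\<^sup>2)"

lemma L_pos: "0 < L"
  using slope_lower[of 0 1] slope_upper[of 0 1] m_pos by simp

lemma s_strongly_monotone: "m * (y - z)\<^sup>2 \<le> (y - z) * (s y - s z)"
proof (cases "z \<le> y")
  case True
  then show ?thesis using mult_left_mono[OF slope_lower[OF True], of "y - z"]
    by (simp add: power2_eq_square algebra_simps)
next
  case False
  then have *: "y \<le> z" by simp
  show ?thesis using mult_left_mono[OF slope_lower[OF *], of "z - y"] *
    by (simp add: power2_eq_square algebra_simps)
qed

lemma s_lipschitz: "\<bar>s y - s z\<bar> \<le> L * \<bar>y - z\<bar>"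
proof -
  have *: "\<bar>s y - s z\<bar> \<le> L * \<bar>y - z\<bar>" if "z \<le> y" for y z
  proof -
    have "0 \<le> m * (y - z)" using that m_pos by simp
    then show ?thesis using slope_lower[OF that] slope_upper[OF that] that by simp
  qed
  show ?thesis using *[of z y] *[of y z] by (cases "z \<le> y") (auto simp: abs_minus_commute)
qed

text \<open>
  Each edge contributes once from either end point, with opposite signs.
\<close>

lemma summation_by_parts:
  assumes "\<And>i j. G j i = - G i j"
  shows "(\<Sum>i\<in>UNIV. h $ i * (\<Sum>j\<in>UNIV. B i j * G i j))
    = (\<Sum>i\<in>UNIV. \<Sum>j\<in>UNIV. B i j * ((h $ i - h $ j) * G i j)) / 2"
proof -
  let ?A = "\<Sum>i\<in>UNIV. \<Sum>j\<in>UNIV. h $ i * (B i j * G i j)"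
  have "?A = (\<Sum>j\<in>UNIV. \<Sum>i\<in>UNIV. h $ i * (B i j * G i j))"
    by (rule sum.swap)
  also have "\<dots> = (\<Sum>i\<in>UNIV. \<Sum>j\<in>UNIV. - (h $ j * (B i j * G i j)))"
  proof (intro sum.cong refl)
    fix i j
    show "h $ j * (B j i * G j i) = - (h $ j * (B i j * G i j))"
      unfolding assms[of j i] B_sym[of j i] by simp
  qed
  finally have "2 * ?A = (\<Sum>i\<in>UNIV. \<Sum>j\<in>UNIV. h $ i * (B i j * G i j))
      + (\<Sum>i\<in>UNIV. \<Sum>j\<in>UNIV. - (h $ j * (B i j * G i j)))" by simp
  also have "\<dots> = (\<Sum>i\<in>UNIV. \<Sum>j\<in>UNIV. B i j * ((h $ i - h $ j) * G i j))"
    unfolding sum.distrib[symmetric] by (intro sum.cong refl) (simp add: algebra_simps)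
  finally have "?A = (\<Sum>i\<in>UNIV. \<Sum>j\<in>UNIV. B i j * ((h $ i - h $ j) * G i j)) / 2"
    by linarith
  then show ?thesis by (simp add: sum_distrib_left)
qed

lemma net_flow_diff:
  "net_flow x i - net_flow z i
    = (\<Sum>j\<in>UNIV. B i j * (s (x $ i - x $ j) - s (z $ i - z $ j)))"
  by (simp add: net_flow_def sum_subtractf right_diff_distrib)

lemma s_difference_antisym: "s (x $ j - x $ i) = - s (x $ i - x $ j)"
  using s_odd[of "x $ i - x $ j"] by simp

lemma sum_net_flow_diff:
  "(\<Sum>i\<in>UNIV. h $ i * (net_flow x i - net_flow z i))
    = (\<Sum>i\<in>UNIV. \<Sum>j\<in>UNIV. B i j * ((h $ i - h $ j) * (s (x $ i - x $ j) - s (z $ i - z $ j)))) / 2"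
  unfolding net_flow_diff
proof (rule summation_by_parts)
  fix i j
  show "s (x $ j - x $ i) - s (z $ j - z $ i) = - (s (x $ i - x $ j) - s (z $ i - z $ j))"
    unfolding s_difference_antisym[of x j i] s_difference_antisym[of z j i] by simp
qed

lemma sum_net_flow_eq_0: "(\<Sum>i\<in>UNIV. net_flow x i) = 0"
proof -
  have "(\<Sum>i\<in>UNIV. (\<chi> i. 1) $ i * (\<Sum>j\<in>UNIV. B i j * s (x $ i - x $ j))) = 0"
    by (subst summation_by_parts, rule s_difference_antisym) simp
  then show ?thesis by (simp add: net_flow_def)
qed

text \<open>
  A discrete Poincare inequality: on a connected graph the energy \<^const>\<open>dirichlet\<close> vanishes only on
  constant vectors, so it is positive on the compact unit sphere of the vectors grounded at \<open>r\<close>.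
\<close>

lemma dirichlet_coercive: "\<exists>\<kappa>>0. \<forall>h. h $ r = 0 \<longrightarrow> \<kappa> * (norm h)\<^sup>2 \<le> dirichlet h"
proof -
  let ?K = "sphere 0 1 \<inter> {h :: real ^ 'n. h $ r = 0}"
  have cont: "continuous_on ?K dirichlet"
    unfolding dirichlet_def by (intro continuous_intros)
  have comp: "compact ?K"
    by (intro compact_Int_closed compact_sphere closed_Collect_eq continuous_intros)
  have term_nonneg: "0 \<le> B i j * (h $ i - h $ j)\<^sup>2" for h :: "real ^ 'n" and i j
    by (rule mult_nonneg_nonneg[OF B_nonneg]) simp
  have nonneg: "0 \<le> dirichlet h" for h
    unfolding dirichlet_def by (intro sum_nonneg term_nonneg)
  have pos: "0 < dirichlet h" if h: "h \<in> ?K" for h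
  proof (rule ccontr)
    assume "\<not> 0 < dirichlet h"
    then have "dirichlet h = 0" using nonneg[of h] by simp
    then have "\<forall>i. (\<Sum>j\<in>UNIV. B i j * (h $ i - h $ j)\<^sup>2) = 0"
      unfolding dirichlet_def by (subst (asm) sum_nonneg_eq_0_iff) (simp_all add: sum_nonneg term_nonneg)
    then have "\<forall>i j. B i j * (h $ i - h $ j)\<^sup>2 = 0"
      by (subst (asm) sum_nonneg_eq_0_iff) (simp_all add: term_nonneg)
    then have edge: "h $ i = h $ j" if "0 < B i j" for i j
    proof -
      have "B i j * (h $ i - h $ j)\<^sup>2 = 0" using \<open>\<forall>i j. B i j * (h $ i - h $ j)\<^sup>2 = 0\<close> by blast
      then show ?thesis using that by simp
    qed
    have "h $ r = h $ j" for j
      using connected[of r j] by (induction rule: rtrancl_induct) (auto dest: edge)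
    then have "h = 0" using h by (auto simp: vec_eq_iff)
    then show False using h by simp
  qed
  have unit: "(1 / norm h) *\<^sub>R h \<in> ?K" if "h $ r = 0" "h \<noteq> 0" for h
    using that by simp
  have scale: "dirichlet h = (norm h)\<^sup>2 * dirichlet ((1 / norm h) *\<^sub>R h)" if "h \<noteq> 0" for h
  proof -
    have "(norm h)\<^sup>2 * (B i j * (((1 / norm h) *\<^sub>R h) $ i - ((1 / norm h) *\<^sub>R h) $ j)\<^sup>2)
      = B i j * (h $ i - h $ j)\<^sup>2" for i j
      using that by (simp add: field_simps power2_eq_square)
    then show ?thesis unfolding dirichlet_def sum_distrib_left by (simp only:)
  qed
  show ?thesis
  proof (cases "?K = {}")
    case True
    have "1 * (norm h)\<^sup>2 \<le> dirichlet h" if "h $ r = 0" for h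
    proof (cases "h = 0")
      case True
      then show ?thesis using nonneg[of h] by simp
    next
      case False
      from unit[OF that this] \<open>?K = {}\<close> show ?thesis by blast
    qed
    then show ?thesis by (intro exI[of _ 1]) auto
  next
    case False
    then obtain h0 where h0: "h0 \<in> ?K" "\<And>h. h \<in> ?K \<Longrightarrow> dirichlet h0 \<le> dirichlet h"
      using continuous_attains_inf[OF comp False cont] by blast
    have "dirichlet h0 * (norm h)\<^sup>2 \<le> dirichlet h" if "h $ r = 0" for h
    proof (cases "h = 0")
      case True
      then show ?thesis by (simp add: nonneg)
    next
      case False
      show ?thesis
        using mult_left_mono[OF h0(2)[OF unit[OF that False]], of "(norm h)\<^sup>2"] scale[OF False]
        by (simp add: mult.commute)
    qed
    then show ?thesis using pos[OF h0(1)] by blast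
  qed
qed

text \<open>
  Summation by parts turns the pairing into a sum over the edges, where the slope of \<open>s\<close> bounds it
  from below by \<^const>\<open>dirichlet\<close>.  A common entry is required because the flow is invariant
  under a shift of all angles.
\<close>

lemma net_flow_strongly_monotone:
  "\<exists>\<mu>>0. \<forall>x z. x $ r = z $ r \<longrightarrow>
     \<mu> * (norm (x - z))\<^sup>2 \<le> (\<Sum>i\<in>UNIV. (x - z) $ i * (net_flow x i - net_flow z i))"
proof -
  obtain \<kappa> where \<kappa>: "\<kappa> > 0" "\<And>h. h $ r = 0 \<Longrightarrow> \<kappa> * (norm h)\<^sup>2 \<le> dirichlet h"
    using dirichlet_coercive by blast
  have "m * \<kappa> / 2 * (norm (x - z))\<^sup>2 \<le> (\<Sum>i\<in>UNIV. (x - z) $ i * (net_flow x i - net_flow z i))"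
    if "x $ r = z $ r" for x z
  proof -
    have "m * (\<kappa> * (norm (x - z))\<^sup>2) \<le> m * dirichlet (x - z)"
      using that m_pos by (intro mult_left_mono \<kappa>) auto
    also have "\<dots> \<le> (\<Sum>i\<in>UNIV. \<Sum>j\<in>UNIV. B i j * (((x - z) $ i - (x - z) $ j)
        * (s (x $ i - x $ j) - s (z $ i - z $ j))))"
      unfolding dirichlet_def sum_distrib_left
    proof (intro sum_mono)
      fix i j
      have "m * ((x - z) $ i - (x - z) $ j)\<^sup>2
        \<le> ((x - z) $ i - (x - z) $ j) * (s (x $ i - x $ j) - s (z $ i - z $ j))"
        using s_strongly_monotone[of "x $ i - x $ j" "z $ i - z $ j"] by (simp add: algebra_simps)
      from mult_left_mono[OF this B_nonneg]
      show "m * (B i j * ((x - z) $ i - (x - z) $ j)\<^sup>2)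
        \<le> B i j * (((x - z) $ i - (x - z) $ j) * (s (x $ i - x $ j) - s (z $ i - z $ j)))"
        by (simp add: mult.left_commute)
    qed
    finally show ?thesis unfolding sum_net_flow_diff by simp
  qed
  then show ?thesis using \<kappa>(1) m_pos by (intro exI[of _ "m * \<kappa> / 2"]) auto
qed

lemma net_flow_lipschitz:
  "\<exists>C>0. \<forall>x z i. \<bar>net_flow x i - net_flow z i\<bar> \<le> C * norm (x - z)"
proof -
  let ?C = "\<Sum>i\<in>UNIV. \<Sum>j\<in>UNIV. B i j * (2 * L)"
  have Bi: "0 \<le> B i j * (2 * L)" for i j
    using L_pos by (intro mult_nonneg_nonneg[OF B_nonneg]) simp
  have "\<bar>net_flow x i - net_flow z i\<bar> \<le> (?C + 1) * norm (x - z)" for x z i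
  proof -
    have "\<bar>net_flow x i - net_flow z i\<bar>
      \<le> (\<Sum>j\<in>UNIV. \<bar>B i j * (s (x $ i - x $ j) - s (z $ i - z $ j))\<bar>)"
      unfolding net_flow_diff by (rule sum_abs)
    also have "\<dots> \<le> (\<Sum>j\<in>UNIV. B i j * (2 * L) * norm (x - z))"
    proof (rule sum_mono)
      fix j
      have "\<bar>s (x $ i - x $ j) - s (z $ i - z $ j)\<bar> \<le> L * \<bar>(x - z) $ i - (x - z) $ j\<bar>"
        using s_lipschitz[of "x $ i - x $ j" "z $ i - z $ j"] by (simp add: algebra_simps)
      also have "\<dots> \<le> L * (2 * norm (x - z))"
        using L_pos component_le_norm_cart[of "x - z" i] component_le_norm_cart[of "x - z" j]
        by (intro mult_left_mono) linarith+
      finally have "\<bar>s (x $ i - x $ j) - s (z $ i - z $ j)\<bar> \<le> L * (2 * norm (x - z))" .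
      from mult_left_mono[OF this B_nonneg[of i j]]
      show "\<bar>B i j * (s (x $ i - x $ j) - s (z $ i - z $ j))\<bar> \<le> B i j * (2 * L) * norm (x - z)"
        unfolding abs_mult abs_of_nonneg[OF B_nonneg] by (simp only: mult.assoc mult.left_commute)
    qed
    also have "\<dots> = (\<Sum>j\<in>UNIV. B i j * (2 * L)) * norm (x - z)"
      by (simp add: sum_distrib_right)
    also have "\<dots> \<le> (?C + 1) * norm (x - z)"
    proof (rule mult_right_mono)
      have "(\<Sum>j\<in>UNIV. B i j * (2 * L)) \<le> ?C"
        by (rule member_le_sum) (simp_all only: finite UNIV_I sum_nonneg[OF Bi])
      then show "(\<Sum>j\<in>UNIV. B i j * (2 * L)) \<le> ?C + 1" by linarith
    qed simp
    finally show ?thesis .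
  qed
  moreover have "0 \<le> ?C" by (intro sum_nonneg Bi)
  ultimately show ?thesis by (intro exI[of _ "?C + 1"]) auto
qed

lemma net_flow_lipschitz_l2:
  "\<exists>Q>0. \<forall>x z. (\<Sum>i\<in>UNIV. (net_flow x i - net_flow z i)\<^sup>2) \<le> Q * (norm (x - z))\<^sup>2"
proof -
  obtain C where C: "C > 0" "\<And>x z i. \<bar>net_flow x i - net_flow z i\<bar> \<le> C * norm (x - z)"
    using net_flow_lipschitz by blast
  have "(\<Sum>i\<in>UNIV. (net_flow x i - net_flow z i)\<^sup>2) \<le> (\<Sum>i\<in>(UNIV :: 'n set). (C * norm (x - z))\<^sup>2)"
    for x z
    by (intro sum_mono, subst power2_abs[symmetric]) (intro power_mono C(2) abs_ge_zero)
  then have "(\<Sum>i\<in>UNIV. (net_flow x i - net_flow z i)\<^sup>2)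
      \<le> real CARD('n) * C\<^sup>2 * (norm (x - z))\<^sup>2" for x z
    by (simp add: power_mult_distrib mult.assoc)
  then show ?thesis using C(1) by (intro exI[of _ "real CARD('n) * C\<^sup>2"]) auto
qed

end

section \<open>Load angles as a function of the other angles\<close>

locale loaded_network = monotone_network B s m L
  for B :: "'n::finite \<Rightarrow> 'n \<Rightarrow> real" and s m L +
  fixes r :: 'n and Ld :: "'n set" and P :: "'n \<Rightarrow> real"
  assumes ref_not_load: "r \<notin> Ld"
begin

text \<open>
  The angle of the reference node is set to \<open>0\<close> whatever \<open>a\<close> is.  Any two solutions are then
  grounded at the same node, so that strong monotonicity makes the solution Lipschitz on the whole space.
\<close>

definition load_solution :: "real ^ 'n \<Rightarrow> real ^ 'n \<Rightarrow> bool" where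
  "load_solution a x \<longleftrightarrow>
     (\<forall>i. i \<notin> Ld \<longrightarrow> x $ i = (if i = r then 0 else a $ i)) \<and> (\<forall>i\<in>Ld. net_flow x i = P i)"

text \<open>
  As for gradient descent on a strongly convex function, a small step against the mismatch at the
  loads is a contraction, with step size \<open>\<mu> / Q\<close> and factor \<open>sqrt (1 - \<mu>\<^sup>2 / Q)\<close>.
\<close>

lemma load_solution_exists_unique: "\<exists>!x. load_solution a x"
proof -
  obtain \<mu> where \<mu>: "\<mu> > 0" "\<And>x z. x $ r = z $ r \<Longrightarrow>
     \<mu> * (norm (x - z))\<^sup>2 \<le> (\<Sum>i\<in>UNIV. (x - z) $ i * (net_flow x i - net_flow z i))"
    using net_flow_strongly_monotone by blast
  obtain Q0 where Q0: "Q0 > 0"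
    "\<And>x z. (\<Sum>i\<in>UNIV. (net_flow x i - net_flow z i)\<^sup>2) \<le> Q0 * (norm (x - z))\<^sup>2"
    using net_flow_lipschitz_l2 by blast
  \<comment> \<open>The added square makes \<open>1 - \<mu>\<^sup>2 / Q\<close> positive.\<close>
  define Q where "Q = Q0 + \<mu>\<^sup>2"
  have Q: "Q > 0" "\<mu>\<^sup>2 < Q" using Q0(1) by (auto simp: Q_def intro: add_pos_nonneg)
  have QQ: "(\<Sum>i\<in>UNIV. (net_flow x i - net_flow z i)\<^sup>2) \<le> Q * (norm (x - z))\<^sup>2" for x z
    using Q0(2)[of x z] by (simp add: Q_def distrib_right add_increasing2)
  define \<tau> where "\<tau> = \<mu> / Q"
  define c where "c = sqrt (1 - \<mu>\<^sup>2 / Q)"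
  have q: "0 < 1 - \<mu>\<^sup>2 / Q" "1 - \<mu>\<^sup>2 / Q < 1" using Q \<mu>(1) by auto
  have c: "0 \<le> c" "c < 1" using q by (auto simp: c_def)
  let ?X = "{x :: real ^ 'n. \<forall>i. i \<notin> Ld \<longrightarrow> x $ i = (if i = r then 0 else a $ i)}"
  define T where "T x = (\<chi> i. if i \<in> Ld then x $ i - \<tau> * (net_flow x i - P i) else x $ i)" for x
  have "closed ?X"
    by (intro closed_Collect_all closed_Collect_imp closed_Collect_eq continuous_intros) auto
  then have "complete ?X" by (simp add: complete_eq_closed)
  moreover have "(\<chi> i. if i = r then 0 else a $ i) \<in> ?X" by auto
  then have "?X \<noteq> {}" by blast
  moreover have "T ` ?X \<subseteq> ?X" by (auto simp: T_def)
  moreover have "dist (T x) (T z) \<le> c * dist x z" if "x \<in> ?X \<and> z \<in> ?X" for x z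
  proof -
    define h where "h = x - z"
    define \<Delta> where "\<Delta> i = net_flow x i - net_flow z i" for i
    have xz: "x $ r = z $ r" using that ref_not_load by simp
    have h0: "h $ i = 0" if "i \<notin> Ld" for i
      using \<open>x \<in> ?X \<and> z \<in> ?X\<close> that by (simp add: h_def)
    have "(norm (T x - T z))\<^sup>2 = (\<Sum>i\<in>UNIV. ((T x - T z) $ i)\<^sup>2)"
      by (simp add: norm_vec_def L2_set_def sum_nonneg)
    also have "\<dots> \<le> (\<Sum>i\<in>UNIV. (h $ i)\<^sup>2 - 2 * \<tau> * (h $ i * \<Delta> i) + \<tau>\<^sup>2 * (\<Delta> i)\<^sup>2)"
    proof (rule sum_mono)
      fix i
      show "((T x - T z) $ i)\<^sup>2 \<le> (h $ i)\<^sup>2 - 2 * \<tau> * (h $ i * \<Delta> i) + \<tau>\<^sup>2 * (\<Delta> i)\<^sup>2"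
      proof (cases "i \<in> Ld")
        case True
        then have "(T x - T z) $ i = h $ i - \<tau> * \<Delta> i"
          by (simp add: T_def h_def \<Delta>_def algebra_simps)
        then show ?thesis by (simp only:) (simp add: power2_eq_square algebra_simps)
      next
        case False
        have "(T x - T z) $ i = h $ i" using False by (simp add: T_def h_def)
        then show ?thesis using h0[OF False] by simp
      qed
    qed
    also have "\<dots> = (norm h)\<^sup>2 - 2 * \<tau> * (\<Sum>i\<in>UNIV. h $ i * \<Delta> i) + \<tau>\<^sup>2 * (\<Sum>i\<in>UNIV. (\<Delta> i)\<^sup>2)"
      by (simp add: sum.distrib sum_subtractf sum_distrib_left norm_vec_def L2_set_def sum_nonneg)
    also have "\<dots> \<le> (norm h)\<^sup>2 - 2 * \<tau> * (\<mu> * (norm h)\<^sup>2) + \<tau>\<^sup>2 * (Q * (norm h)\<^sup>2)"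
    proof (intro add_mono diff_mono mult_left_mono order_refl)
      show "\<mu> * (norm h)\<^sup>2 \<le> (\<Sum>i\<in>UNIV. h $ i * \<Delta> i)"
        using \<mu>(2)[OF xz] by (simp add: h_def \<Delta>_def)
      show "(\<Sum>i\<in>UNIV. (\<Delta> i)\<^sup>2) \<le> Q * (norm h)\<^sup>2"
        using QQ[of x z] by (simp add: h_def \<Delta>_def)
      show "0 \<le> 2 * \<tau>" using \<mu>(1) Q(1) by (simp add: \<tau>_def)
    qed auto
    also have "\<dots> = (1 - \<mu>\<^sup>2 / Q) * (norm h)\<^sup>2"
      using Q(1) by (simp add: \<tau>_def field_simps power2_eq_square)
    also have "\<dots> = (c * norm h)\<^sup>2"
      using q by (simp add: c_def power_mult_distrib)
    finally have "norm (T x - T z) \<le> c * norm h"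
      by (rule power2_le_imp_le) (simp add: c)
    then show ?thesis by (simp add: dist_norm h_def)
  qed
  ultimately have "\<exists>!x\<in>?X. T x = x"
    using c by (intro Banach_fix) auto
  moreover have "(x \<in> ?X \<and> T x = x) \<longleftrightarrow> load_solution a x" for x
  proof -
    have "\<tau> \<noteq> 0" using \<mu>(1) Q(1) by (simp add: \<tau>_def)
    then show ?thesis by (auto simp: load_solution_def T_def vec_eq_iff)
  qed
  ultimately show ?thesis by auto
qed

definition load_flow :: "real ^ 'n \<Rightarrow> real ^ 'n" where
  "load_flow a = (THE x. load_solution a x)"

lemma load_flow_solution: "load_solution a (load_flow a)"
  unfolding load_flow_def by (rule theI'[OF load_solution_exists_unique])

lemma load_flow_unique: "load_solution a x \<Longrightarrow> load_flow a = x"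
  using load_solution_exists_unique load_flow_solution by blast

lemma load_flow_ref: "load_flow a $ r = 0"
  and load_flow_nonload: "i \<notin> Ld \<Longrightarrow> i \<noteq> r \<Longrightarrow> load_flow a $ i = a $ i"
  and load_flow_load: "i \<in> Ld \<Longrightarrow> net_flow (load_flow a) i = P i"
  using load_flow_solution[of a] ref_not_load by (auto simp: load_solution_def)

text \<open>
  Strong monotonicity is applied to two load flows: the loads drop out of the pairing, because there
  both net flows equal \<open>P\<close>, and at the other nodes the angles differ by at most \<open>norm (a - b)\<close>.
\<close>

lemma load_flow_lipschitz: "\<exists>K. K-lipschitz_on UNIV load_flow"
proof -
  obtain \<mu> where \<mu>: "\<mu> > 0" "\<And>x z. x $ r = z $ r \<Longrightarrow>
     \<mu> * (norm (x - z))\<^sup>2 \<le> (\<Sum>i\<in>UNIV. (x - z) $ i * (net_flow x i - net_flow z i))"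
    using net_flow_strongly_monotone by blast
  obtain C where C: "C > 0" "\<And>x z i. \<bar>net_flow x i - net_flow z i\<bar> \<le> C * norm (x - z)"
    using net_flow_lipschitz by blast
  define K where "K = real CARD('n) * C / \<mu>"
  have K: "0 \<le> K" using C \<mu> by (simp add: K_def)
  have "norm (load_flow a - load_flow b) \<le> K * norm (a - b)" for a b
  proof (cases "load_flow a = load_flow b")
    case True
    then show ?thesis using K by simp
  next
    case False
    let ?x = "load_flow a" and ?z = "load_flow b"
    let ?n = "norm (?x - ?z)"
    have n: "0 < ?n" using False by simp
    have "\<mu> * ?n\<^sup>2 \<le> (\<Sum>i\<in>UNIV. (?x - ?z) $ i * (net_flow ?x i - net_flow ?z i))"
      by (rule \<mu>(2)) (simp add: load_flow_ref)
    also have "\<dots> \<le> (\<Sum>i\<in>(UNIV :: 'n set). norm (a - b) * (C * ?n))"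
    proof (rule sum_mono)
      fix i
      consider "i \<in> Ld" | "i = r" | "i \<notin> Ld" "i \<noteq> r" by blast
      then show "(?x - ?z) $ i * (net_flow ?x i - net_flow ?z i) \<le> norm (a - b) * (C * ?n)"
      proof cases
        case 1
        then show ?thesis using C(1) by (simp add: load_flow_load)
      next
        case 2
        then show ?thesis using C(1) by (simp add: load_flow_ref)
      next
        case 3
        have "\<bar>(?x - ?z) $ i\<bar> \<le> norm (a - b)"
          using component_le_norm_cart[of "a - b" i] 3 by (simp add: load_flow_nonload)
        then have "\<bar>(?x - ?z) $ i\<bar> * \<bar>net_flow ?x i - net_flow ?z i\<bar> \<le> norm (a - b) * (C * ?n)"
          by (intro mult_mono C(2)) auto
        then show ?thesis by (metis abs_le_D1 abs_mult)
      qed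
    qed
    also have "\<dots> = (real CARD('n) * C * norm (a - b)) * ?n" by simp
    finally have "\<mu> * ?n * ?n \<le> (real CARD('n) * C * norm (a - b)) * ?n"
      by (simp add: power2_eq_square mult.assoc)
    then have "\<mu> * ?n \<le> real CARD('n) * C * norm (a - b)"
      using n by (rule mult_right_le_imp_le)
    then show ?thesis using \<mu>(1) by (simp add: K_def field_simps)
  qed
  then show ?thesis using K by (intro exI[of _ K] lipschitz_onI) (auto simp: dist_norm)
qed

end

section \<open>Potential energy\<close>

context monotone_network
begin

definition primitive :: "real \<Rightarrow> real" where
  "primitive = (SOME S. \<forall>y. (S has_real_derivative s y) (at y))"

lemma primitive_deriv: "(primitive has_real_derivative s y) (at y)"
proof -
  have "L-lipschitz_on UNIV s"
    using L_pos s_lipschitz by (intro lipschitz_onI) (auto simp: dist_real_def)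
  then have "continuous_on UNIV s" by (rule lipschitz_on_continuous_on)
  then have "isCont s y" for y by (simp add: continuous_on_eq_continuous_at)
  then have "\<exists>S. \<forall>y::real. -\<infinity> < ereal y \<longrightarrow> ereal y < \<infinity> \<longrightarrow> (S has_vector_derivative s y) (at y)"
    by (intro einterval_antiderivative) auto
  then have "\<exists>S. \<forall>y. (S has_real_derivative s y) (at y)"
    by (simp add: has_real_derivative_iff_has_vector_derivative)
  then show ?thesis unfolding primitive_def by (rule someI2_ex) blast
qed

definition bregman :: "real \<Rightarrow> real \<Rightarrow> real" where
  "bregman y z = primitive y - primitive z - s z * (y - z)"

lemma mean_value_between:
  assumes "\<And>v. (f has_real_derivative f' v) (at v)"
  shows "\<exists>v. \<bar>v - z\<bar> \<le> \<bar>y - z\<bar> \<and> (z \<le> y \<longrightarrow> z \<le> v) \<and> (y \<le> z \<longrightarrow> v \<le> z) \<and>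
    f y - f z = f' v * (y - z)"
proof (cases y z rule: linorder_cases)
  case less
  obtain v where "y < v" "v < z" "f z - f y = (z - y) * f' v"
    using MVT2[OF less, of f f'] assms by blast
  then show ?thesis using less by (intro exI[of _ v]) (auto simp: algebra_simps)
next
  case equal
  then show ?thesis by auto
next
  case greater
  obtain v where "z < v" "v < y" "f y - f z = (y - z) * f' v"
    using MVT2[OF greater, of f f'] assms by blast
  then show ?thesis using greater by (intro exI[of _ v]) (auto simp: algebra_simps)
qed

text \<open>
  The mean value theorem is applied after subtracting the quadratic part, because
  \<open>s y - m y\<close> is still monotone.
\<close>

lemma bregman_lower: "m / 2 * (y - z)\<^sup>2 \<le> bregman y z"
proof -
  have "((\<lambda>y. primitive y - m / 2 * y\<^sup>2) has_real_derivative s v - m * v) (at v)" for v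
    by (auto intro!: derivative_eq_intros primitive_deriv)
  from mean_value_between[OF this, of z y] obtain v where
    v: "z \<le> y \<longrightarrow> z \<le> v" "y \<le> z \<longrightarrow> v \<le> z"
      "primitive y - m / 2 * y\<^sup>2 - (primitive z - m / 2 * z\<^sup>2) = (s v - m * v) * (y - z)"
    by blast
  have "0 \<le> ((s v - m * v) - (s z - m * z)) * (y - z)"
  proof (cases "z \<le> y")
    case True
    then show ?thesis using v(1) slope_lower[of z v] by (intro mult_nonneg_nonneg) (auto simp: algebra_simps)
  next
    case False
    then show ?thesis using v(2) slope_lower[of v z] by (intro mult_nonpos_nonpos) (auto simp: algebra_simps)
  qed
  then show ?thesis using v(3) by (simp add: bregman_def power2_eq_square field_simps)
qed

lemma bregman_upper: "bregman y z \<le> L * (y - z)\<^sup>2"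
proof -
  from mean_value_between[OF primitive_deriv, of z y] obtain v where
    v: "\<bar>v - z\<bar> \<le> \<bar>y - z\<bar>" "primitive y - primitive z = s v * (y - z)" by blast
  have "bregman y z = (s v - s z) * (y - z)" using v(2) by (simp add: bregman_def algebra_simps)
  also have "\<dots> \<le> \<bar>s v - s z\<bar> * \<bar>y - z\<bar>" by (metis abs_ge_self abs_mult)
  also have "\<dots> \<le> (L * \<bar>y - z\<bar>) * \<bar>y - z\<bar>"
    using s_lipschitz[of v z] v(1) L_pos
    by (intro mult_right_mono) (auto intro: order_trans mult_left_mono)
  also have "\<dots> = L * (y - z)\<^sup>2" by (simp add: power2_eq_square)
  finally show ?thesis .
qed

text \<open>
  The energy stored in the lines, with its linear part at \<open>z\<close> subtracted so that \<open>z\<close> is its minimum.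
\<close>

definition potential :: "real ^ 'n \<Rightarrow> real ^ 'n \<Rightarrow> real" where
  "potential x z = (\<Sum>i\<in>UNIV. \<Sum>j\<in>UNIV. B i j * bregman (x $ i - x $ j) (z $ i - z $ j)) / 2"

lemma potential_coercive: "\<exists>\<alpha>>0. \<forall>x z. x $ r = z $ r \<longrightarrow> \<alpha> * (norm (x - z))\<^sup>2 \<le> potential x z"
proof -
  obtain \<kappa> where \<kappa>: "\<kappa> > 0" "\<And>h. h $ r = 0 \<Longrightarrow> \<kappa> * (norm h)\<^sup>2 \<le> dirichlet h"
    using dirichlet_coercive by blast
  have "m * \<kappa> / 4 * (norm (x - z))\<^sup>2 \<le> potential x z" if "x $ r = z $ r" for x z
  proof -
    have "m / 2 * (\<kappa> * (norm (x - z))\<^sup>2) \<le> m / 2 * dirichlet (x - z)"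
      using that m_pos by (intro mult_left_mono \<kappa>) auto
    also have "\<dots> \<le> (\<Sum>i\<in>UNIV. \<Sum>j\<in>UNIV. B i j * bregman (x $ i - x $ j) (z $ i - z $ j))"
      unfolding dirichlet_def sum_distrib_left
    proof (intro sum_mono)
      fix i j
      have "m / 2 * ((x - z) $ i - (x - z) $ j)\<^sup>2 \<le> bregman (x $ i - x $ j) (z $ i - z $ j)"
        using bregman_lower[of "x $ i - x $ j" "z $ i - z $ j"] by (simp add: algebra_simps)
      from mult_left_mono[OF this B_nonneg]
      show "m / 2 * (B i j * ((x - z) $ i - (x - z) $ j)\<^sup>2)
        \<le> B i j * bregman (x $ i - x $ j) (z $ i - z $ j)"
        by (simp only: mult.left_commute)
    qed
    finally show ?thesis by (simp add: potential_def mult.assoc mult.left_commute)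
  qed
  then show ?thesis using \<kappa>(1) m_pos by (intro exI[of _ "m * \<kappa> / 4"]) auto
qed

lemma potential_upper: "\<exists>\<beta>>0. \<forall>x z. potential x z \<le> \<beta> * (norm (x - z))\<^sup>2"
proof -
  let ?\<beta> = "\<Sum>i\<in>UNIV. \<Sum>j\<in>UNIV. B i j * (2 * L)"
  have \<beta>: "0 \<le> ?\<beta>"
    using L_pos by (intro sum_nonneg mult_nonneg_nonneg[OF B_nonneg]) simp
  have "potential x z \<le> ?\<beta> * (norm (x - z))\<^sup>2" for x z
  proof -
    have "potential x z \<le> (\<Sum>i\<in>UNIV. \<Sum>j\<in>UNIV. 2 * (B i j * (2 * L) * (norm (x - z))\<^sup>2)) / 2"
      unfolding potential_def
    proof (intro divide_right_mono sum_mono)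
      fix i j
      have "\<bar>(x $ i - x $ j) - (z $ i - z $ j)\<bar> \<le> 2 * norm (x - z)"
        using component_le_norm_cart[of "x - z" i] component_le_norm_cart[of "x - z" j] by simp
      then have "((x $ i - x $ j) - (z $ i - z $ j))\<^sup>2 \<le> (2 * norm (x - z))\<^sup>2"
        by (rule power2_le_iff_abs_le[THEN iffD2, rotated]) simp
      then have "L * ((x $ i - x $ j) - (z $ i - z $ j))\<^sup>2 \<le> L * (2 * norm (x - z))\<^sup>2"
        using L_pos by (intro mult_left_mono) auto
      then have "bregman (x $ i - x $ j) (z $ i - z $ j) \<le> L * (2 * norm (x - z))\<^sup>2"
        using bregman_upper order_trans by blast
      from mult_left_mono[OF this B_nonneg]
      show "B i j * bregman (x $ i - x $ j) (z $ i - z $ j) \<le> 2 * (B i j * (2 * L) * (norm (x - z))\<^sup>2)"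
        by (simp add: power_mult_distrib mult.left_commute mult.assoc)
    qed simp
    also have "\<dots> = ?\<beta> * (norm (x - z))\<^sup>2"
      by (simp add: sum_distrib_left[symmetric] sum_distrib_right[symmetric])
    finally show ?thesis .
  qed
  then have "\<forall>x z. potential x z \<le> (?\<beta> + 1) * (norm (x - z))\<^sup>2"
    by (simp add: distrib_right add_increasing2)
  then show ?thesis using \<beta> by (intro exI[of _ "?\<beta> + 1"]) auto
qed

text \<open>The three-point identity of Bregman distances: the gradient of the potential is the flow.\<close>

lemma potential_three_points:
  "potential x' z - potential x z
    = potential x' x + (\<Sum>i\<in>UNIV. (x' - x) $ i * (net_flow x i - net_flow z i))"
proof -
  have *: "bregman (x' $ i - x' $ j) (z $ i - z $ j) - bregman (x $ i - x $ j) (z $ i - z $ j)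
      = bregman (x' $ i - x' $ j) (x $ i - x $ j)
        + ((x' - x) $ i - (x' - x) $ j) * (s (x $ i - x $ j) - s (z $ i - z $ j))" for i j
    by (simp add: bregman_def algebra_simps)
  have "2 * (potential x' z - potential x z)
    = (\<Sum>i\<in>UNIV. \<Sum>j\<in>UNIV. B i j * (bregman (x' $ i - x' $ j) (z $ i - z $ j)
        - bregman (x $ i - x $ j) (z $ i - z $ j)))"
    unfolding potential_def right_diff_distrib sum_subtractf by simp
  also have "\<dots> = 2 * potential x' x + 2 * (\<Sum>i\<in>UNIV. (x' - x) $ i * (net_flow x i - net_flow z i))"
    unfolding * sum_net_flow_diff potential_def distrib_left sum.distrib by simp
  finally show ?thesis by simp
qed

lemma potential_nonneg: "0 \<le> potential x z"
proof -
  have "0 \<le> bregman y z" for y z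
    using bregman_lower[of y z] m_pos by (meson order_trans mult_nonneg_nonneg zero_le_power2 divide_nonneg_pos less_imp_le zero_less_numeral)
  then show ?thesis unfolding potential_def by (intro divide_nonneg_pos sum_nonneg mult_nonneg_nonneg B_nonneg) auto
qed

end

context loaded_network
begin

text \<open>
  The load angles depend on the other angles only in a Lipschitz way, but at a load the gradient
  of the potential vanishes; hence the potential is differentiable along \<^const>\<open>load_flow\<close>, as in the
  envelope theorem.
\<close>

lemma potential_load_flow_deriv:
  assumes z: "\<And>i. i \<in> Ld \<Longrightarrow> net_flow z i = P i"
  shows "((\<lambda>a. potential (load_flow a) z) has_derivative
    (\<lambda>h. \<Sum>i\<in>- Ld - {r}. (net_flow (load_flow a) i - net_flow z i) * h $ i)) (at a)"
proof -
  obtain K where K: "K-lipschitz_on UNIV load_flow" using load_flow_lipschitz by blast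
  obtain \<beta> where \<beta>: "\<beta> > 0" "\<And>x z. potential x z \<le> \<beta> * (norm (x - z))\<^sup>2"
    using potential_upper by blast
  let ?D = "\<lambda>h. \<Sum>i\<in>- Ld - {r}. (net_flow (load_flow a) i - net_flow z i) * h $ i"
  have rem: "potential (load_flow b) z - potential (load_flow a) z - ?D (b - a)
    = potential (load_flow b) (load_flow a)" for b
  proof -
    have "(\<Sum>i\<in>UNIV. (load_flow b - load_flow a) $ i * (net_flow (load_flow a) i - net_flow z i))
      = ?D (b - a)"
      by (rule sum.mono_neutral_cong_right)
        (auto simp: load_flow_load z load_flow_ref load_flow_nonload mult.commute)
    then show ?thesis using potential_three_points[of "load_flow b" z "load_flow a"] by simp
  qed
  show ?thesis
  proof (rule has_derivativeI_sandwich[of 1])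
    show "bounded_linear ?D"
      by (intro bounded_linear_sum bounded_linear_const_mult bounded_linear_vec_nth)
    show "((\<lambda>b. \<beta> * K\<^sup>2 * norm (b - a)) \<longlongrightarrow> 0) (at a)"
      by (rule tendsto_eq_rhs, (rule tendsto_intros)+) simp
    fix b assume "b \<noteq> a"
    have "norm (load_flow b - load_flow a) \<le> K * norm (b - a)"
      by (rule lipschitz_on_normD[OF K]) auto
    then have "(norm (load_flow b - load_flow a))\<^sup>2 \<le> (K * norm (b - a))\<^sup>2"
      by (rule power_mono) simp
    then have "\<beta> * (norm (load_flow b - load_flow a))\<^sup>2 \<le> \<beta> * (K * norm (b - a))\<^sup>2"
      using \<beta>(1) by (intro mult_left_mono) auto
    then have "potential (load_flow b) (load_flow a) \<le> \<beta> * (K * norm (b - a))\<^sup>2"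
      using \<beta>(2) order_trans by blast
    then have "norm (potential (load_flow b) z - potential (load_flow a) z - ?D (b - a))
      \<le> \<beta> * (K * norm (b - a))\<^sup>2"
      unfolding rem by (simp add: potential_nonneg)
    also have "\<dots> = \<beta> * K\<^sup>2 * norm (b - a) * norm (b - a)"
      by (simp add: power2_eq_square)
    finally show "norm (potential (load_flow b) z - potential (load_flow a) z - ?D (b - a)) / norm (b - a)
      \<le> \<beta> * K\<^sup>2 * norm (b - a)"
      using \<open>b \<noteq> a\<close> by (simp add: divide_le_eq)
  qed simp
qed

end

section \<open>The forced swing equations\<close>

lemma lipschitz_on_vec:
  fixes f :: "'a::metric_space \<Rightarrow> real ^ 'n::finite"
  assumes "\<And>i. \<exists>K. K-lipschitz_on U (\<lambda>z. f z $ i)"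
  shows "\<exists>K. K-lipschitz_on U f"
proof -
  from assms obtain K where K: "\<And>i. (K i)-lipschitz_on U (\<lambda>z. f z $ i)" by metis
  have "(\<Sum>i\<in>UNIV. K i)-lipschitz_on U f"
  proof (rule lipschitz_onI)
    fix x y assume xy: "x \<in> U" "y \<in> U"
    have "dist (f x) (f y) \<le> (\<Sum>i\<in>UNIV. \<bar>(f x - f y) $ i\<bar>)"
      unfolding dist_norm by (rule norm_le_l1_cart)
    also have "\<dots> \<le> (\<Sum>i\<in>UNIV. K i * dist x y)"
      using lipschitz_onD[OF K xy] by (intro sum_mono) (simp add: dist_real_def)
    finally show "dist (f x) (f y) \<le> (\<Sum>i\<in>UNIV. K i) * dist x y" by (simp add: sum_distrib_right)
  next
    show "0 \<le> (\<Sum>i\<in>UNIV. K i)" using K lipschitz_on_nonneg by (intro sum_nonneg) blast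
  qed
  then show ?thesis by blast
qed

lemma lipschitz_on_divide:
  fixes f :: "'a::metric_space \<Rightarrow> real"
  assumes "K-lipschitz_on U f"
  shows "(\<bar>1 / c\<bar> * K)-lipschitz_on U (\<lambda>z. f z / c)"
  using lipschitz_on_cmult_real[OF assms, of "1 / c"] by simp

lemma lipschitz_on_bounded_linear:
  assumes "bounded_linear f"
  shows "\<exists>K. K-lipschitz_on U f"
proof -
  obtain K where "\<And>x. norm (f x) \<le> norm x * K" "0 < K"
    using bounded_linear.pos_bounded[OF assms] by blast
  then show ?thesis
    using assms by (intro exI[of _ K] lipschitz_onI)
      (simp_all add: dist_norm bounded_linear.linear linear_diff[symmetric] mult.commute)
qed

lemma finite_pos_bounds:
  fixes f :: "'a \<Rightarrow> real"
  assumes "finite A" "\<And>i. i \<in> A \<Longrightarrow> 0 < f i"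
  shows "\<exists>\<delta>>0. \<exists>\<Lambda>>0. \<forall>i\<in>A. \<delta> \<le> f i \<and> f i \<le> \<Lambda>"
proof -
  let ?S = "insert 1 (f ` A)"
  have "finite ?S" using assms by simp
  then have "0 < Min ?S" "0 < Max ?S" "\<And>i. i \<in> A \<Longrightarrow> Min ?S \<le> f i \<and> f i \<le> Max ?S"
    using assms(2) by (auto simp: Min_gr_iff Max_gr_iff simp del: Min_insert Max_insert)
  then show ?thesis by blast
qed

text \<open>
  A product with a bounded factor is absorbed into a small multiple of the square of the other factor.
\<close>

lemma young:
  fixes a b c p :: real
  assumes "0 < p" "\<bar>a\<bar> \<le> c" 
  shows "a * b \<le> p * b\<^sup>2 + c\<^sup>2 / (4 * p)"
proof -
  have "a\<^sup>2 \<le> c\<^sup>2" using assms(2) by (metis abs_ge_zero power2_abs power_mono)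
  moreover have "0 \<le> (2 * p * b - a)\<^sup>2" by simp
  ultimately have "4 * p * (a * b) \<le> 4 * p * (p * b\<^sup>2) + c\<^sup>2"
    by (simp add: power2_eq_square algebra_simps)
  then have "4 * p * (a * b) \<le> 4 * p * (p * b\<^sup>2 + c\<^sup>2 / (4 * p))"
    using assms(1) by (simp add: distrib_left)
  then show ?thesis using assms(1) by (simp add: mult_le_cancel_left)
qed

locale swing_network = loaded_network B s m L r Ld P
  for B :: "'n::finite \<Rightarrow> 'n \<Rightarrow> real" and s m L r Ld P +
  fixes M F :: "'n set" and J D :: "'n \<Rightarrow> real"
  assumes cover: "M \<union> F \<union> Ld = UNIV"
    and disjoint: "M \<inter> F = {}" "M \<inter> Ld = {}" "F \<inter> Ld = {}"
    and ref_machine: "r \<in> M"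
    and J_pos: "i \<in> M \<Longrightarrow> 0 < J i"
    and D_pos: "i \<in> M \<union> F \<Longrightarrow> 0 < D i"
begin

text \<open>
  The first component of the state carries the angles of the machines and devices; its load
  entries are constant, and the complete angle vector is its \<^const>\<open>load_flow\<close>.  The frequency of a
  device is eliminated, as in the differential algebraic system.
\<close>

definition drift :: "(real ^ 'n) \<times> (real ^ 'n) \<Rightarrow> (real ^ 'n) \<times> (real ^ 'n)" where
  "drift y =
    (\<chi> i. if i \<in> M then snd y $ i - snd y $ r
          else if i \<in> F then (P i - net_flow (load_flow (fst y)) i) / D i - snd y $ r else 0,
     \<chi> i. if i \<in> M then (P i - D i * snd y $ i - net_flow (load_flow (fst y)) i) / J i else 0)"

definition drive :: "('n \<Rightarrow> real) \<Rightarrow> (real ^ 'n) \<times> (real ^ 'n)" where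
  "drive u = (\<chi> i. if i \<in> F then u i / D i else 0, \<chi> i. if i \<in> M then u i / J i else 0)"

definition swing_solution ::
    "(real \<Rightarrow> 'n \<Rightarrow> real) \<Rightarrow> real set \<Rightarrow> (real \<Rightarrow> (real ^ 'n) \<times> (real ^ 'n)) \<Rightarrow> bool" where
  "swing_solution u I y \<longleftrightarrow>
     (\<forall>t\<in>I. (y has_vector_derivative drift (y t) + drive (u t)) (at t within I))"

lemma drift_lipschitz: "\<exists>K. K-lipschitz_on UNIV drift"
proof -
  let ?U = "UNIV :: ((real ^ 'n) \<times> (real ^ 'n)) set"
  obtain C where C: "C > 0" "\<And>x z i. \<bar>net_flow x i - net_flow z i\<bar> \<le> C * norm (x - z)"
    using net_flow_lipschitz by blast
  have net: "C-lipschitz_on UNIV (\<lambda>x. net_flow x i)" for i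
    using C by (intro lipschitz_onI) (auto simp: dist_norm)
  obtain G where G: "G-lipschitz_on UNIV load_flow" using load_flow_lipschitz by blast
  have fst: "\<exists>K. K-lipschitz_on ?U fst"
    by (rule lipschitz_on_bounded_linear[OF bounded_linear_fst])
  then obtain K1 where K1: "K1-lipschitz_on ?U fst" by blast
  have flow: "\<exists>K. K-lipschitz_on ?U (\<lambda>y. net_flow (load_flow (fst y)) i)" for i
    using lipschitz_on_compose2[OF lipschitz_on_compose2[OF K1] , of G load_flow C "\<lambda>x. net_flow x i"]
      lipschitz_on_subset[OF G] lipschitz_on_subset[OF net]
    by blast
  have freq: "\<exists>K. K-lipschitz_on ?U (\<lambda>y. snd y $ i)" for i
    by (intro lipschitz_on_bounded_linear bounded_linear_compose[OF bounded_linear_vec_nth bounded_linear_snd])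
  have comb: "\<exists>K. K-lipschitz_on ?U (\<lambda>y. (c - d * snd y $ i - e * net_flow (load_flow (fst y)) i) / b - g * snd y $ j)"
    for b c d e g i j
  proof -
    from flow freq obtain Kf Kw where
      "\<And>i. (Kf i)-lipschitz_on ?U (\<lambda>y. net_flow (load_flow (fst y)) i)"
      "\<And>i. (Kw i)-lipschitz_on ?U (\<lambda>y. snd y $ i)" by metis
    then show ?thesis
      using lipschitz_on_diff[OF lipschitz_on_divide[OF lipschitz_on_diff[OF lipschitz_on_diff[OF
              lipschitz_on_constant lipschitz_on_cmult_real] lipschitz_on_cmult_real]] lipschitz_on_cmult_real]
      by blast
  qed
  have "\<exists>K. K-lipschitz_on ?U (\<lambda>y. fst (drift y) $ i)" for i
    unfolding drift_def
    using comb[of 0 "-1" i 0 1 1 r] comb[of "P i" 0 i 1 "D i" 1 r] lipschitz_on_constant[of ?U "0::real"]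
    by (cases "i \<in> M"; cases "i \<in> F") auto
  then obtain A where A: "A-lipschitz_on ?U (\<lambda>y. fst (drift y))"
    using lipschitz_on_vec[of ?U "\<lambda>y. fst (drift y)"] by blast
  have "\<exists>K. K-lipschitz_on ?U (\<lambda>y. snd (drift y) $ i)" for i
    unfolding drift_def
    using comb[of "P i" "D i" i 1 "J i" 0 r] lipschitz_on_constant[of ?U "0::real"]
    by (cases "i \<in> M") auto
  then obtain A' where A': "A'-lipschitz_on ?U (\<lambda>y. snd (drift y))"
    using lipschitz_on_vec[of ?U "\<lambda>y. snd (drift y)"] by blast
  show ?thesis using lipschitz_on_Pair[OF A A'] by auto
qed

lemma swing_solution_exists:
  assumes "\<And>i. continuous_on {0..} (\<lambda>t. u t i)" "\<And>i. bounded ((\<lambda>t. u t i) ` {0..})"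
  shows "\<exists>y. y 0 = y0 \<and> swing_solution u {0..} y"
proof -
  obtain K where K: "K-lipschitz_on UNIV drift" using drift_lipschitz by blast
  have cont: "continuous_on {0..} (\<lambda>t. drive (u t))"
  proof -
    have "continuous_on {0..} (\<lambda>t. if i \<in> A then u t i / d i else 0)" for i and A :: "'n set" and d
      unfolding divide_inverse
      by (cases "i \<in> A") (simp_all add: continuous_on_mult_right assms(1))
    then show ?thesis
      unfolding drive_def by (intro continuous_on_Pair continuous_on_vec_lambda)
  qed
  obtain C where C: "\<And>t i. 0 \<le> t \<Longrightarrow> \<bar>u t i\<bar> \<le> C i"
  proof -
    have "\<exists>C. \<forall>t\<ge>0. \<bar>u t i\<bar> \<le> C" for i
      using assms(2)[of i] by (auto simp: bounded_iff)
    then show ?thesis using that by metis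
  qed
  have "norm (drive (u t)) \<le> (\<Sum>i\<in>UNIV. C i / \<bar>D i\<bar>) + (\<Sum>i\<in>UNIV. C i / \<bar>J i\<bar>)" if "0 \<le> t" for t
  proof -
    have C0: "0 \<le> C i" for i using C[OF that, of i] by linarith
    have *: "norm (\<chi> i. if i \<in> A then u t i / d i else 0) \<le> (\<Sum>i\<in>UNIV. C i / \<bar>d i\<bar>)"
      for A :: "'n set" and d
      by (rule order_trans[OF norm_le_l1_cart])
        (auto intro!: sum_mono divide_right_mono C[OF that] divide_nonneg_nonneg C0)
    show ?thesis
      unfolding drive_def using norm_Pair_le
        *[of F D] *[of M J] by (meson add_mono order_trans)
  qed
  then have "bounded ((\<lambda>t. drive (u t)) ` {0..})"
    by (auto simp: bounded_iff)
  from lipschitz_ode_exists[OF K cont this, of y0] show ?thesis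
    by (auto simp: swing_solution_def)
qed

lemma swing_solution_unique:
  assumes "0 \<le> T" "swing_solution u {0..T} y" "swing_solution u {0..T} y'" "y 0 = y' 0"
  shows "y T = y' T"
proof -
  obtain K where "K-lipschitz_on UNIV drift" using drift_lipschitz by blast
  from lipschitz_ode_unique[OF \<open>0 \<le> T\<close> this, of y "\<lambda>t. drive (u t)" y'] assms
  show ?thesis by (auto simp: swing_solution_def)
qed

lemma swing_solution_subset:
  "swing_solution u I y \<Longrightarrow> I' \<subseteq> I \<Longrightarrow> swing_solution u I' y"
  by (auto simp: swing_solution_def intro: has_vector_derivative_within_subset)

lemma swing_solution_fst:
  assumes "swing_solution u I y" "t \<in> I" "i \<in> M \<union> F"
  shows "((\<lambda>t. fst (y t) $ i) has_real_derivative
      (if i \<in> M then snd (y t) $ i - snd (y t) $ r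
       else (P i - net_flow (load_flow (fst (y t))) i + u t i) / D i - snd (y t) $ r)) (at t within I)"
proof -
  have "bounded_linear (\<lambda>y :: (real ^ 'n) \<times> (real ^ 'n). fst y $ i)"
    by (rule bounded_linear_compose[OF bounded_linear_vec_nth bounded_linear_fst])
  from bounded_linear.has_vector_derivative[OF this assms(1)[unfolded swing_solution_def, rule_format, OF assms(2)]]
    assms(3) disjoint
  show ?thesis
    by (auto simp: has_real_derivative_iff_has_vector_derivative drift_def drive_def
        add_divide_distrib diff_divide_distrib algebra_simps split: if_splits)
qed

lemma swing_solution_snd:
  assumes "swing_solution u I y" "t \<in> I" "i \<in> M"
  shows "((\<lambda>t. snd (y t) $ i) has_real_derivative
      (P i - D i * snd (y t) $ i - net_flow (load_flow (fst (y t))) i + u t i) / J i) (at t within I)"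
proof -
  have "bounded_linear (\<lambda>y :: (real ^ 'n) \<times> (real ^ 'n). snd y $ i)"
    by (rule bounded_linear_compose[OF bounded_linear_vec_nth bounded_linear_snd])
  from bounded_linear.has_vector_derivative[OF this assms(1)[unfolded swing_solution_def, rule_format, OF assms(2)]]
    assms(3) disjoint
  show ?thesis
    by (auto simp: has_real_derivative_iff_has_vector_derivative drift_def drive_def
        add_divide_distrib diff_divide_distrib algebra_simps)
qed

lemma swing_solution_load_flow:
  assumes "swing_solution u I y" "t \<in> I" "i \<in> M \<union> F"
  shows "((\<lambda>t. load_flow (fst (y t)) $ i) has_real_derivative
      (if i \<in> M then snd (y t) $ i - snd (y t) $ r
       else (P i - net_flow (load_flow (fst (y t))) i + u t i) / D i - snd (y t) $ r)) (at t within I)"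
proof (cases "i = r")
  case True
  then show ?thesis using ref_machine by (simp add: load_flow_ref)
next
  case False
  moreover have "i \<notin> Ld" using assms(3) disjoint by auto
  ultimately have "(\<lambda>t. load_flow (fst (y t)) $ i) = (\<lambda>t. fst (y t) $ i)"
    by (simp add: load_flow_nonload)
  then show ?thesis using swing_solution_fst[OF assms] by simp
qed

end

section \<open>A strict Lyapunov function\<close>

context swing_network
begin

lemma J_bounds: "\<exists>\<delta>>0. \<exists>\<Lambda>>0. \<forall>i\<in>M. \<delta> \<le> J i \<and> J i \<le> \<Lambda>"
  and D_bounds: "\<exists>\<delta>>0. \<exists>\<Lambda>>0. \<forall>i\<in>M. \<delta> \<le> D i \<and> D i \<le> \<Lambda>"
  and inverse_D_bounds: "\<exists>\<delta>>0. \<exists>\<Lambda>>0. \<forall>i\<in>F. \<delta> \<le> 1 / D i \<and> 1 / D i \<le> \<Lambda>"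
  by (auto intro!: finite_pos_bounds J_pos D_pos)

definition energy :: "real ^ 'n \<Rightarrow> real ^ 'n \<Rightarrow> real ^ 'n \<Rightarrow> real" where
  "energy z x w = (\<Sum>i\<in>M. J i * (w $ i)\<^sup>2) / 2 + potential x z"

definition cross_term :: "real ^ 'n \<Rightarrow> real ^ 'n \<Rightarrow> real ^ 'n \<Rightarrow> real" where
  "cross_term z x w = (\<Sum>i\<in>M. J i * w $ i * (x $ i - z $ i))"

text \<open>
  \<open>energy_rate\<close> and \<open>cross_term_rate\<close> are the derivatives along solutions, where \<open>d\<close> is the
  deviation of the forcing from the one that balances the flow of \<open>z\<close>; see
  \<open>lyapunov_along_solution\<close>.
\<close>

definition energy_rate :: "real ^ 'n \<Rightarrow> real ^ 'n \<Rightarrow> real ^ 'n \<Rightarrow> ('n \<Rightarrow> real) \<Rightarrow> real" where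
  "energy_rate z x w d = (\<Sum>i\<in>M. w $ i * (- D i * w $ i + d i))
     + (\<Sum>i\<in>F. (net_flow x i - net_flow z i) * (- (net_flow x i - net_flow z i) + d i) / D i)"

definition cross_term_rate :: "real ^ 'n \<Rightarrow> real ^ 'n \<Rightarrow> real ^ 'n \<Rightarrow> ('n \<Rightarrow> real) \<Rightarrow> real" where
  "cross_term_rate z x w d =
     (\<Sum>i\<in>M. (- D i * w $ i - (net_flow x i - net_flow z i) + d i) * (x $ i - z $ i)
       + J i * w $ i * (w $ i - w $ r))"

definition error :: "real ^ 'n \<Rightarrow> real ^ 'n \<Rightarrow> real ^ 'n \<Rightarrow> real" where
  "error z x w = (norm (x - z))\<^sup>2 + (\<Sum>i\<in>M. (w $ i)\<^sup>2)"

lemma norm_power2_eq_sum: "(norm x)\<^sup>2 = (\<Sum>i\<in>UNIV. (x $ i)\<^sup>2)" for x :: "real ^ 'k::finite"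
  by (simp add: norm_vec_def L2_set_def sum_nonneg)

lemma error_nonneg: "0 \<le> error z x w"
  by (simp add: error_def sum_nonneg)

lemma energy_rate_bound:
  "\<exists>\<delta>>0. \<exists>\<kappa>>0. \<forall>z x w d q. (\<forall>i\<in>M \<union> F. \<bar>d i\<bar> \<le> \<bar>q\<bar>) \<longrightarrow>
     energy_rate z x w d
       \<le> - \<delta> * ((\<Sum>i\<in>M. (w $ i)\<^sup>2) + (\<Sum>i\<in>F. (net_flow x i - net_flow z i)\<^sup>2)) + \<kappa> * q\<^sup>2"
proof -
  obtain \<delta>1 where \<delta>1: "0 < \<delta>1" "\<And>i. i \<in> M \<Longrightarrow> \<delta>1 \<le> D i" using D_bounds by blast
  obtain \<delta>2 \<Lambda> where \<delta>2: "0 < \<delta>2" "\<And>i. i \<in> F \<Longrightarrow> \<delta>2 \<le> 1 / D i"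
    and \<Lambda>: "0 < \<Lambda>" "\<And>i. i \<in> F \<Longrightarrow> 1 / D i \<le> \<Lambda>"
    using inverse_D_bounds by blast
  define \<delta> where "\<delta> = min \<delta>1 \<delta>2 / 2"
  have \<delta>: "0 < \<delta>" "2 * \<delta> \<le> \<delta>1" "2 * \<delta> \<le> \<delta>2" using \<delta>1 \<delta>2 by (auto simp: \<delta>_def)
  define N where "N = real CARD('n)"
  have card: "real (card A) \<le> N" for A :: "'n set"
    unfolding N_def by (simp add: card_mono)
  define \<kappa> where "\<kappa> = N * (1 / (4 * \<delta>)) + N * (\<Lambda>\<^sup>2 / (4 * \<delta>))"
  have "N > 0" by (simp add: N_def)
  then have "\<kappa> > 0" using \<delta>(1) \<Lambda>(1) by (auto simp: \<kappa>_def intro!: add_pos_pos)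
  moreover have "energy_rate z x w d
       \<le> - \<delta> * ((\<Sum>i\<in>M. (w $ i)\<^sup>2) + (\<Sum>i\<in>F. (net_flow x i - net_flow z i)\<^sup>2)) + \<kappa> * q\<^sup>2"
    if d: "\<forall>i\<in>M \<union> F. \<bar>d i\<bar> \<le> \<bar>q\<bar>" for z x w d q
  proof -
    define f where "f i = net_flow x i - net_flow z i" for i
    have "(\<Sum>i\<in>M. w $ i * (- D i * w $ i + d i)) \<le> (\<Sum>i\<in>M. - \<delta> * (w $ i)\<^sup>2 + q\<^sup>2 / (4 * \<delta>))"
    proof (rule sum_mono)
      fix i assume i: "i \<in> M"
      have "2 * \<delta> * (w $ i)\<^sup>2 \<le> D i * (w $ i)\<^sup>2"
        using \<delta>1(2)[OF i] \<delta> by (intro mult_right_mono) auto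
      moreover have "d i * w $ i \<le> \<delta> * (w $ i)\<^sup>2 + \<bar>q\<bar>\<^sup>2 / (4 * \<delta>)"
        using d i \<delta>(1) by (intro young) auto
      ultimately show "w $ i * (- D i * w $ i + d i) \<le> - \<delta> * (w $ i)\<^sup>2 + q\<^sup>2 / (4 * \<delta>)"
        by (simp add: power2_eq_square algebra_simps)
    qed
    also have "\<dots> = - \<delta> * (\<Sum>i\<in>M. (w $ i)\<^sup>2) + real (card M) * (q\<^sup>2 / (4 * \<delta>))"
      by (simp add: sum.distrib sum_distrib_left sum_negf sum_subtractf)
    finally have A: "(\<Sum>i\<in>M. w $ i * (- D i * w $ i + d i))
      \<le> - \<delta> * (\<Sum>i\<in>M. (w $ i)\<^sup>2) + real (card M) * (q\<^sup>2 / (4 * \<delta>))" .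
    have "(\<Sum>i\<in>F. f i * (- f i + d i) / D i) \<le> (\<Sum>i\<in>F. - \<delta> * (f i)\<^sup>2 + (\<Lambda> * \<bar>q\<bar>)\<^sup>2 / (4 * \<delta>))"
    proof (rule sum_mono)
      fix i assume i: "i \<in> F"
      have "2 * \<delta> * (f i)\<^sup>2 \<le> 1 / D i * (f i)\<^sup>2"
        using \<delta>2(2)[OF i] \<delta> by (intro mult_right_mono) auto
      moreover have "(1 / D i * d i) * f i \<le> \<delta> * (f i)\<^sup>2 + (\<Lambda> * \<bar>q\<bar>)\<^sup>2 / (4 * \<delta>)"
      proof (rule young[OF \<delta>(1)])
        have "0 \<le> 1 / D i" using D_pos[of i] i by simp
        then show "\<bar>1 / D i * d i\<bar> \<le> \<Lambda> * \<bar>q\<bar>"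
          using \<Lambda>(2)[OF i] \<Lambda>(1) d i unfolding abs_mult by (intro mult_mono) auto
      qed
      ultimately show "f i * (- f i + d i) / D i \<le> - \<delta> * (f i)\<^sup>2 + (\<Lambda> * \<bar>q\<bar>)\<^sup>2 / (4 * \<delta>)"
        by (simp add: power2_eq_square algebra_simps add_divide_distrib diff_divide_distrib)
    qed
    also have "\<dots> = - \<delta> * (\<Sum>i\<in>F. (f i)\<^sup>2) + real (card F) * (\<Lambda>\<^sup>2 / (4 * \<delta>) * q\<^sup>2)"
      by (simp add: sum.distrib sum_distrib_left sum_negf sum_subtractf power_mult_distrib)
    finally have B: "(\<Sum>i\<in>F. f i * (- f i + d i) / D i)
      \<le> - \<delta> * (\<Sum>i\<in>F. (f i)\<^sup>2) + real (card F) * (\<Lambda>\<^sup>2 / (4 * \<delta>) * q\<^sup>2)" .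
    have "real (card M) * (q\<^sup>2 / (4 * \<delta>)) \<le> N * (q\<^sup>2 / (4 * \<delta>))"
      using card \<delta>(1) by (intro mult_right_mono) auto
    moreover have "real (card F) * (\<Lambda>\<^sup>2 / (4 * \<delta>) * q\<^sup>2) \<le> N * (\<Lambda>\<^sup>2 / (4 * \<delta>) * q\<^sup>2)"
      using card \<delta>(1) by (intro mult_right_mono) auto
    moreover have "N * (q\<^sup>2 / (4 * \<delta>)) + N * (\<Lambda>\<^sup>2 / (4 * \<delta>) * q\<^sup>2) = \<kappa> * q\<^sup>2"
      by (simp add: \<kappa>_def algebra_simps)
    ultimately show ?thesis
      using A B unfolding energy_rate_def f_def[symmetric] distrib_left by linarith
  qed
  ultimately show ?thesis using \<delta>(1) by blast
qed

text \<open>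
  Completed by the device and load terms, the sum of the flow terms over the machines is the pairing
  of strong monotonicity.  The load terms vanish, and the remainder is absorbed by \<open>young\<close>.
\<close>

lemma cross_term_rate_bound:
  "\<exists>\<rho>>0. \<exists>\<kappa>>0. \<forall>z x w d q. (\<forall>i\<in>M \<union> F. \<bar>d i\<bar> \<le> \<bar>q\<bar>) \<longrightarrow> x $ r = z $ r \<longrightarrow>
     (\<forall>i\<in>Ld. net_flow x i = net_flow z i) \<longrightarrow>
     cross_term_rate z x w d \<le> - \<rho> * (norm (x - z))\<^sup>2
       + \<kappa> * ((\<Sum>i\<in>M. (w $ i)\<^sup>2) + (\<Sum>i\<in>F. (net_flow x i - net_flow z i)\<^sup>2) + q\<^sup>2)"
proof -
  obtain \<mu> where \<mu>: "\<mu> > 0" "\<And>x z. x $ r = z $ r \<Longrightarrow>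
     \<mu> * (norm (x - z))\<^sup>2 \<le> (\<Sum>i\<in>UNIV. (x - z) $ i * (net_flow x i - net_flow z i))"
    using net_flow_strongly_monotone by blast
  obtain \<Lambda>1 where \<Lambda>1: "0 < \<Lambda>1" "\<And>i. i \<in> M \<Longrightarrow> D i \<le> \<Lambda>1" using D_bounds by blast
  obtain \<Lambda>2 where \<Lambda>2: "0 < \<Lambda>2" "\<And>i. i \<in> M \<Longrightarrow> J i \<le> \<Lambda>2" using J_bounds by blast
  \<comment> \<open>Each node has at most two mixed terms in its angle error; they consume half of the constant \<open>\<mu>\<close>.\<close>
  define p where "p = \<mu> / 4"
  have p: "0 < p" using \<mu>(1) by (simp add: p_def)
  define N where "N = real CARD('n)"
  have card: "real (card A) \<le> N" for A :: "'n set"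
    unfolding N_def by (simp add: card_mono)
  have N: "0 < N" by (simp add: N_def)
  define \<kappa> where "\<kappa> = 1 / (4 * p) + \<Lambda>1\<^sup>2 / (4 * p) + 2 * \<Lambda>2 + N * \<Lambda>2 + N * (1 / (4 * p))"
  have \<kappa>: "1 / (4 * p) \<le> \<kappa>" "\<Lambda>1\<^sup>2 / (4 * p) + 2 * \<Lambda>2 + N * \<Lambda>2 \<le> \<kappa>" "N * (1 / (4 * p)) \<le> \<kappa>" "0 < \<kappa>"
  proof -
    have nn: "0 < 1 / (4 * p)" "0 \<le> \<Lambda>1\<^sup>2 / (4 * p)" "0 < 2 * \<Lambda>2" "0 < N * \<Lambda>2" "0 < N * (1 / (4 * p))"
      using p N \<Lambda>2(1) by auto
    show "1 / (4 * p) \<le> \<kappa>" "\<Lambda>1\<^sup>2 / (4 * p) + 2 * \<Lambda>2 + N * \<Lambda>2 \<le> \<kappa>" "N * (1 / (4 * p)) \<le> \<kappa>" "0 < \<kappa>"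
      unfolding \<kappa>_def using nn by linarith+
  qed
  have "cross_term_rate z x w d \<le> - (\<mu> / 2) * (norm (x - z))\<^sup>2
       + \<kappa> * ((\<Sum>i\<in>M. (w $ i)\<^sup>2) + (\<Sum>i\<in>F. (net_flow x i - net_flow z i)\<^sup>2) + q\<^sup>2)"
    if d: "\<forall>i\<in>M \<union> F. \<bar>d i\<bar> \<le> \<bar>q\<bar>" and ref: "x $ r = z $ r"
      and load: "\<forall>i\<in>Ld. net_flow x i = net_flow z i" for z x w d q
  proof -
    define f where "f i = net_flow x i - net_flow z i" for i
    define y where "y = x - z"
    define W where "W = (\<Sum>i\<in>M. (w $ i)\<^sup>2)"
    define Fsq where "Fsq = (\<Sum>i\<in>F. (f i)\<^sup>2)"
    have W0: "0 \<le> W" and F0: "0 \<le> Fsq" by (auto simp: W_def Fsq_def sum_nonneg)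
    have wr: "(w $ r)\<^sup>2 \<le> W"
      unfolding W_def using ref_machine by (intro member_le_sum) auto
    have split: "sum g UNIV = sum g M + sum g F + sum g Ld" for g :: "'n \<Rightarrow> real"
      using disjoint by (subst cover[symmetric]) (auto simp: sum.union_disjoint Int_Un_distrib2)
    have "\<mu> * (norm y)\<^sup>2 \<le> (\<Sum>i\<in>UNIV. y $ i * f i)"
      using \<mu>(2)[OF ref] by (simp add: y_def f_def)
    also have "\<dots> = (\<Sum>i\<in>M. y $ i * f i) + (\<Sum>i\<in>F. y $ i * f i)"
      using load by (simp add: split f_def)
    also have "(\<Sum>i\<in>F. y $ i * f i) \<le> (\<Sum>i\<in>F. p * (y $ i)\<^sup>2 + \<bar>f i\<bar>\<^sup>2 / (4 * p))"
      using young[OF p order_refl] by (intro sum_mono) (subst mult.commute, blast)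
    also have "\<dots> = p * (\<Sum>i\<in>F. (y $ i)\<^sup>2) + 1 / (4 * p) * Fsq"
      by (simp add: sum.distrib sum_distrib_left Fsq_def)
    finally have mono: "\<mu> * (norm y)\<^sup>2
      \<le> (\<Sum>i\<in>M. y $ i * f i) + p * (\<Sum>i\<in>F. (y $ i)\<^sup>2) + 1 / (4 * p) * Fsq" by simp
    have "cross_term_rate z x w d
      = (\<Sum>i\<in>M. (- D i * w $ i) * y $ i + d i * y $ i + J i * (w $ i * (w $ i - w $ r)) - y $ i * f i)"
      unfolding cross_term_rate_def f_def[symmetric] y_def
      by (intro sum.cong refl) (simp add: algebra_simps)
    also have "\<dots> \<le> (\<Sum>i\<in>M. (p * (y $ i)\<^sup>2 + (\<Lambda>1 * \<bar>w $ i\<bar>)\<^sup>2 / (4 * p)) + (p * (y $ i)\<^sup>2 + \<bar>q\<bar>\<^sup>2 / (4 * p))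
        + \<Lambda>2 * (2 * (w $ i)\<^sup>2 + (w $ r)\<^sup>2) - y $ i * f i)"
    proof (intro sum_mono add_mono diff_mono order_refl)
      fix i assume i: "i \<in> M"
      have Di: "0 < D i" and Ji: "0 < J i" using i D_pos J_pos by auto
      show "(- D i * w $ i) * y $ i \<le> p * (y $ i)\<^sup>2 + (\<Lambda>1 * \<bar>w $ i\<bar>)\<^sup>2 / (4 * p)"
        using \<Lambda>1(2)[OF i] Di by (intro young[OF p]) (simp add: abs_mult mult_right_mono)
      show "d i * y $ i \<le> p * (y $ i)\<^sup>2 + \<bar>q\<bar>\<^sup>2 / (4 * p)"
        using d i by (intro young[OF p]) auto
      have "w $ i * (w $ i - w $ r) \<le> 2 * (w $ i)\<^sup>2 + (w $ r)\<^sup>2"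
      proof -
        have "0 \<le> (w $ i + w $ r)\<^sup>2 + (w $ i)\<^sup>2 + (w $ r)\<^sup>2" by simp
        then show ?thesis by (simp add: power2_eq_square algebra_simps)
      qed
      then have "J i * (w $ i * (w $ i - w $ r)) \<le> J i * (2 * (w $ i)\<^sup>2 + (w $ r)\<^sup>2)"
        using Ji by (intro mult_left_mono) auto
      also have "\<dots> \<le> \<Lambda>2 * (2 * (w $ i)\<^sup>2 + (w $ r)\<^sup>2)"
        using \<Lambda>2(2)[OF i] by (intro mult_right_mono) auto
      finally show "J i * (w $ i * (w $ i - w $ r)) \<le> \<Lambda>2 * (2 * (w $ i)\<^sup>2 + (w $ r)\<^sup>2)" .
    qed
    also have "\<dots> = 2 * p * (\<Sum>i\<in>M. (y $ i)\<^sup>2) + (\<Lambda>1\<^sup>2 / (4 * p) + 2 * \<Lambda>2) * W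
        + real (card M) * (1 / (4 * p)) * q\<^sup>2 + real (card M) * (\<Lambda>2 * (w $ r)\<^sup>2) - (\<Sum>i\<in>M. y $ i * f i)"
      by (simp add: sum.distrib sum_subtractf sum_distrib_left[symmetric] sum_divide_distrib[symmetric]
          W_def power_mult_distrib algebra_simps)
    also have "\<dots> \<le> 2 * p * (\<Sum>i\<in>M. (y $ i)\<^sup>2) + (\<Lambda>1\<^sup>2 / (4 * p) + 2 * \<Lambda>2) * W
        + N * (1 / (4 * p)) * q\<^sup>2 + N * (\<Lambda>2 * W) - (\<Sum>i\<in>M. y $ i * f i)"
      using card[of M] wr \<Lambda>2(1) N p
      by (intro diff_mono add_mono mult_mono mult_right_mono order_refl) auto
    also have "\<dots> \<le> 2 * p * (\<Sum>i\<in>M. (y $ i)\<^sup>2) + (\<Lambda>1\<^sup>2 / (4 * p) + 2 * \<Lambda>2 + N * \<Lambda>2) * W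
        + N * (1 / (4 * p)) * q\<^sup>2
        + (p * (\<Sum>i\<in>F. (y $ i)\<^sup>2) + 1 / (4 * p) * Fsq - \<mu> * (norm y)\<^sup>2)"
      using mono by (simp add: algebra_simps)
    also have "\<dots> \<le> 2 * p * (\<Sum>i\<in>M. (y $ i)\<^sup>2) + \<kappa> * W + \<kappa> * q\<^sup>2
        + (p * (\<Sum>i\<in>F. (y $ i)\<^sup>2) + \<kappa> * Fsq - \<mu> * (norm y)\<^sup>2)"
      using \<kappa> W0 F0 by (intro add_mono diff_mono mult_right_mono order_refl) auto
    also have "\<dots> \<le> - (\<mu> / 2) * (norm y)\<^sup>2 + \<kappa> * (W + Fsq + q\<^sup>2)"
    proof -
      have "2 * p * (\<Sum>i\<in>M. (y $ i)\<^sup>2) + p * (\<Sum>i\<in>F. (y $ i)\<^sup>2) \<le> 2 * p * (norm y)\<^sup>2"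
        unfolding norm_power2_eq_sum split distrib_left using p
        by (simp add: add_increasing2 sum_nonneg)
      also have "\<dots> = \<mu> / 2 * (norm y)\<^sup>2" by (simp add: p_def)
      finally show ?thesis by (simp add: algebra_simps)
    qed
    finally show ?thesis by (simp add: y_def f_def W_def Fsq_def)
  qed
  then show ?thesis using \<mu>(1) \<kappa>(4) by (intro exI[of _ "\<mu> / 2"] conjI exI[of _ \<kappa>]) auto
qed

lemma cross_term_bound: "\<exists>\<Lambda>>0. \<forall>z x w. \<bar>cross_term z x w\<bar> \<le> \<Lambda> * error z x w"
proof -
  obtain \<Lambda> where \<Lambda>: "0 < \<Lambda>" "\<And>i. i \<in> M \<Longrightarrow> J i \<le> \<Lambda>" using J_bounds by blast
  have "\<bar>cross_term z x w\<bar> \<le> \<Lambda> * error z x w" for z x w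
  proof -
    have "\<bar>cross_term z x w\<bar> \<le> (\<Sum>i\<in>M. \<Lambda> * ((w $ i)\<^sup>2 + ((x - z) $ i)\<^sup>2))"
      unfolding cross_term_def
    proof (rule order_trans[OF sum_abs sum_mono])
      fix i assume i: "i \<in> M"
      have "\<bar>w $ i * (x - z) $ i\<bar> \<le> (w $ i)\<^sup>2 + ((x - z) $ i)\<^sup>2"
      proof -
        have "0 \<le> (\<bar>w $ i\<bar> - \<bar>(x - z) $ i\<bar>)\<^sup>2 + (w $ i)\<^sup>2 + ((x - z) $ i)\<^sup>2" by simp
        then have "2 * (\<bar>w $ i\<bar> * \<bar>(x - z) $ i\<bar>) \<le> 2 * ((w $ i)\<^sup>2 + ((x - z) $ i)\<^sup>2)"
          unfolding power2_diff power2_abs by simp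
        then show ?thesis unfolding abs_mult by simp
      qed
      then have "J i * \<bar>w $ i * (x - z) $ i\<bar> \<le> \<Lambda> * ((w $ i)\<^sup>2 + ((x - z) $ i)\<^sup>2)"
        using \<Lambda>(2)[OF i] \<Lambda>(1) by (intro mult_mono) auto
      then show "\<bar>J i * w $ i * (x $ i - z $ i)\<bar> \<le> \<Lambda> * ((w $ i)\<^sup>2 + ((x - z) $ i)\<^sup>2)"
        using J_pos[OF i] by (simp add: abs_mult mult.assoc)
    qed
    also have "\<dots> = \<Lambda> * ((\<Sum>i\<in>M. ((x - z) $ i)\<^sup>2) + (\<Sum>i\<in>M. (w $ i)\<^sup>2))"
      by (simp add: sum_distrib_left[symmetric] sum.distrib add.commute)
    also have "\<dots> \<le> \<Lambda> * error z x w"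
      unfolding error_def norm_power2_eq_sum using \<Lambda>(1)
      by (intro mult_left_mono add_right_mono sum_mono2) auto
    finally show ?thesis .
  qed
  then show ?thesis using \<Lambda>(1) by blast
qed

lemma energy_bounds:
  "\<exists>\<alpha>>0. \<exists>\<beta>>0. \<forall>z x w. x $ r = z $ r \<longrightarrow>
     \<alpha> * error z x w \<le> energy z x w \<and> energy z x w \<le> \<beta> * error z x w"
proof -
  obtain \<alpha> where \<alpha>: "\<alpha> > 0" "\<And>x z. x $ r = z $ r \<Longrightarrow> \<alpha> * (norm (x - z))\<^sup>2 \<le> potential x z"
    using potential_coercive by blast
  obtain \<beta> where \<beta>: "\<beta> > 0" "\<And>x z. potential x z \<le> \<beta> * (norm (x - z))\<^sup>2"
    using potential_upper by blast
  obtain \<delta> \<Lambda> where J: "0 < \<delta>" "0 < \<Lambda>" "\<And>i. i \<in> M \<Longrightarrow> \<delta> \<le> J i" "\<And>i. i \<in> M \<Longrightarrow> J i \<le> \<Lambda>"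
    using J_bounds by blast
  have W: "\<delta> / 2 * (\<Sum>i\<in>M. (w $ i)\<^sup>2) \<le> (\<Sum>i\<in>M. J i * (w $ i)\<^sup>2) / 2"
    "(\<Sum>i\<in>M. J i * (w $ i)\<^sup>2) / 2 \<le> \<Lambda> / 2 * (\<Sum>i\<in>M. (w $ i)\<^sup>2)" for w :: "real ^ 'n"
  proof -
    have "\<delta> * (\<Sum>i\<in>M. (w $ i)\<^sup>2) \<le> (\<Sum>i\<in>M. J i * (w $ i)\<^sup>2)"
      "(\<Sum>i\<in>M. J i * (w $ i)\<^sup>2) \<le> \<Lambda> * (\<Sum>i\<in>M. (w $ i)\<^sup>2)"
      unfolding sum_distrib_left by (intro sum_mono mult_right_mono J; simp)+
    then show "\<delta> / 2 * (\<Sum>i\<in>M. (w $ i)\<^sup>2) \<le> (\<Sum>i\<in>M. J i * (w $ i)\<^sup>2) / 2"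
      "(\<Sum>i\<in>M. J i * (w $ i)\<^sup>2) / 2 \<le> \<Lambda> / 2 * (\<Sum>i\<in>M. (w $ i)\<^sup>2)"
      by linarith+
  qed
  have "min \<alpha> (\<delta> / 2) * error z x w \<le> energy z x w \<and> energy z x w \<le> max \<beta> (\<Lambda> / 2) * error z x w"
    if "x $ r = z $ r" for z x w
  proof
    have "min \<alpha> (\<delta> / 2) * (norm (x - z))\<^sup>2 \<le> \<alpha> * (norm (x - z))\<^sup>2"
      "min \<alpha> (\<delta> / 2) * (\<Sum>i\<in>M. (w $ i)\<^sup>2) \<le> \<delta> / 2 * (\<Sum>i\<in>M. (w $ i)\<^sup>2)"
      by (intro mult_right_mono sum_nonneg; simp)+
    then show "min \<alpha> (\<delta> / 2) * error z x w \<le> energy z x w"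
      using \<alpha>(2)[OF that] W(1)[of w] unfolding error_def energy_def distrib_left by linarith
    have "\<beta> * (norm (x - z))\<^sup>2 \<le> max \<beta> (\<Lambda> / 2) * (norm (x - z))\<^sup>2"
      "\<Lambda> / 2 * (\<Sum>i\<in>M. (w $ i)\<^sup>2) \<le> max \<beta> (\<Lambda> / 2) * (\<Sum>i\<in>M. (w $ i)\<^sup>2)"
      by (intro mult_right_mono sum_nonneg; simp)+
    then show "energy z x w \<le> max \<beta> (\<Lambda> / 2) * error z x w"
      using \<beta>(2)[of x z] W(2)[of w] unfolding error_def energy_def distrib_left by linarith
  qed
  moreover have "0 < min \<alpha> (\<delta> / 2)" "0 < max \<beta> (\<Lambda> / 2)" using \<alpha>(1) \<beta>(1) J by auto
  ultimately show ?thesis by blast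
qed

text \<open>
  The energy alone is not a strict Lyapunov function, since it does not dissipate the angle errors
  at the machines; a small multiple of the cross term of momenta and angle errors repairs this.
\<close>

lemma strict_lyapunov:
  "\<exists>\<epsilon> \<gamma> \<Gamma> a \<kappa>. 0 < \<gamma> \<and> 0 < \<Gamma> \<and> 0 < a \<and> 0 < \<kappa> \<and>
    (\<forall>z x w. x $ r = z $ r \<longrightarrow>
       \<gamma> * error z x w \<le> energy z x w + \<epsilon> * cross_term z x w \<and>
       energy z x w + \<epsilon> * cross_term z x w \<le> \<Gamma> * error z x w) \<and>
    (\<forall>z x w d q. x $ r = z $ r \<longrightarrow> (\<forall>i\<in>Ld. net_flow x i = net_flow z i) \<longrightarrow>
       (\<forall>i\<in>M \<union> F. \<bar>d i\<bar> \<le> \<bar>q\<bar>) \<longrightarrow>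
       energy_rate z x w d + \<epsilon> * cross_term_rate z x w d \<le> - a * error z x w + \<kappa> * q\<^sup>2)"
proof -
  obtain \<alpha> \<beta> where \<alpha>\<beta>: "0 < \<alpha>" "0 < \<beta>"
    "\<And>z x w. x $ r = z $ r \<Longrightarrow> \<alpha> * error z x w \<le> energy z x w"
    "\<And>z x w. x $ r = z $ r \<Longrightarrow> energy z x w \<le> \<beta> * error z x w"
    using energy_bounds by blast
  obtain \<Lambda> where \<Lambda>: "0 < \<Lambda>" "\<And>z x w. \<bar>cross_term z x w\<bar> \<le> \<Lambda> * error z x w"
    using cross_term_bound by blast
  obtain \<delta> \<kappa>1 where e: "0 < \<delta>" "0 < \<kappa>1"
    "\<And>z x w d q. (\<forall>i\<in>M \<union> F. \<bar>d i\<bar> \<le> \<bar>q\<bar>) \<Longrightarrow> energy_rate z x w d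
       \<le> - \<delta> * ((\<Sum>i\<in>M. (w $ i)\<^sup>2) + (\<Sum>i\<in>F. (net_flow x i - net_flow z i)\<^sup>2)) + \<kappa>1 * q\<^sup>2"
    using energy_rate_bound by blast
  obtain \<rho> \<kappa>2 where c: "0 < \<rho>" "0 < \<kappa>2"
    "\<And>z x w d q. (\<forall>i\<in>M \<union> F. \<bar>d i\<bar> \<le> \<bar>q\<bar>) \<Longrightarrow> x $ r = z $ r \<Longrightarrow>
     (\<forall>i\<in>Ld. net_flow x i = net_flow z i) \<Longrightarrow>
     cross_term_rate z x w d \<le> - \<rho> * (norm (x - z))\<^sup>2
       + \<kappa>2 * ((\<Sum>i\<in>M. (w $ i)\<^sup>2) + (\<Sum>i\<in>F. (net_flow x i - net_flow z i)\<^sup>2) + q\<^sup>2)"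
    using cross_term_rate_bound by blast
  \<comment> \<open>The first bound keeps the function equivalent to the energy, the second lets the dissipation of
    the energy absorb what the cross term produces in the frequencies and device mismatches.\<close>
  define \<epsilon> where "\<epsilon> = min (\<alpha> / (2 * \<Lambda>)) (\<delta> / (2 * \<kappa>2))"
  have \<epsilon>: "0 < \<epsilon>" "\<epsilon> * \<Lambda> \<le> \<alpha> / 2" "\<epsilon> * \<kappa>2 \<le> \<delta> / 2"
  proof -
    have "\<epsilon> \<le> \<alpha> / (2 * \<Lambda>)" "\<epsilon> \<le> \<delta> / (2 * \<kappa>2)" by (simp_all add: \<epsilon>_def)
    then show "\<epsilon> * \<Lambda> \<le> \<alpha> / 2" "\<epsilon> * \<kappa>2 \<le> \<delta> / 2"
      using \<Lambda>(1) c(2) by (simp_all add: field_simps)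
    show "0 < \<epsilon>" using \<alpha>\<beta>(1) \<Lambda>(1) e(1) c(2) by (simp add: \<epsilon>_def)
  qed
  define a where "a = min (\<delta> / 2) (\<epsilon> * \<rho>)"
  define \<kappa> where "\<kappa> = \<kappa>1 + \<epsilon> * \<kappa>2"
  have a: "0 < a" "a \<le> \<delta> / 2" "a \<le> \<epsilon> * \<rho>" using e(1) \<epsilon>(1) c(1) by (auto simp: a_def)
  have \<kappa>: "0 < \<kappa>" using e(2) \<epsilon>(1) c(2) by (simp add: \<kappa>_def add_pos_pos)
  have bound: "\<alpha> / 2 * error z x w \<le> energy z x w + \<epsilon> * cross_term z x w \<and>
       energy z x w + \<epsilon> * cross_term z x w \<le> (\<beta> + \<alpha> / 2) * error z x w" if "x $ r = z $ r" for z x w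
  proof -
    have "\<bar>\<epsilon> * cross_term z x w\<bar> \<le> \<epsilon> * (\<Lambda> * error z x w)"
      unfolding abs_mult using \<epsilon>(1) \<Lambda>(2)[of z x w] by simp
    also have "\<dots> \<le> \<alpha> / 2 * error z x w"
      unfolding mult.assoc[symmetric] using \<epsilon>(2) error_nonneg by (rule mult_right_mono)
    finally show ?thesis
      using \<alpha>\<beta>(3,4)[OF that, of w] by (auto simp: algebra_simps)
  qed
  have rate: "energy_rate z x w d + \<epsilon> * cross_term_rate z x w d \<le> - a * error z x w + \<kappa> * q\<^sup>2"
    if "x $ r = z $ r" "\<forall>i\<in>Ld. net_flow x i = net_flow z i" "\<forall>i\<in>M \<union> F. \<bar>d i\<bar> \<le> \<bar>q\<bar>" for z x w d q
  proof -
    define W where "W = (\<Sum>i\<in>M. (w $ i)\<^sup>2)"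
    define Fsq where "Fsq = (\<Sum>i\<in>F. (net_flow x i - net_flow z i)\<^sup>2)"
    have W0: "0 \<le> W" and F0: "0 \<le> Fsq" by (auto simp: W_def Fsq_def sum_nonneg)
    let ?Y = "(norm (x - z))\<^sup>2"
    have "energy_rate z x w d \<le> - \<delta> * (W + Fsq) + \<kappa>1 * q\<^sup>2"
      using e(3)[OF that(3)] by (simp add: W_def Fsq_def)
    moreover have "\<epsilon> * cross_term_rate z x w d \<le> \<epsilon> * (- \<rho> * ?Y + \<kappa>2 * (W + Fsq + q\<^sup>2))"
      using c(3)[OF that(3,1,2), of w] \<epsilon>(1) by (intro mult_left_mono) (auto simp: W_def Fsq_def)
    ultimately have "energy_rate z x w d + \<epsilon> * cross_term_rate z x w d
      \<le> (\<epsilon> * \<kappa>2) * (W + Fsq) - \<delta> * (W + Fsq) - (\<epsilon> * \<rho>) * ?Y + \<kappa> * q\<^sup>2"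
      by (simp add: \<kappa>_def algebra_simps)
    moreover have "(\<epsilon> * \<kappa>2) * (W + Fsq) \<le> \<delta> / 2 * (W + Fsq)"
      using \<epsilon>(3) W0 F0 by (intro mult_right_mono) auto
    moreover have "a * (W + Fsq) \<le> \<delta> / 2 * (W + Fsq)" "a * ?Y \<le> (\<epsilon> * \<rho>) * ?Y" "0 \<le> a * Fsq"
      using a W0 F0 by (intro mult_right_mono mult_nonneg_nonneg; simp)+
    ultimately have "energy_rate z x w d + \<epsilon> * cross_term_rate z x w d \<le> - a * (?Y + W) + \<kappa> * q\<^sup>2"
      by (simp add: algebra_simps)
    then show ?thesis by (simp add: error_def W_def)
  qed
  have "0 < \<alpha> / 2" "0 < \<beta> + \<alpha> / 2" using \<alpha>\<beta> by auto
  then show ?thesis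
    by (intro exI[of _ \<epsilon>] exI[of _ "\<alpha> / 2"] exI[of _ "\<beta> + \<alpha> / 2"] exI[of _ a] exI[of _ \<kappa>]
        conjI allI impI \<kappa> a(1) rate bound[THEN conjunct1] bound[THEN conjunct2])
qed

section \<open>Exponential decay of the angle and frequency errors\<close>

lemma sum_machine_device_split: "sum g (- Ld) = sum g M + sum g F" for g :: "'n \<Rightarrow> real"
proof -
  have "- Ld = M \<union> F" using cover disjoint by auto
  then show ?thesis using disjoint by (simp add: sum.union_disjoint)
qed

text \<open>
  All angles are measured relative to the reference node; the resulting common summand
  \<open>- w $ r\<close> of their rates does no work, since the flows add up to zero.
\<close>

lemma potential_along_solution:
  assumes y: "swing_solution u I y" and t: "t \<in> I"
    and z: "\<And>i. i \<in> Ld \<Longrightarrow> net_flow z i = P i"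
    and balance: "\<And>i. i \<in> M \<union> F \<Longrightarrow> P i - net_flow z i + v i = 0"
  defines "x \<equiv> load_flow (fst (y t))" and "w \<equiv> snd (y t)"
  shows "((\<lambda>t. potential (load_flow (fst (y t))) z) has_real_derivative
     (\<Sum>i\<in>M. (net_flow x i - net_flow z i) * w $ i)
     + (\<Sum>i\<in>F. (net_flow x i - net_flow z i) * (- (net_flow x i - net_flow z i) + (u t i - v i)) / D i))
     (at t within I)"
proof -
  define f where "f i = net_flow x i - net_flow z i" for i
  define dy where "dy = fst (drift (y t) + drive (u t))"
  have "((\<lambda>t. fst (y t)) has_vector_derivative dy) (at t within I)"
    using bounded_linear.has_vector_derivative[OF bounded_linear_fst
        y[unfolded swing_solution_def, rule_format, OF t]]
    by (simp add: dy_def)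
  from diff_chain_within[OF this[unfolded has_vector_derivative_def]
      has_derivative_at_withinI[OF potential_load_flow_deriv[of z, OF z]]]
  have "((\<lambda>t. potential (load_flow (fst (y t))) z) has_derivative
      (\<lambda>h. \<Sum>i\<in>- Ld - {r}. f i * (h *\<^sub>R dy) $ i)) (at t within I)"
    by (simp add: o_def f_def x_def)
  then have "((\<lambda>t. potential (load_flow (fst (y t))) z) has_real_derivative
      (\<Sum>i\<in>- Ld - {r}. f i * dy $ i)) (at t within I)"
    unfolding has_field_derivative_def
    by (rule has_derivative_eq_rhs) (simp add: fun_eq_iff sum_distrib_left mult.commute mult.left_commute)
  moreover have "(\<Sum>i\<in>- Ld - {r}. f i * dy $ i) =
    (\<Sum>i\<in>M. f i * w $ i) + (\<Sum>i\<in>F. f i * (- f i + (u t i - v i)) / D i)"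
  proof -
    have dy_M: "dy $ i = w $ i - w $ r" if "i \<in> M" for i
      using that disjoint by (auto simp: dy_def drift_def drive_def w_def)
    have dy_F: "dy $ i = (- f i + (u t i - v i)) / D i - w $ r" if "i \<in> F" for i
    proof -
      have "dy $ i = (P i - net_flow x i + u t i) / D i - w $ r"
        using that disjoint by (auto simp: dy_def drift_def drive_def w_def x_def add_divide_distrib)
      moreover have "P i - net_flow x i + u t i = - f i + (u t i - v i)"
        using balance[of i] that by (simp add: f_def)
      ultimately show ?thesis by simp
    qed
    have "(\<Sum>i\<in>- Ld - {r}. f i * dy $ i) = (\<Sum>i\<in>- Ld. f i * dy $ i)"
      using dy_M[OF ref_machine] by (intro sum.mono_neutral_left) auto
    also have "\<dots> = (\<Sum>i\<in>M. f i * (w $ i - w $ r)) + (\<Sum>i\<in>F. f i * ((- f i + (u t i - v i)) / D i - w $ r))"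
      unfolding sum_machine_device_split using dy_M dy_F by (intro arg_cong2[of _ _ _ _ "(+)"] sum.cong) auto
    also have "\<dots> = (\<Sum>i\<in>M. f i * w $ i) + (\<Sum>i\<in>F. f i * (- f i + (u t i - v i)) / D i)
        - w $ r * (\<Sum>i\<in>- Ld. f i)"
      unfolding sum_machine_device_split
      by (simp add: right_diff_distrib sum_subtractf sum_distrib_left distrib_left mult.commute)
    also have "(\<Sum>i\<in>- Ld. f i) = (\<Sum>i\<in>UNIV. f i)"
      by (rule sum.mono_neutral_left) (auto simp: f_def x_def load_flow_load z)
    also have "\<dots> = 0" by (simp add: f_def sum_subtractf sum_net_flow_eq_0)
    finally show ?thesis by simp
  qed
  ultimately show ?thesis by (simp add: f_def)
qed

lemma lyapunov_along_solution:
  assumes y: "swing_solution u I y" and t: "t \<in> I"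
    and z: "\<And>i. i \<in> Ld \<Longrightarrow> net_flow z i = P i"
    and balance: "\<And>i. i \<in> M \<union> F \<Longrightarrow> P i - net_flow z i + v i = 0"
  shows "((\<lambda>t. energy z (load_flow (fst (y t))) (snd (y t))
            + \<epsilon> * cross_term z (load_flow (fst (y t))) (snd (y t))) has_real_derivative
     energy_rate z (load_flow (fst (y t))) (snd (y t)) (\<lambda>i. u t i - v i)
     + \<epsilon> * cross_term_rate z (load_flow (fst (y t))) (snd (y t)) (\<lambda>i. u t i - v i)) (at t within I)"
proof -
  define x where "x = load_flow (fst (y t))"
  define w where "w = snd (y t)"
  define f where "f i = net_flow x i - net_flow z i" for i
  define d where "d i = u t i - v i" for i
  have w': "((\<lambda>t. snd (y t) $ i) has_real_derivative (- D i * w $ i - f i + d i) / J i) (at t within I)"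
    if "i \<in> M" for i
  proof -
    have eq: "P i - D i * w $ i - net_flow x i + u t i = - D i * w $ i - f i + d i"
      using balance[of i] that by (simp add: f_def d_def)
    show ?thesis
      using swing_solution_snd[OF y t that] unfolding x_def[symmetric] w_def[symmetric] eq .
  qed
  have x': "((\<lambda>t. load_flow (fst (y t)) $ i) has_real_derivative w $ i - w $ r) (at t within I)"
    if "i \<in> M" for i
    using swing_solution_load_flow[OF y t, of i] that by (simp add: w_def)
  have kin: "((\<lambda>t. (\<Sum>i\<in>M. J i * (snd (y t) $ i)\<^sup>2) / 2) has_real_derivative
      (\<Sum>i\<in>M. w $ i * (- D i * w $ i - f i + d i))) (at t within I)"
  proof -
    have "((\<lambda>t. J i * (snd (y t) $ i)\<^sup>2) has_real_derivative
      2 * (w $ i * (- D i * w $ i - f i + d i))) (at t within I)" if "i \<in> M" for i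
    proof -
      have "((\<lambda>t. J i * (snd (y t) $ i)\<^sup>2) has_real_derivative
        J i * (2 * w $ i * ((- D i * w $ i - f i + d i) / J i))) (at t within I)"
        by (auto intro!: derivative_eq_intros w'[OF that] simp: w_def)
      then show ?thesis using J_pos[OF that] by (simp add: mult.assoc)
    qed
    from DERIV_cdivide[OF DERIV_sum[of M, OF this], where c = 2] show ?thesis
      by (simp add: sum_distrib_left[symmetric])
  qed
  have "((\<lambda>t. energy z (load_flow (fst (y t))) (snd (y t))) has_real_derivative
      energy_rate z x w d) (at t within I)"
  proof -
    have "(\<Sum>i\<in>M. w $ i * (- D i * w $ i - f i + d i)) + (\<Sum>i\<in>M. f i * w $ i)
        = (\<Sum>i\<in>M. w $ i * (- D i * w $ i + d i))"
      unfolding sum.distrib[symmetric] by (intro sum.cong refl) (simp add: algebra_simps)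
    then have "(\<Sum>i\<in>M. w $ i * (- D i * w $ i - f i + d i))
        + ((\<Sum>i\<in>M. f i * w $ i) + (\<Sum>i\<in>F. f i * (- f i + d i) / D i)) = energy_rate z x w d"
      unfolding energy_rate_def f_def[symmetric] by linarith
    with DERIV_add[OF kin potential_along_solution[OF y t z balance]] show ?thesis
      unfolding energy_def by (simp add: x_def w_def f_def d_def)
  qed
  moreover have "((\<lambda>t. cross_term z (load_flow (fst (y t))) (snd (y t))) has_real_derivative
      cross_term_rate z x w d) (at t within I)"
    unfolding cross_term_def cross_term_rate_def
  proof (rule DERIV_sum)
    fix i assume i: "i \<in> M"
    show "((\<lambda>t. J i * snd (y t) $ i * (load_flow (fst (y t)) $ i - z $ i)) has_real_derivative
      (- D i * w $ i - (net_flow x i - net_flow z i) + d i) * (x $ i - z $ i)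
       + J i * w $ i * (w $ i - w $ r)) (at t within I)"
    proof -
      have "((\<lambda>t. J i * snd (y t) $ i * (load_flow (fst (y t)) $ i - z $ i)) has_real_derivative
        J i * ((- D i * w $ i - f i + d i) / J i) * (x $ i - z $ i) + (w $ i - w $ r) * (J i * w $ i))
        (at t within I)"
        using DERIV_mult[OF DERIV_cmult[OF w'[OF i], of "J i"] DERIV_diff[OF x'[OF i] DERIV_const, of "z $ i"]]
        by (simp add: w_def x_def)
      then show ?thesis using J_pos[OF i] by (simp add: f_def mult.commute)
    qed
  qed
  ultimately show ?thesis
    unfolding x_def w_def d_def by (intro DERIV_add DERIV_cmult)
qed

text \<open>
  The deviation \<open>q\<close> of the forcing decays by itself at rate \<open>k\<close>.  Adding \<open>(\<kappa> / k) q\<^sup>2\<close> to the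
  Lyapunov function therefore absorbs the contribution of the forcing, and the differential inequality
  closes.
\<close>

theorem error_exponential_decay:
  assumes "0 < k"
  obtains C c where "0 < C" "0 < c"
    "\<And>z v u q y t. z $ r = 0 \<Longrightarrow> \<forall>i\<in>Ld. net_flow z i = P i \<Longrightarrow>
       \<forall>i\<in>M \<union> F. P i - net_flow z i + v i = 0 \<Longrightarrow> swing_solution u {0..} y \<Longrightarrow>
       \<forall>t\<ge>0. (q has_real_derivative - k * q t) (at t within {0..}) \<Longrightarrow>
       \<forall>t\<ge>0. \<forall>i\<in>M \<union> F. \<bar>u t i - v i\<bar> \<le> \<bar>q t\<bar> \<Longrightarrow> 0 \<le> t \<Longrightarrow>
       error z (load_flow (fst (y t))) (snd (y t))
         \<le> C * exp (- c * t) * (error z (load_flow (fst (y 0))) (snd (y 0)) + (q 0)\<^sup>2)"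
proof -
  obtain \<epsilon> \<gamma> \<Gamma> a \<kappa> where pos: "0 < \<gamma>" "0 < \<Gamma>" "0 < a" "0 < \<kappa>"
    and bounds: "\<And>z x w. x $ r = z $ r \<Longrightarrow> \<gamma> * error z x w \<le> energy z x w + \<epsilon> * cross_term z x w"
      "\<And>z x w. x $ r = z $ r \<Longrightarrow> energy z x w + \<epsilon> * cross_term z x w \<le> \<Gamma> * error z x w"
    and rate: "\<And>z x w d q. x $ r = z $ r \<Longrightarrow> (\<forall>i\<in>Ld. net_flow x i = net_flow z i) \<Longrightarrow>
       (\<forall>i\<in>M \<union> F. \<bar>d i\<bar> \<le> \<bar>q\<bar>) \<Longrightarrow>
       energy_rate z x w d + \<epsilon> * cross_term_rate z x w d \<le> - a * error z x w + \<kappa> * q\<^sup>2"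
    using strict_lyapunov by blast
  define K where "K = \<kappa> / k"
  define c where "c = min (a / \<Gamma>) k"
  define C where "C = (\<Gamma> + K) / \<gamma>"
  have K: "0 < K" and c: "0 < c" "c \<le> a / \<Gamma>" "c \<le> k" and C: "0 < C"
    using pos assms by (auto simp: K_def c_def C_def add_pos_pos)
  have "error z (load_flow (fst (y t))) (snd (y t))
       \<le> C * exp (- c * t) * (error z (load_flow (fst (y 0))) (snd (y 0)) + (q 0)\<^sup>2)"
    if z: "z $ r = 0" "\<forall>i\<in>Ld. net_flow z i = P i"
      and balance: "\<forall>i\<in>M \<union> F. P i - net_flow z i + v i = 0"
      and y: "swing_solution u {0..} y"
      and q: "\<forall>t\<ge>0. (q has_real_derivative - k * q t) (at t within {0..})"
      and d: "\<forall>t\<ge>0. \<forall>i\<in>M \<union> F. \<bar>u t i - v i\<bar> \<le> \<bar>q t\<bar>"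
      and "0 \<le> t" for z v u q y t
  proof -
    let ?x = "\<lambda>t. load_flow (fst (y t))" and ?w = "\<lambda>t. snd (y t)"
    define E where "E t = error z (?x t) (?w t)" for t
    define V where "V t = energy z (?x t) (?w t) + \<epsilon> * cross_term z (?x t) (?w t)" for t
    define V' where "V' t = energy_rate z (?x t) (?w t) (\<lambda>i. u t i - v i)
      + \<epsilon> * cross_term_rate z (?x t) (?w t) (\<lambda>i. u t i - v i)" for t
    have ref: "?x t $ r = z $ r" for t using z(1) by (simp add: load_flow_ref)
    have VE: "\<gamma> * E t \<le> V t" "V t \<le> \<Gamma> * E t" for t
      unfolding V_def E_def by (rule bounds[OF ref])+
    have "V t + K * (q t)\<^sup>2 \<le> exp (- c * t) * (V 0 + K * (q 0)\<^sup>2)"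
    proof (rule exponential_bound_from_differential_inequality[OF \<open>0 \<le> t\<close>])
      fix \<tau> assume \<tau>: "\<tau> \<in> {0..t}"
      have "(V has_real_derivative V' \<tau>) (at \<tau> within {0..})"
        unfolding V_def V'_def using \<tau> z(2) balance by (intro lyapunov_along_solution[OF y]) auto
      moreover have "(q has_real_derivative - k * q \<tau>) (at \<tau> within {0..})" using q \<tau> by auto
      ultimately have "((\<lambda>t. V t + K * (q t)\<^sup>2) has_real_derivative V' \<tau> - 2 * k * K * (q \<tau>)\<^sup>2)
          (at \<tau> within {0..})"
        by (auto intro!: derivative_eq_intros simp: power2_eq_square)
      then show "((\<lambda>t. V t + K * (q t)\<^sup>2) has_real_derivative V' \<tau> - 2 * k * K * (q \<tau>)\<^sup>2)
          (at \<tau> within {0..t})"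
        by (rule has_field_derivative_subset) auto
      have "V' \<tau> \<le> - a * E \<tau> + \<kappa> * (q \<tau>)\<^sup>2"
        unfolding V'_def E_def using d \<tau> z(2) by (intro rate[OF ref]) (auto simp: load_flow_load)
      moreover have "c * V \<tau> \<le> a * E \<tau>"
      proof -
        have "c * V \<tau> \<le> c * (\<Gamma> * E \<tau>)" using VE(2) c(1) by (intro mult_left_mono) auto
        also have "\<dots> \<le> a / \<Gamma> * (\<Gamma> * E \<tau>)"
          using c(2) pos(2) error_nonneg by (intro mult_right_mono) (auto simp: E_def)
        finally show ?thesis using pos(2) by simp
      qed
      moreover have "\<kappa> * (q \<tau>)\<^sup>2 = k * (K * (q \<tau>)\<^sup>2)" using assms by (simp add: K_def)
      moreover have "c * (K * (q \<tau>)\<^sup>2) \<le> k * (K * (q \<tau>)\<^sup>2)"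
        using c(3) K by (intro mult_right_mono) auto
      ultimately show "V' \<tau> - 2 * k * K * (q \<tau>)\<^sup>2 \<le> - c * (V \<tau> + K * (q \<tau>)\<^sup>2)"
        by (simp add: algebra_simps)
    qed
    moreover have "\<gamma> * E t \<le> V t + K * (q t)\<^sup>2"
      using VE(1)[of t] K by (simp add: add_increasing2)
    moreover have "exp (- c * t) * (V 0 + K * (q 0)\<^sup>2) \<le> exp (- c * t) * ((\<Gamma> + K) * (E 0 + (q 0)\<^sup>2))"
    proof (rule mult_left_mono)
      have "0 \<le> K * E 0" "0 \<le> \<Gamma> * (q 0)\<^sup>2" using K pos(2) error_nonneg by (auto simp: E_def)
      then show "V 0 + K * (q 0)\<^sup>2 \<le> (\<Gamma> + K) * (E 0 + (q 0)\<^sup>2)"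
        using VE(2)[of 0] by (simp add: algebra_simps)
    qed simp
    ultimately have "\<gamma> * E t \<le> exp (- c * t) * ((\<Gamma> + K) * (E 0 + (q 0)\<^sup>2))" by linarith
    then have "E t \<le> C * exp (- c * t) * (E 0 + (q 0)\<^sup>2)"
      using pos(1) by (simp add: C_def field_simps)
    then show ?thesis by (simp add: E_def)
  qed
  with C c(1) show thesis by (rule that)
qed

end

section \<open>The controllers\<close>

text \<open>
  A monotone function onto the real line cannot jump.
\<close>

lemma inverse_of_increasing_bijection:
  fixes g :: "real \<Rightarrow> real"
  assumes "strict_mono g" "surj g"
  shows "strict_mono (inv g)" "continuous_on UNIV (inv g)" "surj (inv g)"
proof -
  have inj: "inj g" using assms(1) by (rule strict_mono_imp_inj_on)
  show mono: "strict_mono (inv g)"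
    using strict_mono_inv[OF assms, of "inv g"] inj by simp
  show surj: "surj (inv g)" using inj by (rule inj_imp_surj_inv)
  show "continuous_on UNIV (inv g)"
    using surj mono by (intro continuous_onI_mono) (auto simp: strict_mono_less_eq)
qed

definition total_control :: "'n::finite power_system \<Rightarrow> real \<Rightarrow> real" where
  "total_control S l = (\<Sum>i\<in>controlled S. control S i l)"

locale regulated_system =
  fixes S :: "'n::finite power_system"
  assumes wf: "well_formed S" and costs: "admissible_costs S"
begin

lemma control_strict_mono: "i \<in> controlled S \<Longrightarrow> strict_mono (control S i)"
  and control_continuous: "continuous_on UNIV (control S j)"
  and control_surj: "i \<in> controlled S \<Longrightarrow> surj (control S i)"
proof -
  have mono: "strict_mono (deriv (cost S i))" and surj: "surj (deriv (cost S i))"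
    if "i \<in> controlled S" for i
  proof -
    show "strict_mono (deriv (cost S i))"
    proof (rule strict_monoI)
      fix x y :: real assume "x < y"
      moreover have "\<exists>d. (deriv (cost S i) has_real_derivative d) (at u) \<and> 0 < d" for u
        using costs that unfolding admissible_costs_def by (meson field_differentiable_derivI)
      ultimately show "deriv (cost S i) x < deriv (cost S i) y"
        by (rule DERIV_pos_imp_increasing)
    qed
    show "surj (deriv (cost S i))" using costs that by (simp add: admissible_costs_def)
  qed
  have eq: "control S i = inv (deriv (cost S i))" if "i \<in> controlled S" for i
    using that by (simp add: control_def fun_eq_iff)
  show "i \<in> controlled S \<Longrightarrow> strict_mono (control S i)" "i \<in> controlled S \<Longrightarrow> surj (control S i)"
    using inverse_of_increasing_bijection[OF mono surj] eq by auto
  show "continuous_on UNIV (control S j)"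
  proof (cases "j \<in> controlled S")
    case True
    then show ?thesis using inverse_of_increasing_bijection[OF mono surj] eq by auto
  next
    case False
    then have "control S j = (\<lambda>l. 0)" by (simp add: control_def fun_eq_iff)
    then show ?thesis by simp
  qed
qed

lemma controlled_nonempty: "controlled S \<noteq> {}"
  and controlled_not_load: "i \<in> controlled S \<Longrightarrow> i \<notin> loads S"
  and ref_machine: "ref S \<in> machines S"
  and cover: "machines S \<union> freq_devices S \<union> loads S = UNIV"
  and disjoint: "machines S \<inter> freq_devices S = {}" "machines S \<inter> loads S = {}"
    "freq_devices S \<inter> loads S = {}"
  and inertia_pos: "i \<in> machines S \<Longrightarrow> 0 < inertia S i"
  and damping_pos: "i \<in> machines S \<union> freq_devices S \<Longrightarrow> 0 < damping S i"
  and gain_pos: "0 < gain S"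
  and edges_connected: "(i, j) \<in> (edges S)\<^sup>*"
  and coupling_sym: "coupling S i j = coupling S j i"
proof -
  note W = wf[unfolded well_formed_def]
  show "controlled S \<noteq> {}" "ref S \<in> machines S" "machines S \<union> freq_devices S \<union> loads S = UNIV"
    "machines S \<inter> freq_devices S = {}" "machines S \<inter> loads S = {}"
    "freq_devices S \<inter> loads S = {}" "0 < gain S"
    using W by simp_all
  then show "i \<in> controlled S \<Longrightarrow> i \<notin> loads S"
    using W by auto
  have "\<forall>i\<in>machines S. 0 < inertia S i" "\<forall>i\<in>machines S \<union> freq_devices S. 0 < damping S i"
    "\<forall>i j. (i, j) \<in> (edges S)\<^sup>*" "\<forall>i j. coupling S i j = coupling S j i"
    using W by - (elim conjE, assumption)+
  then show "i \<in> machines S \<Longrightarrow> 0 < inertia S i"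
    "i \<in> machines S \<union> freq_devices S \<Longrightarrow> 0 < damping S i"
    "(i, j) \<in> (edges S)\<^sup>*" "coupling S i j = coupling S j i" by blast+
qed

lemma coupling_edge: "(i, j) \<in> edges S \<Longrightarrow> 0 < coupling S i j"
  and coupling_nonedge: "(i, j) \<notin> edges S \<Longrightarrow> coupling S i j = 0"
proof -
  have "if (i, j) \<in> edges S then coupling S i j > 0 else coupling S i j = 0"
    using wf unfolding well_formed_def by blast
  then show "(i, j) \<in> edges S \<Longrightarrow> 0 < coupling S i j"
    "(i, j) \<notin> edges S \<Longrightarrow> coupling S i j = 0" by auto
qed

lemma total_control_strict_mono: "strict_mono (total_control S)"
  unfolding total_control_def
  by (intro strict_monoI sum_strict_mono controlled_nonempty strict_monoD[OF control_strict_mono]) simp_all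

text \<open>
  At a sufficiently high or low price, all controllers are simultaneously above \<open>\<bar>v\<bar>\<close> or below
  \<open>- \<bar>v\<bar>\<close>, and so is their sum.
\<close>

lemma total_control_surj: "surj (total_control S)"
proof -
  have "\<exists>l. total_control S l = v" for v
  proof -
    have "\<exists>l. control S i l = c" if "i \<in> controlled S" for i c
      using control_surj[OF that] by (metis surjD)
    then obtain g where g: "\<And>i c. i \<in> controlled S \<Longrightarrow> control S i (g i c) = c" by metis
    obtain i0 where i0: "i0 \<in> controlled S" using controlled_nonempty by blast
    have mono: "control S i l \<le> control S i l'" if "i \<in> controlled S" "l \<le> l'" for i l l'
      using control_strict_mono[OF that(1)] that(2) by (simp add: strict_mono_less_eq)
    define lo where "lo = Min ((\<lambda>i. g i (- \<bar>v\<bar>)) ` controlled S)"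
    define hi where "hi = Max ((\<lambda>i. g i \<bar>v\<bar>) ` controlled S)"
    have lo: "control S i lo \<le> - \<bar>v\<bar>" if "i \<in> controlled S" for i
      using mono[OF that, of lo "g i (- \<bar>v\<bar>)"] g[OF that] that by (simp add: lo_def)
    have hi: "\<bar>v\<bar> \<le> control S i hi" if "i \<in> controlled S" for i
      using mono[OF that, of "g i \<bar>v\<bar>" hi] g[OF that] that by (simp add: hi_def)
    have "total_control S lo \<le> control S i0 lo"
    proof -
      have "(\<Sum>i\<in>controlled S - {i0}. control S i lo) \<le> 0"
        using lo by (intro sum_nonpos) force
      then show ?thesis unfolding total_control_def by (simp add: sum.remove[OF _ i0])
    qed
    then have A: "total_control S lo \<le> v" using lo[OF i0] by linarith
    have "control S i0 hi \<le> total_control S hi"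
      unfolding total_control_def using i0 hi by (intro member_le_sum) force+
    then have B: "v \<le> total_control S hi" using hi[OF i0] by linarith
    have "lo \<le> hi \<or> total_control S lo = v"
      using A B total_control_strict_mono by (metis order_antisym order_trans linear strict_mono_less_eq)
    then show ?thesis
    proof
      assume "lo \<le> hi"
      moreover have "continuous_on {lo..hi} (total_control S)"
        unfolding total_control_def
        by (intro continuous_intros continuous_on_subset[OF control_continuous]) auto
      ultimately show ?thesis using IVT'[of "total_control S" lo v hi] A B by blast
    qed auto
  qed
  then show ?thesis by (metis surjI)
qed

text \<open>
  Since all controllers respond monotonically to the common price, none of them can move by more
  than their sum does.
\<close>

lemma control_diff_le_total_control_diff:
  "\<bar>control S i l - control S i l'\<bar> \<le> \<bar>total_control S l - total_control S l'\<bar>"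
proof -
  have *: "\<bar>control S i l - control S i l'\<bar> \<le> \<bar>total_control S l - total_control S l'\<bar>"
    if "l' \<le> l" "i \<in> controlled S" for l l'
  proof -
    have pos: "0 \<le> control S j l - control S j l'" if "j \<in> controlled S" for j
      using control_strict_mono[OF that] \<open>l' \<le> l\<close> by (simp add: strict_mono_less_eq)
    have "control S i l - control S i l' \<le> (\<Sum>j\<in>controlled S. control S j l - control S j l')"
      using that pos by (intro member_le_sum) auto
    then show ?thesis using pos[OF that(2)] by (simp add: total_control_def sum_subtractf)
  qed
  show ?thesis
  proof (cases "i \<in> controlled S")
    case True
    then show ?thesis using *[of l' l] *[of l l'] by (cases "l \<le> l'") (auto simp: abs_minus_commute)
  next
    case False
    then show ?thesis by (simp add: control_def)
  qed
qed

lemma sum_control: "(\<Sum>i\<in>UNIV. control S i l) = total_control S l"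
  unfolding total_control_def by (rule sum.mono_neutral_right) (auto simp: control_def)

lemma control_load: "i \<in> loads S \<Longrightarrow> control S i l = 0"
  using controlled_not_load by (auto simp: control_def)

section \<open>The network of the power system\<close>

text \<open>
  On \<open>angle_region r\<close> the flow agrees with the one of the network in which the sine has been
  replaced by \<^const>\<open>extended_sin\<close>.
\<close>

definition angle_region :: "real \<Rightarrow> (real ^ 'n) set" where
  "angle_region r = {x. \<forall>i j. (i, j) \<in> edges S \<longrightarrow> \<bar>x $ i - x $ j\<bar> < r}"

lemma swing_network:
  assumes "0 \<le> r" "r < pi / 2"
  shows "swing_network (coupling S) (extended_sin r) (cos r) 1 (ref S) (loads S)
    (machines S) (freq_devices S) (inertia S) (damping S)"
proof -
  have pos: "0 < coupling S i j \<longleftrightarrow> (i, j) \<in> edges S" for i j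
    using coupling_edge[of i j] coupling_nonedge[of i j] by (cases "(i, j) \<in> edges S") auto
  have "{(i, j). 0 < coupling S i j} = edges S" by (auto simp: pos)
  then have connected: "(i, j) \<in> {(i, j). 0 < coupling S i j}\<^sup>*" for i j
    using edges_connected by simp
  have nonneg: "0 \<le> coupling S i j" for i j
    using coupling_edge[of i j] coupling_nonedge[of i j] by (cases "(i, j) \<in> edges S") auto
  have cos: "0 < cos r" using assms by (intro cos_gt_zero_pi) auto
  show ?thesis
    by (unfold_locales; (rule coupling_sym | rule nonneg | rule connected | rule cos
          | rule extended_sin_minus[OF assms(1)] | rule extended_sin_slope[OF assms] | rule disjoint
          | rule cover | rule ref_machine | rule inertia_pos | rule damping_pos | use ref_machine disjoint in blast))
qed

lemma flow_eq_net_flow: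
  assumes "0 \<le> r" "r < pi / 2" "\<And>i j. (i, j) \<in> edges S \<Longrightarrow> \<bar>x $ i - x $ j\<bar> \<le> r"
  shows "monotone_network.net_flow (coupling S) (extended_sin r) x i = flow S x i"
proof -
  interpret swing_network "coupling S" "extended_sin r" "cos r" 1 "ref S" "loads S" "injection S"
    "machines S" "freq_devices S" "inertia S" "damping S"
    using assms(1,2) by (rule swing_network)
  have "coupling S i j * extended_sin r (x $ i - x $ j) = coupling S i j * sin (x $ i - x $ j)" for j
    using assms(3)[of i j] coupling_nonedge[of i j]
    by (cases "(i, j) \<in> edges S") (simp_all add: extended_sin_eq)
  then show ?thesis unfolding net_flow_def flow_def by (rule sum.cong[OF refl])
qed

lemma sum_flow: "(\<Sum>i\<in>UNIV. flow S x i) = 0"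
proof -
  interpret swing_network "coupling S" "extended_sin 0" "cos 0" 1 "ref S" "loads S" "injection S"
    "machines S" "freq_devices S" "inertia S" "damping S"
    by (rule swing_network) auto
  have "(\<Sum>i\<in>UNIV. ((\<chi> i. 1) :: real ^ 'n) $ i * (\<Sum>j\<in>UNIV. coupling S i j * sin (x $ i - x $ j))) = 0"
  proof (subst summation_by_parts)
    fix i j
    show "sin (x $ j - x $ i) = - sin (x $ i - x $ j)" using sin_minus[of "x $ i - x $ j"] by simp
  qed simp
  then show ?thesis by (simp add: flow_def)
qed

lemma Theta_angle_region:
  assumes "x \<in> Theta S"
  obtains r where "0 \<le> r" "r < pi / 2" "x \<in> angle_region r"
proof -
  let ?A = "insert 0 ((\<lambda>(i, j). \<bar>x $ i - x $ j\<bar>) ` edges S)"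
  have fin: "finite ?A" by (simp add: finite_subset[OF subset_UNIV])
  have "Max ?A < pi / 2"
    using assms fin by (subst Max_less_iff) (auto simp: Theta_def)
  then obtain r where r: "Max ?A < r" "r < pi / 2" using dense by blast
  have "x \<in> angle_region r"
  proof -
    have "\<bar>x $ i - x $ j\<bar> < r" if "(i, j) \<in> edges S" for i j
    proof -
      have "\<bar>x $ i - x $ j\<bar> \<in> ?A" using that by force
      then show ?thesis using Max_ge[OF fin] r(1) order_le_less_trans by blast
    qed
    then show ?thesis by (simp add: angle_region_def)
  qed
  moreover have "0 \<le> r" using Max_ge[OF fin, of 0] r(1) by simp
  ultimately show ?thesis using that r(2) by blast
qed

lemma angle_region_mono:
  assumes "r \<le> r'"
  shows "angle_region r \<subseteq> angle_region r'"
proof -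
  have "a < r \<Longrightarrow> a < r'" for a using assms by simp
  then show ?thesis unfolding angle_region_def by blast
qed

lemma open_angle_region: "open (angle_region r)"
proof -
  have eq: "angle_region r = (\<Inter>e\<in>edges S. {x. \<bar>x $ fst e - x $ snd e\<bar> < r})"
    by (fastforce simp: angle_region_def)
  have "open {x :: real ^ 'n. \<bar>x $ i - x $ j\<bar> < r}" for i j
    by (intro open_Collect_less continuous_intros)
  moreover have "finite (edges S)" by simp
  ultimately show ?thesis unfolding eq by blast
qed

text \<open>
  Finitely many edges leave room for one \<open>R < \<pi> / 2\<close> that serves both vectors, and then the strong
  monotonicity of the modified flow applies.
\<close>

lemma flow_injective_on_Phi:
  assumes "x \<in> Phi S" "z \<in> Phi S" "\<And>i. flow S x i = flow S z i"
  shows "x = z"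
proof -
  have Theta: "x \<in> Theta S" "z \<in> Theta S" using assms(1,2) by (auto simp: Phi_def)
  obtain r1 where r1: "0 \<le> r1" "r1 < pi / 2" "x \<in> angle_region r1"
    using Theta(1) by (rule Theta_angle_region)
  obtain r2 where r2: "0 \<le> r2" "r2 < pi / 2" "z \<in> angle_region r2"
    using Theta(2) by (rule Theta_angle_region)
  define R where "R = max r1 r2"
  have R: "0 \<le> R" "R < pi / 2" "x \<in> angle_region R" "z \<in> angle_region R"
    using r1 r2 angle_region_mono[of r1 R] angle_region_mono[of r2 R] by (auto simp: R_def)
  interpret swing_network "coupling S" "extended_sin R" "cos R" 1 "ref S" "loads S" "injection S"
    "machines S" "freq_devices S" "inertia S" "damping S"
    using R(1,2) by (rule swing_network)
  obtain \<mu> where \<mu>: "\<mu> > 0" "\<And>x z. x $ ref S = z $ ref S \<Longrightarrow>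
     \<mu> * (norm (x - z))\<^sup>2 \<le> (\<Sum>i\<in>UNIV. (x - z) $ i * (net_flow x i - net_flow z i))"
    using net_flow_strongly_monotone by blast
  have "net_flow x i = net_flow z i" for i
    using R assms(3) flow_eq_net_flow[of R x i] flow_eq_net_flow[of R z i]
    by (auto simp: angle_region_def less_imp_le)
  then have "\<mu> * (norm (x - z))\<^sup>2 \<le> 0"
    using \<mu>(2)[of x z] assms(1,2) by (simp add: Phi_def)
  then show ?thesis using \<mu>(1) by (simp add: mult_le_0_iff)
qed

section \<open>Equilibria\<close>

lemma damping_sum_pos: "0 < (\<Sum>i\<in>machines S \<union> freq_devices S. damping S i)"
  using ref_machine by (intro sum_pos damping_pos) auto

text \<open>
  Vanishing angle rates make all frequencies equal to that of the reference node, and the vanishing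
  rate of \<open>\<eta>\<close> then says that the positive total damping times this frequency is zero.
\<close>

lemma equilibrium_iff:
  assumes "(x, w, \<eta>, l) \<in> Psi S"
  shows "equilibrium S (x, w, \<eta>, l) \<longleftrightarrow>
    w = 0 \<and> (\<forall>i. injection S i - flow S x i + control S i l = 0) \<and> total_control S l + gain S * \<eta> = 0"
    (is "?L \<longleftrightarrow> ?R")
proof
  note M = ref_machine and disj = disjoint(1) and J = inertia_pos and D = damping_pos
  {
    assume L: ?L
    have \<phi>0: "\<phi>_rate S i (x, w, \<eta>, l) = 0" if "i \<in> machines S \<union> freq_devices S" for i
      using L that unfolding equilibrium_def by blast
    have \<omega>0: "\<omega>_rate S i (x, w, \<eta>, l) = 0" if "i \<in> machines S" for i
      using L that unfolding equilibrium_def by blast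
    have \<eta>0: "\<eta>_rate S (x, w, \<eta>, l) = 0" and alg: "algebraic_eqs S (x, w, \<eta>, l)"
      using L unfolding equilibrium_def by blast+
    let ?w1 = "w $ ref S"
    have wM: "w $ i = ?w1" if "i \<in> machines S" for i
      using \<phi>0[of i] that by simp
    have FD: "injection S i - flow S x i + control S i l = damping S i * ?w1" if "i \<in> freq_devices S" for i
    proof -
      have "i \<notin> machines S" using that disj by auto
      then have "(injection S i - damping S i * ?w1 - flow S x i + control S i l) / damping S i = 0"
        using \<phi>0[of i] that by simp
      then show ?thesis using D[of i] that by simp
    qed
    have "(\<Sum>i\<in>machines S. damping S i * w $ i)
        + (\<Sum>i\<in>freq_devices S. injection S i - flow S x i + control S i l) = 0"
      using \<eta>0 by simp
    then have "(\<Sum>i\<in>machines S. damping S i * ?w1) + (\<Sum>i\<in>freq_devices S. damping S i * ?w1) = 0"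
      using wM FD by simp
    then have "(\<Sum>i\<in>machines S \<union> freq_devices S. damping S i) * ?w1 = 0"
      using disj by (simp add: sum.union_disjoint sum_distrib_right distrib_right)
    then have w1: "?w1 = 0" using damping_sum_pos by simp
    then have "w = 0" using wM assms by (auto simp: Psi_def vec_eq_iff)
    moreover have "injection S i - flow S x i + control S i l = 0" for i
    proof -
      consider "i \<in> machines S" | "i \<in> freq_devices S" | "i \<in> loads S" using cover by blast
      then show ?thesis
      proof cases
        case 1
        then have "(injection S i - damping S i * w $ i - flow S x i + control S i l) / inertia S i = 0"
          using \<omega>0[of i] by simp
        then show ?thesis using J[OF 1] \<open>w = 0\<close> by simp
      next
        case 2
        then show ?thesis using FD w1 by simp
      next
        case 3
        then show ?thesis using alg control_load by simp
      qed
    qed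
    ultimately show ?R using alg by (simp add: total_control_def)
  }
  {
    assume R: ?R
    have "(x, w, \<eta>, l) \<in> state_space S"
      using assms by (auto simp: Psi_def Phi_def state_space_def)
    moreover have "injection S i - flow S x i = 0" if "i \<in> loads S" for i
    proof -
      have "injection S i - flow S x i + control S i l = 0" using R by blast
      then show ?thesis using control_load[OF that, of l] by simp
    qed
    moreover have "\<phi>_rate S i (x, w, \<eta>, l) = 0" "\<omega>_rate S i (x, w, \<eta>, l) = 0" for i
      using R by simp_all
    moreover have "\<eta>_rate S (x, w, \<eta>, l) = 0" using R by simp
    ultimately show ?L
      using R unfolding equilibrium_def by (simp add: total_control_def)
  }
qed

lemma equilibrium_unique:
  assumes "z \<in> Psi S" "equilibrium S z" "z' \<in> Psi S" "equilibrium S z'"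
  shows "z = z'"
proof -
  obtain x w \<eta> l where z: "z = (x, w, \<eta>, l)" by (cases z) auto
  obtain x' w' \<eta>' l' where z': "z' = (x', w', \<eta>', l')" by (cases z') auto
  note E = equilibrium_iff[THEN iffD1, OF assms(1,2)[unfolded z]]
  note E' = equilibrium_iff[THEN iffD1, OF assms(3,4)[unfolded z']]
  have total: "(\<Sum>i\<in>UNIV. injection S i) + total_control S l = 0"
    if "\<forall>i. injection S i - flow S x i + control S i l = 0" for x l
  proof -
    have "(\<Sum>i\<in>UNIV. injection S i - flow S x i + control S i l) = 0" using that by simp
    then show ?thesis by (simp add: sum.distrib sum_subtractf sum_flow sum_control)
  qed
  have "(\<Sum>i\<in>UNIV. injection S i) + total_control S l = 0"
    "(\<Sum>i\<in>UNIV. injection S i) + total_control S l' = 0"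
    using total E E' by blast+
  then have "total_control S l = total_control S l'" by linarith
  then have l: "l = l'" using strict_mono_eq[OF total_control_strict_mono] by simp
  have "flow S x i = flow S x' i" for i
  proof -
    have "injection S i - flow S x i + control S i l = 0" "injection S i - flow S x' i + control S i l = 0"
      using E E' l by auto
    then show ?thesis by linarith
  qed
  then have "x = x'"
    using assms(1,3) by (intro flow_injective_on_Phi) (auto simp: z z' Psi_def)
  moreover have "total_control S l + gain S * \<eta> = 0" "total_control S l + gain S * \<eta>' = 0"
    using E E' l by blast+
  then have "gain S * \<eta> = gain S * \<eta>'" by linarith
  then have "\<eta> = \<eta>'" using gain_pos by simp
  moreover have "w = 0" "w' = 0" using E E' by blast+
  ultimately show ?thesis using l unfolding z z' by blast
qed

text \<open>
  Since \<open>\<eta>\<close> is constant, the synchronous frequency times the total damping vanishes.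
\<close>

lemma synchronous_state_balance:
  assumes "has_synchronous_state S"
  obtains x l where "x \<in> Phi S" "\<And>i. injection S i - flow S x i + control S i l = 0"
proof -
  obtain \<theta> w \<eta> l ws where sol: "angle_solution S \<theta> w (\<lambda>t. \<eta>) (\<lambda>t. l)"
    and sync: "\<And>t. 0 \<le> t \<Longrightarrow> \<theta> t \<in> Theta S" "\<And>t i. 0 \<le> t \<Longrightarrow> w t $ i = ws"
    using assms unfolding has_synchronous_state_def by blast
  \<comment> \<open>At an interior time the derivatives are unique.\<close>
  have at1: "at 1 within {0..} = at (1 :: real)" by (rule at_within_interior) simp
  note J = inertia_pos
  note sol1 = sol[unfolded angle_solution_def, THEN conjunct2, THEN conjunct2, rule_format, of 1, unfolded at1]
  have "((\<lambda>t. \<eta>) has_real_derivative (\<Sum>i\<in>machines S \<union> freq_devices S. damping S i * w 1 $ i)) (at 1)"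
    using sol1 by simp
  then have "(\<Sum>i\<in>machines S \<union> freq_devices S. damping S i * ws) = 0"
    using DERIV_unique[OF _ DERIV_const] sync(2)[of 1] by simp
  then have ws: "ws = 0"
    using damping_sum_pos by (simp add: sum_distrib_right[symmetric])
  have bal: "injection S i - flow S (\<theta> 1) i + control S i l = 0" for i
  proof -
    consider "i \<in> machines S" | "i \<in> freq_devices S" | "i \<in> loads S" using cover by blast
    then show ?thesis
    proof cases
      case 1
      have "((\<lambda>s. w s $ i) has_real_derivative
         (injection S i - damping S i * w 1 $ i - flow S (\<theta> 1) i + control S i l) / inertia S i) (at 1)"
        using sol1 1 by simp
      moreover have "((\<lambda>s. w s $ i) has_real_derivative 0) (at 1)"
      proof (rule DERIV_cong_ev[THEN iffD2])
        show "\<forall>\<^sub>F s in nhds 1. w s $ i = ws"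
          using eventually_nhds_in_open[of "{0<..}" "1 :: real"] by (auto elim!: eventually_mono intro: sync(2))
        show "((\<lambda>s. ws) has_real_derivative 0) (at 1)" by simp
      qed auto
      ultimately show ?thesis using DERIV_unique J[OF 1] sync(2)[of 1 i] ws by fastforce
    next
      case 2
      then show ?thesis using sol1 sync(2)[of 1 i] ws by auto
    next
      case 3
      then show ?thesis using sol1 control_load by auto
    qed
  qed
  let ?x = "\<chi> i. \<theta> 1 $ i - \<theta> 1 $ ref S"
  have "flow S ?x i = flow S (\<theta> 1) i" for i by (simp add: flow_def)
  then have "injection S i - flow S ?x i + control S i l = 0" for i using bal by (simp only:)
  moreover have "?x \<in> Phi S" using sync(1)[of 1] by (simp add: Phi_def Theta_def)
  ultimately show ?thesis using that by blast
qed

lemma convex_Psi: "convex (Psi S)"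
proof -
  have "Psi S = Phi S \<times> {w. \<forall>i. i \<notin> machines S \<longrightarrow> w $ i = 0} \<times> UNIV"
    by (auto simp: Psi_def)
  moreover have "convex (Phi S)"
  proof -
    have "Phi S = (\<Inter>(i, j)\<in>edges S. (\<lambda>x. x $ i - x $ j) -` ball 0 (pi / 2)) \<inter> (\<lambda>x. x $ ref S) -` {0}"
      by (auto simp: Phi_def Theta_def)
    moreover have "linear (\<lambda>x. x $ i - x $ j :: real)" "linear (\<lambda>x. x $ i :: real)" for i j :: 'n
      by (auto intro!: linearI simp: algebra_simps)
    ultimately show ?thesis
      by (simp only:) (intro convex_Int convex_INT convex_linear_vimage, auto intro: convex_linear_vimage)
  qed
  moreover have "convex {w :: real ^ 'n. \<forall>i. i \<notin> machines S \<longrightarrow> w $ i = 0}"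
    by (intro convexI) auto
  ultimately show ?thesis by (simp add: convex_Times)
qed

end

section \<open>Trajectories near an equilibrium\<close>

lemma has_vector_derivative_vec:
  fixes f :: "real \<Rightarrow> real ^ 'n::finite"
  assumes "\<And>i. ((\<lambda>t. f t $ i) has_real_derivative f' $ i) (at t within I)"
  shows "(f has_vector_derivative f') (at t within I)"
  unfolding has_vector_derivative_def
proof (subst has_derivative_componentwise_within, rule ballI)
  fix b :: "real ^ 'n" assume "b \<in> Basis"
  then obtain i where b: "b = axis i 1" by (auto simp: Basis_vec_def)
  show "((\<lambda>x. f x \<bullet> b) has_derivative (\<lambda>x. (x *\<^sub>R f') \<bullet> b)) (at t within I)"
    using assms[of i] by (simp add: b inner_axis has_field_derivative_def mult.commute[of _ "f' $ i"])
qed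

text \<open>
  The components of a solution are unique, so its existential description can be eliminated.
\<close>

lemma solution_onD:
  assumes "solution_on S I (\<lambda>t. (x t, w t, \<eta> t, l t))"
  shows "i \<in> loads S \<Longrightarrow> continuous_on I (\<lambda>t. x t $ i)"
    and "t \<in> I \<Longrightarrow> (x t, w t, \<eta> t, l t) \<in> state_space S"
    and "t \<in> I \<Longrightarrow> algebraic_eqs S (x t, w t, \<eta> t, l t)"
    and "t \<in> I \<Longrightarrow> i \<in> machines S \<union> freq_devices S \<Longrightarrow>
      ((\<lambda>s. x s $ i) has_real_derivative \<phi>_rate S i (x t, w t, \<eta> t, l t)) (at t within I)"
    and "t \<in> I \<Longrightarrow> i \<in> machines S \<Longrightarrow>
      ((\<lambda>s. w s $ i) has_real_derivative \<omega>_rate S i (x t, w t, \<eta> t, l t)) (at t within I)"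
    and "t \<in> I \<Longrightarrow> (\<eta> has_real_derivative \<eta>_rate S (x t, w t, \<eta> t, l t)) (at t within I)"
proof -
  obtain x' w' \<eta>' l' where eq: "(\<lambda>t. (x t, w t, \<eta> t, l t)) = (\<lambda>t. (x' t, w' t, \<eta>' t, l' t))"
    and loads: "\<forall>i\<in>loads S. continuous_on I (\<lambda>t. x' t $ i)"
    and rest: "\<forall>t\<in>I. (x t, w t, \<eta> t, l t) \<in> state_space S \<and> algebraic_eqs S (x t, w t, \<eta> t, l t) \<and>
           (\<forall>i\<in>machines S \<union> freq_devices S.
              ((\<lambda>s. x' s $ i) has_real_derivative \<phi>_rate S i (x t, w t, \<eta> t, l t)) (at t within I)) \<and>
           (\<forall>i\<in>machines S.
              ((\<lambda>s. w' s $ i) has_real_derivative \<omega>_rate S i (x t, w t, \<eta> t, l t)) (at t within I)) \<and>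
           (\<eta>' has_real_derivative \<eta>_rate S (x t, w t, \<eta> t, l t)) (at t within I)"
    using assms unfolding solution_on_def by blast
  have "x' = x" "w' = w" "\<eta>' = \<eta>" using fun_cong[OF eq] by (simp_all add: fun_eq_iff)
  note loads = loads[unfolded this] and rest = rest[unfolded this]
  show "i \<in> loads S \<Longrightarrow> continuous_on I (\<lambda>t. x t $ i)"
    using loads by blast
  show "t \<in> I \<Longrightarrow> (x t, w t, \<eta> t, l t) \<in> state_space S"
    "t \<in> I \<Longrightarrow> algebraic_eqs S (x t, w t, \<eta> t, l t)"
    "t \<in> I \<Longrightarrow> i \<in> machines S \<union> freq_devices S \<Longrightarrow>
      ((\<lambda>s. x s $ i) has_real_derivative \<phi>_rate S i (x t, w t, \<eta> t, l t)) (at t within I)"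
    "t \<in> I \<Longrightarrow> i \<in> machines S \<Longrightarrow>
      ((\<lambda>s. w s $ i) has_real_derivative \<omega>_rate S i (x t, w t, \<eta> t, l t)) (at t within I)"
    "t \<in> I \<Longrightarrow> (\<eta> has_real_derivative \<eta>_rate S (x t, w t, \<eta> t, l t)) (at t within I)"
    using rest by blast+
qed

locale power_equilibrium = regulated_system S
  for S :: "'n::finite power_system" +
  fixes r :: real and zs :: "real ^ 'n" and ls :: real
  assumes r: "0 \<le> r" "r < pi / 2"
    and zs_region: "zs \<in> angle_region r" and zs_ref: "zs $ ref S = 0"
    and balance: "injection S i - flow S zs i + control S i ls = 0"
begin

sublocale net: swing_network "coupling S" "extended_sin r" "cos r" 1 "ref S" "loads S" "injection S"
    "machines S" "freq_devices S" "inertia S" "damping S"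
  by (rule swing_network[OF r])

lemma net_flow_eq_flow:
  "(\<And>i j. (i, j) \<in> edges S \<Longrightarrow> \<bar>x $ i - x $ j\<bar> \<le> r) \<Longrightarrow> net.net_flow x i = flow S x i"
  using r by (rule flow_eq_net_flow)

lemma net_flow_eq_flow_region: "x \<in> angle_region r \<Longrightarrow> net.net_flow x i = flow S x i"
  by (rule net_flow_eq_flow) (auto simp: angle_region_def intro: less_imp_le)

definition \<eta>s :: real where
  "\<eta>s = - total_control S ls / gain S"

lemma gain_\<eta>s: "gain S * \<eta>s = - total_control S ls"
  using gain_pos by (simp add: \<eta>s_def)

text \<open>
  The quantity \<open>\<Sum>M\<^sub>i \<omega>\<^sub>i + \<eta>\<close> obeys a scalar linear equation of its own, so the price can be
  written down in advance; \<open>c\<close> is the amount by which the total control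
  initially falls short of its equilibrium value.
\<close>

definition price :: "real \<Rightarrow> real \<Rightarrow> real" where
  "price c t = inv (total_control S) (total_control S ls - c * exp (- gain S * t))"

definition input :: "real \<Rightarrow> real \<Rightarrow> 'n \<Rightarrow> real" where
  "input c t i = control S i (price c t)"

lemma total_control_price: "total_control S (price c t) = total_control S ls - c * exp (- gain S * t)"
  unfolding price_def by (rule surj_f_inv_f[OF total_control_surj])

lemma price_eqI: "total_control S l = total_control S ls - c * exp (- gain S * t) \<Longrightarrow> l = price c t"
  unfolding total_control_price[symmetric] using strict_mono_eq[OF total_control_strict_mono] by simp

lemma total_control_inv_continuous: "continuous_on UNIV (inv (total_control S))"
  by (rule inverse_of_increasing_bijection(2)[OF total_control_strict_mono total_control_surj])

lemma price_continuous: "continuous_on A (price c)"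
  unfolding price_def
  by (intro continuous_on_compose2[OF total_control_inv_continuous] continuous_intros) auto

lemma exp_decay_tendsto: "0 < a \<Longrightarrow> ((\<lambda>t :: real. b * exp (- a * t)) \<longlongrightarrow> 0) at_top"
  by (rule tendsto_mult_right_zero, rule filterlim_compose[OF exp_at_bot])
     (simp add: filterlim_uminus_at_bot filterlim_tendsto_pos_mult_at_top[OF tendsto_const] filterlim_ident)

lemma price_tendsto: "(price c \<longlongrightarrow> ls) at_top"
proof -
  have "isCont (inv (total_control S)) (total_control S ls)"
    using total_control_inv_continuous by (simp add: continuous_on_eq_continuous_at)
  moreover have "((\<lambda>t. total_control S ls - c * exp (- gain S * t)) \<longlongrightarrow> total_control S ls) at_top"
    using tendsto_diff[OF tendsto_const exp_decay_tendsto[OF gain_pos]] by simp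
  ultimately have "((\<lambda>t. inv (total_control S) (total_control S ls - c * exp (- gain S * t)))
      \<longlongrightarrow> inv (total_control S) (total_control S ls)) at_top"
    by (rule isCont_tendsto_compose)
  moreover have "inv (total_control S) (total_control S ls) = ls"
    by (rule inv_f_f[OF strict_mono_imp_inj_on[OF total_control_strict_mono]])
  ultimately show ?thesis unfolding price_def by simp
qed

lemma input_diff: "\<bar>input c t i - control S i ls\<bar> \<le> \<bar>c * exp (- gain S * t)\<bar>"
  using control_diff_le_total_control_diff[of i "price c t" ls]
  by (simp add: input_def total_control_price)

lemma swing_solution_exists: "\<exists>y. y 0 = y0 \<and> net.swing_solution (input c) {0..} y"
proof (rule net.swing_solution_exists)
  fix i
  show "continuous_on {0..} (\<lambda>t. input c t i)"
    unfolding input_def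
    by (intro continuous_on_compose2[OF control_continuous price_continuous]) auto
  have "\<bar>input c t i\<bar> \<le> \<bar>control S i ls\<bar> + \<bar>c\<bar>" if "0 \<le> t" for t
  proof -
    have "\<bar>c * exp (- gain S * t)\<bar> \<le> \<bar>c\<bar>"
      using gain_pos that by (simp add: abs_mult mult_left_le)
    then show ?thesis using input_diff[of c t i] by linarith
  qed
  then show "bounded ((\<lambda>t. input c t i) ` {0..})" by (auto simp: bounded_iff)
qed

lemma total_injection: "(\<Sum>i\<in>UNIV. injection S i) = - total_control S ls"
proof -
  have "(\<Sum>i\<in>UNIV. injection S i - flow S zs i + control S i ls) = 0" using balance by simp
  then show ?thesis by (simp add: sum.distrib sum_subtractf sum_flow sum_control)
qed

lemma total_power:
  assumes "\<And>i. i \<in> loads S \<Longrightarrow> 0 = injection S i - flow S x i"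
  shows "(\<Sum>i\<in>machines S. injection S i - flow S x i + control S i l)
    + (\<Sum>i\<in>freq_devices S. injection S i - flow S x i + control S i l)
    = total_control S l - total_control S ls"
proof -
  have "(\<Sum>i\<in>UNIV. injection S i - flow S x i + control S i l)
    = (\<Sum>i\<in>- loads S. injection S i - flow S x i + control S i l)"
    using assms control_load by (intro sum.mono_neutral_right) auto
  then show ?thesis
    unfolding net.sum_machine_device_split
    by (simp add: sum.distrib sum_subtractf sum_flow sum_control total_injection)
qed

text \<open>
  The entry for \<open>\<eta>\<close> is what remains of the explicitly known \<open>\<Sum>M\<^sub>i \<omega>\<^sub>i + \<eta>\<close>.
\<close>

definition trajectory :: "real \<Rightarrow> (real \<Rightarrow> (real ^ 'n) \<times> (real ^ 'n)) \<Rightarrow> real \<Rightarrow> 'n state" where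
  "trajectory c y t =
     (net.load_flow (fst (y t)),
      \<chi> i. if i \<in> machines S then snd (y t) $ i else 0,
      \<eta>s + c / gain S * exp (- gain S * t) - (\<Sum>i\<in>machines S. inertia S i * snd (y t) $ i),
      price c t)"

lemma trajectory_solution:
  assumes y: "net.swing_solution (input c) {0..} y"
    and region: "\<And>t. 0 \<le> t \<Longrightarrow> net.load_flow (fst (y t)) \<in> angle_region r"
  shows "solution_on S {0..} (trajectory c y)"
proof -
  define x where "x t = net.load_flow (fst (y t))" for t
  define w where "w t = (\<chi> i. if i \<in> machines S then snd (y t) $ i else 0)" for t
  define \<eta> where "\<eta> t = \<eta>s + c / gain S * exp (- gain S * t)
    - (\<Sum>i\<in>machines S. inertia S i * snd (y t) $ i)" for t
  have wM: "w t $ i = snd (y t) $ i" if "i \<in> machines S" for i t using that by (simp add: w_def)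
  have flow: "net.net_flow (x t) i = flow S (x t) i" if "0 \<le> t" for t i
    using net_flow_eq_flow_region[OF region[OF that]] by (simp add: x_def)
  have load: "0 = injection S i - flow S (x t) i" if "i \<in> loads S" "0 \<le> t" for i t
    using net.load_flow_load[OF that(1), of "fst (y t)"] flow[OF that(2), of i] by (simp add: x_def)
  have "continuous_on {0..} y"
    using y unfolding net.swing_solution_def
    by (meson continuous_on_eq_continuous_within has_vector_derivative_continuous)
  moreover obtain K where "K-lipschitz_on UNIV net.load_flow" using net.load_flow_lipschitz by blast
  then have "continuous_on UNIV net.load_flow" by (rule lipschitz_on_continuous_on)
  ultimately have cont: "continuous_on {0..} x"
    unfolding x_def using continuous_on_compose2[OF _ continuous_on_fst] by blast
  have "(x t, w t, \<eta> t, price c t) \<in> state_space S" for t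
    by (simp add: state_space_def x_def w_def net.load_flow_ref)
  moreover have "algebraic_eqs S (x t, w t, \<eta> t, price c t)" if "0 \<le> t" for t
  proof -
    have "total_control S (price c t) + gain S * ((\<Sum>i\<in>machines S. inertia S i * w t $ i) + \<eta> t) = 0"
      using gain_pos gain_\<eta>s by (simp add: wM \<eta>_def total_control_price algebra_simps)
    then show ?thesis using load[OF _ that] by (simp add: total_control_def)
  qed
  moreover have "((\<lambda>s. x s $ i) has_real_derivative \<phi>_rate S i (x t, w t, \<eta> t, price c t)) (at t within {0..})"
    if "0 \<le> t" "i \<in> machines S \<union> freq_devices S" for t i
  proof -
    have eq: "\<phi>_rate S i (x t, w t, \<eta> t, price c t) =
      (if i \<in> machines S then snd (y t) $ i - snd (y t) $ ref S
       else (injection S i - net.net_flow (x t) i + input c t i) / damping S i - snd (y t) $ ref S)"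
      using damping_pos[OF that(2)] ref_machine
      by (auto simp: wM flow[OF that(1)] input_def field_simps)
    show ?thesis
      unfolding eq unfolding x_def using that(1)
      by (intro net.swing_solution_load_flow[OF y _ that(2)]) simp
  qed
  moreover have w': "((\<lambda>s. snd (y s) $ i) has_real_derivative \<omega>_rate S i (x t, w t, \<eta> t, price c t)) (at t within {0..})"
    if "0 \<le> t" "i \<in> machines S" for t i
  proof -
    have eq: "\<omega>_rate S i (x t, w t, \<eta> t, price c t) =
      (injection S i - damping S i * snd (y t) $ i - net.net_flow (x t) i + input c t i) / inertia S i"
      by (simp add: wM[OF that(2)] flow[OF that(1)] input_def)
    show ?thesis
      unfolding eq unfolding x_def using that(1)
      by (intro net.swing_solution_snd[OF y _ that(2)]) simp
  qed
  then have "((\<lambda>s. w s $ i) has_real_derivative \<omega>_rate S i (x t, w t, \<eta> t, price c t)) (at t within {0..})"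
    if "0 \<le> t" "i \<in> machines S" for t i
    using that by (simp add: wM)
  moreover have "(\<eta> has_real_derivative \<eta>_rate S (x t, w t, \<eta> t, price c t)) (at t within {0..})"
    if t: "0 \<le> t" for t
  proof -
    let ?W = "\<Sum>i\<in>machines S. injection S i - damping S i * w t $ i - flow S (x t) i + control S i (price c t)"
    have "((\<lambda>s. \<Sum>i\<in>machines S. inertia S i * snd (y s) $ i) has_real_derivative
        (\<Sum>i\<in>machines S. inertia S i * \<omega>_rate S i (x t, w t, \<eta> t, price c t))) (at t within {0..})"
      by (intro DERIV_sum DERIV_cmult w'[OF t])
    moreover have "(\<Sum>i\<in>machines S. inertia S i * \<omega>_rate S i (x t, w t, \<eta> t, price c t)) = ?W"
      by (intro sum.cong refl) (use inertia_pos in force)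
    ultimately have I: "((\<lambda>s. \<Sum>i\<in>machines S. inertia S i * snd (y s) $ i) has_real_derivative ?W) (at t within {0..})"
      by simp
    have "((\<lambda>t. \<eta>s + c / gain S * exp (- gain S * t)) has_real_derivative
        c / gain S * (exp (- gain S * t) * (- gain S))) (at t within {0..})"
      using gain_pos by (auto intro!: derivative_eq_intros)
    from DERIV_diff[OF this I]
    have "(\<eta> has_real_derivative (c / gain S * (exp (- gain S * t) * (- gain S)) - ?W)) (at t within {0..})"
      unfolding \<eta>_def .
    moreover have "c / gain S * (exp (- gain S * t) * (- gain S)) - ?W = \<eta>_rate S (x t, w t, \<eta> t, price c t)"
    proof -
      have "c / gain S * (exp (- gain S * t) * (- gain S)) = total_control S (price c t) - total_control S ls"
        using gain_pos by (simp add: total_control_price)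
      also have "\<dots> = (\<Sum>i\<in>machines S. injection S i - flow S (x t) i + control S i (price c t))
          + (\<Sum>i\<in>freq_devices S. injection S i - flow S (x t) i + control S i (price c t))"
        using total_power[of "x t" "price c t"] load[OF _ t] by simp
      finally show ?thesis by (simp add: sum.distrib sum_subtractf)
    qed
    ultimately show ?thesis by simp
  qed
  moreover have "trajectory c y = (\<lambda>t. (x t, w t, \<eta> t, price c t))"
    by (simp add: trajectory_def x_def w_def \<eta>_def fun_eq_iff)
  moreover have "continuous_on {0..} (\<lambda>t. x t $ i)" for i
    using cont by (rule continuous_on_component)
  ultimately show ?thesis
    unfolding solution_on_def using price_continuous[of "{0..}" c]
    by (intro exI[of _ x] exI[of _ w] exI[of _ \<eta>] exI[of _ "price c"]) simp
qed

section \<open>Uniqueness of solutions\<close>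

lemma solution_momentum:
  assumes sol: "solution_on S I (\<lambda>t. (x t, w t, \<eta> t, l t))" and t: "t \<in> I"
  shows "((\<lambda>t. (\<Sum>i\<in>machines S. inertia S i * w t $ i) + \<eta> t) has_real_derivative
    - gain S * ((\<Sum>i\<in>machines S. inertia S i * w t $ i) + \<eta> t) + - total_control S ls) (at t within I)"
    (is "(?p has_real_derivative _) _")
    and "total_control S (l t) = - gain S * ((\<Sum>i\<in>machines S. inertia S i * w t $ i) + \<eta> t)"
proof -
  note alg = solution_onD(3)[OF sol t] and w' = solution_onD(5)[OF sol t]
    and \<eta>' = solution_onD(6)[OF sol t]
  show U: "total_control S (l t) = - gain S * ?p t"
    using alg by (simp add: total_control_def)
  have "(?p has_real_derivative (\<Sum>i\<in>machines S. inertia S i * \<omega>_rate S i (x t, w t, \<eta> t, l t))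
      + \<eta>_rate S (x t, w t, \<eta> t, l t)) (at t within I)"
    by (intro DERIV_add DERIV_sum DERIV_cmult w' \<eta>')
  moreover have "(\<Sum>i\<in>machines S. inertia S i * \<omega>_rate S i (x t, w t, \<eta> t, l t))
    = (\<Sum>i\<in>machines S. injection S i - damping S i * w t $ i - flow S (x t) i + control S i (l t))"
    by (intro sum.cong refl) (use inertia_pos in force)
  moreover have "\<dots> + \<eta>_rate S (x t, w t, \<eta> t, l t) = total_control S (l t) - total_control S ls"
    using total_power[of "x t" "l t"] alg by (simp add: sum.distrib sum_subtractf)
  ultimately show "(?p has_real_derivative - gain S * ?p t + - total_control S ls) (at t within I)"
    using U by simp
qed

lemma solution_price:
  assumes sol: "solution_on S {0..<T} (\<lambda>t. (x t, w t, \<eta> t, l t))" and t: "t \<in> {0..<T}"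
    and c: "c = gain S * ((\<Sum>i\<in>machines S. inertia S i * w 0 $ i) + \<eta> 0 - \<eta>s)"
  shows "(\<Sum>i\<in>machines S. inertia S i * w t $ i) + \<eta> t = \<eta>s + c / gain S * exp (- gain S * t)"
    and "l t = price c t"
proof -
  let ?p = "\<lambda>t. (\<Sum>i\<in>machines S. inertia S i * w t $ i) + \<eta> t"
  let ?e = "\<lambda>t. \<eta>s + c / gain S * exp (- gain S * t)"
  have lip: "\<bar>gain S\<bar>-lipschitz_on UNIV (\<lambda>p. - gain S * p)"
    by (rule lipschitz_onI) (simp_all add: dist_real_def abs_mult[symmetric] right_diff_distrib abs_minus_commute)
  have p': "(?p has_vector_derivative - gain S * ?p s + - total_control S ls) (at s within {0..t})"
    if "s \<in> {0..t}" for s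
  proof -
    have "(?p has_real_derivative - gain S * ?p s + - total_control S ls) (at s within {0..<T})"
      using that t by (intro solution_momentum(1)[OF sol]) auto
    then show ?thesis
      unfolding has_real_derivative_iff_has_vector_derivative
      by (rule has_vector_derivative_within_subset) (use t in auto)
  qed
  have e': "(?e has_vector_derivative - gain S * ?e s + - total_control S ls) (at s within {0..t})" for s
    unfolding has_real_derivative_iff_has_vector_derivative[symmetric]
    using gain_pos gain_\<eta>s by (auto intro!: derivative_eq_intros simp: algebra_simps)
  have init: "?p 0 = ?e 0" using gain_pos by (simp add: c)
  have "0 \<le> t" using t by simp
  from lipschitz_ode_unique[OF this lip p' e' init] show p: "?p t = ?e t" .
  have "total_control S (l t) = - gain S * ?p t" by (rule solution_momentum(2)[OF sol t])
  also have "\<dots> = total_control S ls - c * exp (- gain S * t)"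
    unfolding p using gain_\<eta>s gain_pos by (simp add: algebra_simps)
  finally show "l t = price c t" by (rule price_eqI)
qed

text \<open>
  As long as the angles of a solution stay in the region where the sine has not been modified, the
  solution is the one of the modified system.
\<close>

lemma solution_eq_while_in_region:
  assumes sol: "solution_on S {0..<T} (\<lambda>t. (x t, w t, \<eta> t, l t))" and t: "t \<in> {0..<T}"
    and price: "\<And>s. s \<in> {0..<T} \<Longrightarrow> l s = price c s"
    and region: "\<And>s i j. s \<in> {0..t} \<Longrightarrow> (i, j) \<in> edges S \<Longrightarrow> \<bar>x s $ i - x s $ j\<bar> \<le> r"
    and y: "net.swing_solution (input c) {0..} y" "y 0 = (x 0, w 0)"
  shows "x t = net.load_flow (fst (y t))" "w t = snd (y t)"
proof -
  \<comment> \<open>In the modified system the load entries stay at their initial values.\<close>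
  define a where "a s = (\<chi> i. if i \<in> loads S then x 0 $ i else x s $ i)" for s
  have st: "(x s, w s, \<eta> s, l s) \<in> state_space S" "algebraic_eqs S (x s, w s, \<eta> s, l s)"
    and x': "\<And>i. i \<in> machines S \<union> freq_devices S \<Longrightarrow>
      ((\<lambda>s. x s $ i) has_real_derivative \<phi>_rate S i (x s, w s, \<eta> s, l s)) (at s within {0..t})"
    and w': "\<And>i. i \<in> machines S \<Longrightarrow>
      ((\<lambda>s. w s $ i) has_real_derivative \<omega>_rate S i (x s, w s, \<eta> s, l s)) (at s within {0..t})"
    if "s \<in> {0..t}" for s
  proof -
    have s: "s \<in> {0..<T}" and sub: "{0..t} \<subseteq> {0..<T}" using that t by auto
    show "(x s, w s, \<eta> s, l s) \<in> state_space S" "algebraic_eqs S (x s, w s, \<eta> s, l s)"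
      using solution_onD(2,3)[OF sol s] .
    show "((\<lambda>s. x s $ i) has_real_derivative \<phi>_rate S i (x s, w s, \<eta> s, l s)) (at s within {0..t})"
      if "i \<in> machines S \<union> freq_devices S" for i
    proof (rule has_field_derivative_subset[OF _ sub])
      show "((\<lambda>s. x s $ i) has_real_derivative \<phi>_rate S i (x s, w s, \<eta> s, l s)) (at s within {0..<T})"
        by (rule solution_onD(4)[OF sol s that])
    qed
    show "((\<lambda>s. w s $ i) has_real_derivative \<omega>_rate S i (x s, w s, \<eta> s, l s)) (at s within {0..t})"
      if "i \<in> machines S" for i
    proof (rule has_field_derivative_subset[OF _ sub])
      show "((\<lambda>s. w s $ i) has_real_derivative \<omega>_rate S i (x s, w s, \<eta> s, l s)) (at s within {0..<T})"
        by (rule solution_onD(5)[OF sol s that])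
    qed
  qed
  have flow: "net.net_flow (x s) i = flow S (x s) i" if "s \<in> {0..t}" for s i
    using region[OF that] by (rule net_flow_eq_flow)
  have load_flow: "net.load_flow (a s) = x s" if "s \<in> {0..t}" for s
  proof (rule net.load_flow_unique)
    show "net.load_solution (a s) (x s)"
      using st[OF that] by (auto simp: net.load_solution_def a_def state_space_def flow[OF that])
  qed
  have w0: "w s $ i = 0" if "s \<in> {0..t}" "i \<notin> machines S" for s i
    using st(1)[OF that(1)] that(2) by (simp add: state_space_def)
  have "net.swing_solution (input c) {0..t} (\<lambda>s. (a s, w s))"
    unfolding net.swing_solution_def
  proof
    fix s assume s: "s \<in> {0..t}"
    let ?d = "net.drift (a s, w s) + net.drive (input c s)"
    have ls: "l s = price c s" using s t by (intro price) auto
    have a': "(a has_vector_derivative fst ?d) (at s within {0..t})"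
    proof (rule has_vector_derivative_vec)
      fix i
      show "((\<lambda>s. a s $ i) has_real_derivative fst ?d $ i) (at s within {0..t})"
      proof (cases "i \<in> loads S")
        case True
        then have "i \<notin> machines S" "i \<notin> freq_devices S" using disjoint by auto
        then show ?thesis using True by (simp add: a_def net.drift_def net.drive_def)
      next
        case False
        then have i: "i \<in> machines S \<union> freq_devices S" using cover by auto
        have "fst ?d $ i = \<phi>_rate S i (x s, w s, \<eta> s, l s)"
          using i disjoint damping_pos[OF i]
          by (auto simp: net.drift_def net.drive_def load_flow[OF s] flow[OF s] ls input_def field_simps)
        then show ?thesis using x'[OF s i] False by (simp add: a_def)
      qed
    qed
    have w': "(w has_vector_derivative snd ?d) (at s within {0..t})"
    proof (rule has_vector_derivative_vec)
      fix i
      show "((\<lambda>s. w s $ i) has_real_derivative snd ?d $ i) (at s within {0..t})"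
      proof (cases "i \<in> machines S")
        case True
        have "snd ?d $ i = \<omega>_rate S i (x s, w s, \<eta> s, l s)"
          using True inertia_pos[OF True]
          by (simp add: net.drift_def net.drive_def load_flow[OF s] flow[OF s] ls input_def field_simps)
        then show ?thesis using w'[OF s True] by simp
      next
        case False
        have "((\<lambda>s. w s $ i) has_real_derivative 0) (at s within {0..t})"
          by (rule has_field_derivative_transform_within[OF DERIV_const zero_less_one s])
             (simp add: w0[OF _ False])
        then show ?thesis using False by (simp add: net.drift_def net.drive_def)
      qed
    qed
    show "((\<lambda>s. (a s, w s)) has_vector_derivative ?d) (at s within {0..t})"
      using has_vector_derivative_Pair[OF a' w'] unfolding prod.collapse .
  qed
  moreover have "net.swing_solution (input c) {0..t} y"
    using y(1) by (rule net.swing_solution_subset) auto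
  moreover have "(a 0, w 0) = y 0" using y(2) by (simp add: a_def vec_eq_iff)
  moreover have t0: "0 \<le> t" using t by simp
  ultimately have eq: "(a t, w t) = y t"
    using net.swing_solution_unique[of t "input c" "\<lambda>s. (a s, w s)" y] by blast
  then show "w t = snd (y t)" by (metis snd_conv)
  show "x t = net.load_flow (fst (y t))"
    using eq load_flow[of t] t0 by (metis atLeastAtMost_iff fst_conv order_refl)
qed

lemma trajectory_unique:
  assumes sol: "solution_on S {0..<T} z" and t: "t \<in> {0..<T}"
    and y: "net.swing_solution (input c) {0..} y"
    and region: "\<And>t. 0 \<le> t \<Longrightarrow> net.load_flow (fst (y t)) \<in> angle_region r"
    and z0: "z 0 = (fst (y 0), snd (y 0), \<eta>0, l0)"
    and c: "c = gain S * ((\<Sum>i\<in>machines S. inertia S i * snd (y 0) $ i) + \<eta>0 - \<eta>s)"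
    and y0: "net.load_flow (fst (y 0)) = fst (y 0)"
  shows "z t = trajectory c y t"
proof -
  obtain x w \<eta> l where z: "z = (\<lambda>t. (x t, w t, \<eta> t, l t))"
    using sol unfolding solution_on_def by blast
  note sol = sol[unfolded z]
  have init: "x 0 = fst (y 0)" "w 0 = snd (y 0)" "\<eta> 0 = \<eta>0" using z0 by (auto simp: z)
  have c': "c = gain S * ((\<Sum>i\<in>machines S. inertia S i * w 0 $ i) + \<eta> 0 - \<eta>s)"
    by (simp add: c init)
  have price: "l s = price c s" if "s \<in> {0..<T}" for s
    by (rule solution_price(2)[OF sol that c'])
  have y0': "y 0 = (x 0, w 0)" by (simp add: init)
  note eq = solution_eq_while_in_region[OF sol _ price _ y y0']
  have cont: "continuous_on {0..<T} x"
  proof -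
    have "continuous_on {0..<T} (\<lambda>t. x t $ i)" for i
    proof (cases "i \<in> loads S")
      case True
      then show ?thesis by (rule solution_onD(1)[OF sol])
    next
      case False
      then have i: "i \<in> machines S \<union> freq_devices S" using cover by auto
      have "((\<lambda>s. x s $ i) has_real_derivative \<phi>_rate S i (x s, w s, \<eta> s, l s)) (at s within {0..<T})"
        if "s \<in> {0..<T}" for s
        using that i by (rule solution_onD(4)[OF sol])
      then show ?thesis by (rule DERIV_continuous_on)
    qed
    then have "continuous_on {0..<T} (\<lambda>t. \<chi> i. x t $ i)" by (rule continuous_on_vec_lambda)
    then show ?thesis by simp
  qed
  \<comment> \<open>At the first exit time the solution would still agree with the trajectory, which lies in the
    open region.\<close>
  have in_region: "x s \<in> angle_region r" if s: "s \<in> {0..t}" for s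
  proof (rule ccontr)
    assume "x s \<notin> angle_region r"
    define E where "E = {0..t} \<inter> x -` (- angle_region r)"
    have sub: "{0..t} \<subseteq> {0..<T}" using t by auto
    have "closed E"
      unfolding E_def using open_angle_region continuous_on_subset[OF cont sub]
      by (intro continuous_closed_preimage) auto
    then have "compact E" unfolding E_def by (metis compact_Icc compact_Int_closed inf.left_idem)
    moreover have "E \<noteq> {}" using s \<open>x s \<notin> angle_region r\<close> by (auto simp: E_def)
    ultimately obtain \<tau> where \<tau>: "\<tau> \<in> E" "\<And>\<sigma>. \<sigma> \<in> E \<Longrightarrow> \<tau> \<le> \<sigma>"
      using compact_attains_inf by metis
    have \<tau>t: "\<tau> \<in> {0..t}" "x \<tau> \<notin> angle_region r" using \<tau>(1) by (auto simp: E_def)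
    have before: "x \<sigma> \<in> angle_region r" if "\<sigma> \<in> {0..<\<tau>}" for \<sigma>
      using \<tau>(2)[of \<sigma>] \<tau>t that by (auto simp: E_def)
    have "x 0 \<in> angle_region r" using region[of 0] y0 init by simp
    then have pos: "0 < \<tau>" using \<tau>t by (metis atLeastAtMost_iff order_le_less)
    have "\<bar>x \<sigma> $ i - x \<sigma> $ j\<bar> \<le> r" if "\<sigma> \<in> {0..\<tau>}" "(i, j) \<in> edges S" for \<sigma> i j
    proof (rule continuous_le_on_closure[of "{0..<\<tau>}" "\<lambda>\<sigma>. \<bar>x \<sigma> $ i - x \<sigma> $ j\<bar>"])
      have "continuous_on {0..\<tau>} x" using \<tau>t t by (intro continuous_on_subset[OF cont]) auto
      then show "continuous_on (closure {0..<\<tau>}) (\<lambda>\<sigma>. \<bar>x \<sigma> $ i - x \<sigma> $ j\<bar>)"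
        using pos by (simp add: continuous_intros)
      show "\<sigma> \<in> closure {0..<\<tau>}" using that(1) pos by simp
      show "\<bar>x \<rho> $ i - x \<rho> $ j\<bar> \<le> r" if "\<rho> \<in> {0..<\<tau>}" for \<rho>
        using before[OF that] \<open>(i, j) \<in> edges S\<close> by (auto simp: angle_region_def less_imp_le)
    qed
    then have "x \<tau> = net.load_flow (fst (y \<tau>))"
      using \<tau>t t by (intro eq(1)) auto
    then show False using region[of \<tau>] \<tau>t by simp
  qed
  have le: "\<bar>x s $ i - x s $ j\<bar> \<le> r" if "s \<in> {0..t}" "(i, j) \<in> edges S" for s i j
    using in_region[OF that(1)] that(2) by (auto simp: angle_region_def less_imp_le)
  have "x t = net.load_flow (fst (y t))" "w t = snd (y t)"
    using eq[OF t _ le] by auto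
  moreover have "w t $ i = 0" if "i \<notin> machines S" for i
  proof -
    have "(x t, w t, \<eta> t, l t) \<in> state_space S"
      by (rule solution_onD(2)[OF sol t])
    then show ?thesis using that by (simp add: state_space_def)
  qed
  moreover have "\<eta> t = \<eta>s + c / gain S * exp (- gain S * t) - (\<Sum>i\<in>machines S. inertia S i * w t $ i)"
    using solution_price(1)[OF sol t c'] by linarith
  ultimately show ?thesis
    using price[OF t] by (simp add: z trajectory_def vec_eq_iff)
qed

end

section \<open>Convergence\<close>

context power_equilibrium
begin

lemma trajectory_converges:
  assumes "0 < a"
    and decay: "\<And>t. 0 \<le> t \<Longrightarrow>
      net.error zs (net.load_flow (fst (y t))) (snd (y t)) \<le> E * exp (- a * t)"
  shows "(trajectory c y \<longlongrightarrow> (zs, 0, \<eta>s, ls)) at_top"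
proof -
  let ?x = "\<lambda>t. net.load_flow (fst (y t))"
  let ?b = "\<lambda>t. sqrt (E * exp (- a * t))"
  have b: "(?b \<longlongrightarrow> 0) at_top"
    using tendsto_real_sqrt[OF exp_decay_tendsto[OF \<open>0 < a\<close>]] by simp
  have x: "(?x \<longlongrightarrow> zs) at_top"
  proof (rule Lim_null[THEN iffD2], rule Lim_null_comparison[OF _ b])
    show "\<forall>\<^sub>F t in at_top. norm (?x t - zs) \<le> ?b t"
      using eventually_ge_at_top[of 0]
    proof eventually_elim
      case (elim t)
      have "(norm (?x t - zs))\<^sup>2 \<le> E * exp (- a * t)"
        using decay[OF elim] sum_nonneg[of "machines S" "\<lambda>i. (snd (y t) $ i)\<^sup>2"]
        unfolding net.error_def by simp
      then show ?case by (rule real_le_rsqrt)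
    qed
  qed
  have w: "((\<lambda>t. snd (y t) $ i) \<longlongrightarrow> 0) at_top" if "i \<in> machines S" for i
  proof (rule Lim_null_comparison[OF _ b])
    show "\<forall>\<^sub>F t in at_top. norm (snd (y t) $ i) \<le> ?b t"
      using eventually_ge_at_top[of 0]
    proof eventually_elim
      case (elim t)
      have "(snd (y t) $ i)\<^sup>2 \<le> (\<Sum>i\<in>machines S. (snd (y t) $ i)\<^sup>2)"
        using that by (intro member_le_sum) auto
      moreover have "0 \<le> (norm (?x t - zs))\<^sup>2" by simp
      ultimately have "\<bar>snd (y t) $ i\<bar>\<^sup>2 \<le> E * exp (- a * t)"
        using decay[OF elim] unfolding net.error_def power2_abs by linarith
      then show ?case unfolding real_norm_def by (rule real_le_rsqrt)
    qed
  qed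
  have "((\<lambda>t. \<chi> i. if i \<in> machines S then snd (y t) $ i else 0) \<longlongrightarrow> 0) at_top"
  proof (rule vec_tendstoI)
    fix i
    show "((\<lambda>t. (\<chi> i. if i \<in> machines S then snd (y t) $ i else 0) $ i) \<longlongrightarrow> 0 $ i) at_top"
      by (cases "i \<in> machines S") (simp_all add: w)
  qed
  moreover have "((\<lambda>t. \<eta>s + c / gain S * exp (- gain S * t)
      - (\<Sum>i\<in>machines S. inertia S i * snd (y t) $ i)) \<longlongrightarrow> \<eta>s + 0 - (\<Sum>i\<in>machines S. inertia S i * 0)) at_top"
    by (intro tendsto_intros exp_decay_tendsto gain_pos w)
  ultimately show ?thesis
    unfolding trajectory_def using x price_tendsto by (intro tendsto_Pair) simp_all
qed

text \<open>
  The radius of the basin is chosen such that the exponential bound keeps the angles inside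
  \<open>angle_region r\<close> for all times.
\<close>

lemma basin:
  obtains \<rho> where "0 < \<rho>"
    "\<And>z0. z0 \<in> Psi S \<Longrightarrow> dist (zs, 0, \<eta>s, ls) z0 < \<rho> \<Longrightarrow> algebraic_eqs S z0 \<Longrightarrow>
       \<exists>z. is_trajectory_from S z0 z \<and> (z \<longlongrightarrow> (zs, 0, \<eta>s, ls)) at_top"
proof -
  obtain \<delta> where \<delta>: "0 < \<delta>" "\<And>x. dist zs x < \<delta> \<Longrightarrow> x \<in> angle_region r"
    using open_angle_region zs_region by (metis open_contains_ball mem_ball subsetD)
  obtain C a where C: "0 < C" and a: "0 < a" and decay: "\<And>z v u q y t.
    z $ ref S = 0 \<Longrightarrow> \<forall>i\<in>loads S. net.net_flow z i = injection S i \<Longrightarrow>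
    \<forall>i\<in>machines S \<union> freq_devices S. injection S i - net.net_flow z i + v i = 0 \<Longrightarrow>
    net.swing_solution u {0..} y \<Longrightarrow>
    \<forall>t\<ge>0. (q has_real_derivative - gain S * q t) (at t within {0..}) \<Longrightarrow>
    \<forall>t\<ge>0. \<forall>i\<in>machines S \<union> freq_devices S. \<bar>u t i - v i\<bar> \<le> \<bar>q t\<bar> \<Longrightarrow> 0 \<le> t \<Longrightarrow>
    net.error z (net.load_flow (fst (y t))) (snd (y t))
       \<le> C * exp (- a * t) * (net.error z (net.load_flow (fst (y 0))) (snd (y 0)) + (q 0)\<^sup>2)"
    by (rule net.error_exponential_decay[OF gain_pos], rule that)
  define Mtot where "Mtot = (\<Sum>i\<in>machines S. inertia S i)"
  have Mtot: "0 \<le> Mtot" unfolding Mtot_def using inertia_pos by (intro sum_nonneg less_imp_le)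
  \<comment> \<open>\<open>H \<rho>\<^sup>2\<close> bounds the initial error plus the square of the initial deviation of the total control.\<close>
  define H where "H = 2 + (gain S * (Mtot + 1))\<^sup>2"
  have H: "0 < H" by (simp add: H_def add_pos_nonneg)
  define \<rho> where "\<rho> = \<delta> / (1 + C * H)"
  have CH: "0 < C * H" using C H by simp
  have \<rho>: "0 < \<rho>" "\<rho> \<le> \<delta>" "C * H * \<rho>\<^sup>2 < \<delta>\<^sup>2"
  proof -
    show "0 < \<rho>" using \<delta>(1) CH by (simp add: \<rho>_def)
    show "\<rho> \<le> \<delta>" using \<delta>(1) CH by (simp add: \<rho>_def divide_le_eq)
    have "C * H < (1 + C * H)\<^sup>2"
      unfolding power2_sum one_power2 using CH zero_le_power2[of "C * H"] by linarith
    then have "C * H * \<rho>\<^sup>2 < (1 + C * H)\<^sup>2 * \<rho>\<^sup>2" using \<open>0 < \<rho>\<close> by (intro mult_strict_right_mono) auto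
    also have "\<dots> = \<delta>\<^sup>2" using CH by (simp add: \<rho>_def power_mult_distrib[symmetric])
    finally show "C * H * \<rho>\<^sup>2 < \<delta>\<^sup>2" .
  qed
  have "\<exists>z. is_trajectory_from S z0 z \<and> (z \<longlongrightarrow> (zs, 0, \<eta>s, ls)) at_top"
    if z0: "z0 \<in> Psi S" "dist (zs, 0, \<eta>s, ls) z0 < \<rho>" "algebraic_eqs S z0" for z0
  proof -
    obtain x0 w0 \<eta>0 l0 where z0_eq: "z0 = (x0, w0, \<eta>0, l0)" by (cases z0) auto
    have dist: "dist zs x0 < \<rho>" "norm w0 < \<rho>" "\<bar>\<eta>0 - \<eta>s\<bar> < \<rho>"
    proof -
      have 1: "dist zs x0 \<le> dist (zs, 0 :: real ^ 'n, \<eta>s, ls) z0"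
        using dist_fst_le[of "(zs, 0 :: real ^ 'n, \<eta>s, ls)" z0] by (simp add: z0_eq)
      have 2: "dist (0 :: real ^ 'n, \<eta>s, ls) (w0, \<eta>0, l0) \<le> dist (zs, 0 :: real ^ 'n, \<eta>s, ls) z0"
        using dist_snd_le[of "(zs, 0 :: real ^ 'n, \<eta>s, ls)" z0] by (simp add: z0_eq)
      have 3: "dist 0 w0 \<le> dist (0 :: real ^ 'n, \<eta>s, ls) (w0, \<eta>0, l0)"
        using dist_fst_le[of "(0 :: real ^ 'n, \<eta>s, ls)" "(w0, \<eta>0, l0)"] by simp
      have 4: "dist (\<eta>s, ls) (\<eta>0, l0) \<le> dist (0 :: real ^ 'n, \<eta>s, ls) (w0, \<eta>0, l0)"
        using dist_snd_le[of "(0 :: real ^ 'n, \<eta>s, ls)" "(w0, \<eta>0, l0)"] by simp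
      have 5: "dist \<eta>s \<eta>0 \<le> dist (\<eta>s, ls) (\<eta>0, l0)"
        using dist_fst_le[of "(\<eta>s, ls)" "(\<eta>0, l0)"] by simp
      show "dist zs x0 < \<rho>" "norm w0 < \<rho>" "\<bar>\<eta>0 - \<eta>s\<bar> < \<rho>"
        using 1 2 3 4 5 z0(2) by (simp_all add: dist_real_def abs_minus_commute)
    qed
    define c where "c = gain S * ((\<Sum>i\<in>machines S. inertia S i * w0 $ i) + \<eta>0 - \<eta>s)"
    obtain y where y: "y 0 = (x0, w0)" "net.swing_solution (input c) {0..} y"
      using swing_solution_exists by blast
    have x0_region: "x0 \<in> angle_region r" using \<delta>(2) dist(1) \<rho>(2) by simp
    have load_flow0: "net.load_flow x0 = x0"
    proof (rule net.load_flow_unique)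
      show "net.load_solution x0 x0"
        using z0(1,3) net_flow_eq_flow_region[OF x0_region]
        by (auto simp: net.load_solution_def z0_eq Psi_def Phi_def)
    qed
    have zs_flow: "net.net_flow zs i = flow S zs i" for i
      by (rule net_flow_eq_flow_region[OF zs_region])
    define q where "q t = c * exp (- gain S * t)" for t
    define E where "E = C * (net.error zs x0 w0 + c\<^sup>2)"
    have bound: "net.error zs (net.load_flow (fst (y t))) (snd (y t)) \<le> E * exp (- a * t)"
      if "0 \<le> t" for t
    proof -
      have "\<forall>i\<in>loads S. net.net_flow zs i = injection S i"
      proof
        fix i assume "i \<in> loads S"
        then show "net.net_flow zs i = injection S i"
          using balance[of i] control_load[of i ls] by (simp add: zs_flow)
      qed
      moreover have "\<forall>t\<ge>0. (q has_real_derivative - gain S * q t) (at t within {0..})"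
        unfolding q_def by (auto intro!: derivative_eq_intros)
      moreover have "\<forall>t\<ge>0. \<forall>i\<in>machines S \<union> freq_devices S. \<bar>input c t i - control S i ls\<bar> \<le> \<bar>q t\<bar>"
        using input_diff by (simp add: q_def)
      moreover have "\<forall>i\<in>machines S \<union> freq_devices S. injection S i - net.net_flow zs i + control S i ls = 0"
        using balance by (simp add: zs_flow)
      ultimately have "net.error zs (net.load_flow (fst (y t))) (snd (y t))
        \<le> C * exp (- a * t) * (net.error zs (net.load_flow (fst (y 0))) (snd (y 0)) + (q 0)\<^sup>2)"
        using decay[OF zs_ref _ _ y(2) _ _ \<open>0 \<le> t\<close>, of "\<lambda>i. control S i ls" q] by blast
      then show ?thesis by (simp add: y(1) load_flow0 E_def q_def mult.commute mult.left_commute)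
    qed
    have E: "0 \<le> E" "E < \<delta>\<^sup>2"
    proof -
      have "(norm (x0 - zs))\<^sup>2 \<le> \<rho>\<^sup>2"
        using dist(1) by (intro power_mono) (simp_all add: dist_norm norm_minus_commute)
      moreover have "(\<Sum>i\<in>machines S. (w0 $ i)\<^sup>2) \<le> \<rho>\<^sup>2"
      proof -
        have "(\<Sum>i\<in>machines S. (w0 $ i)\<^sup>2) \<le> (norm w0)\<^sup>2"
          unfolding net.norm_power2_eq_sum by (rule sum_mono2) auto
        also have "\<dots> \<le> \<rho>\<^sup>2" using dist(2) by (intro power_mono) auto
        finally show ?thesis .
      qed
      moreover have "c\<^sup>2 \<le> (gain S * (Mtot + 1))\<^sup>2 * \<rho>\<^sup>2"
      proof -
        have "\<bar>\<Sum>i\<in>machines S. inertia S i * w0 $ i\<bar> \<le> (\<Sum>i\<in>machines S. inertia S i * \<rho>)"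
        proof (rule order_trans[OF sum_abs sum_mono])
          fix i assume i: "i \<in> machines S"
          have "\<bar>w0 $ i\<bar> \<le> \<rho>" using component_le_norm_cart[of w0 i] dist(2) by linarith
          then show "\<bar>inertia S i * w0 $ i\<bar> \<le> inertia S i * \<rho>"
            using inertia_pos[OF i] by (simp add: abs_mult)
        qed
        also have "\<dots> = Mtot * \<rho>" by (simp add: Mtot_def sum_distrib_right)
        finally have "\<bar>(\<Sum>i\<in>machines S. inertia S i * w0 $ i) + \<eta>0 - \<eta>s\<bar> \<le> (Mtot + 1) * \<rho>"
          using dist(3) by (simp add: distrib_right)
        then have "\<bar>c\<bar> \<le> gain S * ((Mtot + 1) * \<rho>)"
          unfolding c_def abs_mult using gain_pos by (simp add: mult_left_mono)
        then have "\<bar>c\<bar>\<^sup>2 \<le> (gain S * ((Mtot + 1) * \<rho>))\<^sup>2" by (intro power_mono) auto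
        then show ?thesis by (simp add: power_mult_distrib mult.assoc)
      qed
      ultimately have "net.error zs x0 w0 + c\<^sup>2 \<le> H * \<rho>\<^sup>2"
        unfolding net.error_def H_def distrib_right by linarith
      then have "E \<le> C * (H * \<rho>\<^sup>2)" unfolding E_def using C by (intro mult_left_mono) auto
      then show "E < \<delta>\<^sup>2" using \<rho>(3) by (simp add: mult.assoc)
      show "0 \<le> E" unfolding E_def using C net.error_nonneg[of zs x0 w0] by simp
    qed
    have region: "net.load_flow (fst (y t)) \<in> angle_region r" if "0 \<le> t" for t
    proof (rule \<delta>(2))
      have "(norm (net.load_flow (fst (y t)) - zs))\<^sup>2 \<le> net.error zs (net.load_flow (fst (y t))) (snd (y t))"
        unfolding net.error_def by (simp add: sum_nonneg)
      also have "\<dots> \<le> E * exp (- a * t)" by (rule bound[OF that])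
      also have "\<dots> \<le> E" using E(1) a that by (simp add: mult_left_le)
      also have "\<dots> < \<delta>\<^sup>2" by (rule E(2))
      finally have "norm (net.load_flow (fst (y t)) - zs) < \<delta>"
        by (rule power2_less_imp_less) (use \<delta>(1) in simp)
      then show "dist zs (net.load_flow (fst (y t))) < \<delta>" by (simp add: dist_norm norm_minus_commute)
    qed
    have start: "trajectory c y 0 = z0"
    proof -
      have "l0 = price c 0"
      proof (rule price_eqI)
        have "total_control S l0 = - gain S * ((\<Sum>i\<in>machines S. inertia S i * w0 $ i) + \<eta>0)"
          using z0(3) by (simp add: z0_eq total_control_def)
        then show "total_control S l0 = total_control S ls - c * exp (- gain S * 0)"
          using gain_\<eta>s by (simp add: c_def algebra_simps)
      qed
      moreover have "(\<chi> i. if i \<in> machines S then w0 $ i else 0) = w0"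
        using z0(1) by (auto simp: z0_eq Psi_def vec_eq_iff)
      moreover have "c / gain S = (\<Sum>i\<in>machines S. inertia S i * w0 $ i) + \<eta>0 - \<eta>s"
        using gain_pos by (simp add: c_def)
      ultimately show ?thesis
        unfolding trajectory_def y(1) fst_conv snd_conv load_flow0 z0_eq by simp
    qed
    have "is_trajectory_from S z0 (trajectory c y)"
      unfolding is_trajectory_from_def
    proof (intro conjI allI impI ballI)
      show "solution_on S {0..} (trajectory c y)"
        by (rule trajectory_solution[OF y(2) region])
      show "trajectory c y 0 = z0" by (rule start)
      fix T z t assume "0 < T" and z: "solution_on S {0..<T} z \<and> z 0 = z0" and t: "t \<in> {0..<T}"
      show "z t = trajectory c y t"
      proof (rule trajectory_unique[OF _ t y(2) region])
        show "solution_on S {0..<T} z" using z by blast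
        show "z 0 = (fst (y 0), snd (y 0), \<eta>0, l0)" using z by (simp add: z0_eq y(1))
        show "c = gain S * ((\<Sum>i\<in>machines S. inertia S i * snd (y 0) $ i) + \<eta>0 - \<eta>s)"
          by (simp add: c_def y(1))
        show "net.load_flow (fst (y 0)) = fst (y 0)" by (simp add: y(1) load_flow0)
      qed
    qed
    then show ?thesis using trajectory_converges[OF a bound] by blast
  qed
  then show thesis using that \<rho>(1) by blast
qed

end

theorem theorem2:
  fixes S :: "'n::finite power_system"
  assumes "well_formed S"
    and "balance_feasible S"
    and "admissible_costs S"
    and "has_synchronous_state S"
  shows "\<exists>z_star.
     (z_star \<in> Psi S \<and> equilibrium S z_star \<and>
      (\<forall>z \<in> Psi S. equilibrium S z \<longrightarrow> z = z_star)) \<and>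
     (\<exists>Psi_d. Psi_d \<subseteq> Psi S \<and> z_star \<in> Psi_d \<and>
        openin (top_of_set (Psi S)) Psi_d \<and> connected Psi_d \<and>
        (\<forall>z0 \<in> Psi_d. algebraic_eqs S z0 \<longrightarrow>
           (\<exists>z. is_trajectory_from S z0 z \<and> (z \<longlongrightarrow> z_star) at_top)))"
proof -
  interpret regulated_system S using assms(1,3) by unfold_locales
  obtain zs ls where zs: "zs \<in> Phi S"
    and balance: "\<And>i. injection S i - flow S zs i + control S i ls = 0"
    using synchronous_state_balance[OF assms(4)] by blast
  have "zs \<in> Theta S" "zs $ ref S = 0" using zs by (auto simp: Phi_def)
  obtain r where r: "0 \<le> r" "r < pi / 2" "zs \<in> angle_region r"
    using \<open>zs \<in> Theta S\<close> by (rule Theta_angle_region)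
  interpret power_equilibrium S r zs ls
    using r \<open>zs $ ref S = 0\<close> balance by unfold_locales auto
  let ?z = "(zs, 0, \<eta>s, ls) :: 'n state"
  have z_Psi: "?z \<in> Psi S" using zs by (simp add: Psi_def)
  have z_eq: "equilibrium S ?z"
    using balance gain_\<eta>s by (simp add: equilibrium_iff[OF z_Psi])
  obtain \<rho> where \<rho>: "0 < \<rho>"
    "\<And>z0. z0 \<in> Psi S \<Longrightarrow> dist ?z z0 < \<rho> \<Longrightarrow> algebraic_eqs S z0 \<Longrightarrow>
       \<exists>z. is_trajectory_from S z0 z \<and> (z \<longlongrightarrow> ?z) at_top"
    using basin by blast
  have "connected (Psi S \<inter> ball ?z \<rho>)"
    by (intro convex_connected convex_Int convex_Psi convex_ball)
  moreover have "openin (top_of_set (Psi S)) (Psi S \<inter> ball ?z \<rho>)"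
    by (rule openin_open_Int) simp
  ultimately have "\<exists>Psi_d. Psi_d \<subseteq> Psi S \<and> ?z \<in> Psi_d \<and>
        openin (top_of_set (Psi S)) Psi_d \<and> connected Psi_d \<and>
        (\<forall>z0 \<in> Psi_d. algebraic_eqs S z0 \<longrightarrow>
           (\<exists>z. is_trajectory_from S z0 z \<and> (z \<longlongrightarrow> ?z) at_top))"
    using \<rho> z_Psi by (intro exI[of _ "Psi S \<inter> ball ?z \<rho>"]) auto
  then show ?thesis
    using z_Psi z_eq equilibrium_unique by (intro exI[of _ ?z] conjI ballI impI) blast+
qed

end
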